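(* For every knot $K$, the Reidemeister graphs $\mathcal{G}(K)$ and $\mathcal{G}_S(K)$ are not planar.
   Context: Knots are unoriented knot types in $S^3$. $\mathcal{G}(K)$ (resp. $\mathcal{G}_S(K)$) is the graph whose vertices are the diagrams of $K$ on $\mathbb{R}^2$ up to planar isotopy (resp. on $S^2$ up to isotopy of $S^2$), with one edge for each single Reidemeister move (of type 1, 2 or 3, all variants allowed) relating two diagrams; different moves between the same diagrams give different edges, and moves coinciding up to isotopy give a single edge. *)

theory Defs
  imports "HOL-Analysis.Analysis"
begin

section \<open>Knot types in the 3-sphere\<close>

text \<open>
  The plane is the type \<open>complex\<close>, 3-space is \<open>complex \<times> real\<close>, and the 3-sphere is the
  unit sphere of \<open>(complex \<times> real) \<times> real\<close>.
\<close>

abbreviation S1 :: "complex set" where "S1 \<equiv> sphere 0 1"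
abbreviation S2 :: "(complex \<times> real) set" where "S2 \<equiv> sphere 0 1"
abbreviation S3 :: "((complex \<times> real) \<times> real) set" where "S3 \<equiv> sphere 0 1"

definition ambient_isotopy :: "'a::topological_space set \<Rightarrow> (real \<Rightarrow> 'a \<Rightarrow> 'a) \<Rightarrow> bool" where
  "ambient_isotopy X H \<longleftrightarrow>
     continuous_on ({0..1} \<times> X) (\<lambda>(t, x). H t x) \<and>
     (\<forall>t\<in>{0..1}. \<exists>g. homeomorphism X X (H t) g) \<and>
     (\<forall>x\<in>X. H 0 x = x)"

definition ambient_isotopic :: "'a::topological_space set \<Rightarrow> 'a set \<Rightarrow> 'a set \<Rightarrow> bool" where
  "ambient_isotopic X k k' \<longleftrightarrow> (\<exists>H. ambient_isotopy X H \<and> H 1 ` k = k')"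

text \<open>Inverse stereographic projection from the north pole, an embedding of 3-space in \<open>S3\<close>.\<close>

definition stereo :: "complex \<times> real \<Rightarrow> (complex \<times> real) \<times> real" where
  "stereo x = ((2 / (1 + (norm x)\<^sup>2)) *\<^sub>R x, ((norm x)\<^sup>2 - 1) / (1 + (norm x)\<^sup>2))"

definition polygonal_knot :: "(complex \<times> real) set \<Rightarrow> bool" where
  "polygonal_knot P \<longleftrightarrow>
     P homeomorphic S1 \<and> (\<exists>S. finite S \<and> P = (\<Union>(a, b)\<in>S. closed_segment a b))"

text \<open>As usual, knots are tame.  They are subsets of \<open>S3\<close>, hence unoriented.\<close>

definition tame_knot :: "((complex \<times> real) \<times> real) set \<Rightarrow> bool" where
  "tame_knot k \<longleftrightarrow> (\<exists>P. polygonal_knot P \<and> ambient_isotopic S3 (stereo ` P) k)"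

definition knot_types :: "((complex \<times> real) \<times> real) set set set" where
  "knot_types = {k. tame_knot k} // {(k, k'). tame_knot k \<and> tame_knot k' \<and> ambient_isotopic S3 k k'}"


section \<open>Diagrams\<close>

text \<open>
  A diagram on a surface \<open>F\<close> is a closed curve, parametrised by \<open>S1\<close> (its values elsewhere are
  irrelevant), with finitely many multiple points, all of them transverse double points, together
  with the set of those parameters at which the curve runs over a crossing.
\<close>

datatype 'a diagram = Diagram (curve: "complex \<Rightarrow> 'a") (overs: "complex set")

text \<open>
  Topological transversality at a double point: in a local chart, the two branches lie on
  the two coordinate axes (and thus each runs along its axis, both being locally injective).
\<close>

definition transverse_at ::
  "'a::topological_space set \<Rightarrow> (complex \<Rightarrow> 'a) \<Rightarrow> complex \<Rightarrow> complex \<Rightarrow> bool" where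
  "transverse_at F \<gamma> s t \<longleftrightarrow>
     (\<exists>U h g A B. openin (top_of_set F) U \<and> homeomorphism U (ball (0::complex) 1) h g \<and>
        openin (top_of_set S1) A \<and> s \<in> A \<and> \<gamma> ` A \<subseteq> U \<and> (\<forall>a\<in>A. Im (h (\<gamma> a)) = 0) \<and>
        openin (top_of_set S1) B \<and> t \<in> B \<and> \<gamma> ` B \<subseteq> U \<and> (\<forall>b\<in>B. Re (h (\<gamma> b)) = 0))"

definition double_params :: "(complex \<Rightarrow> 'a) \<Rightarrow> complex set" where
  "double_params \<gamma> = {s\<in>S1. \<exists>t\<in>S1. t \<noteq> s \<and> \<gamma> t = \<gamma> s}"

definition is_diagram :: "'a::topological_space set \<Rightarrow> 'a diagram \<Rightarrow> bool" where
  "is_diagram F D \<longleftrightarrow>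
     continuous_on S1 (curve D) \<and> curve D ` S1 \<subseteq> F \<and>
     finite (double_params (curve D)) \<and>
     (\<forall>s\<in>S1. card {t\<in>S1. curve D t = curve D s} \<le> 2) \<and>
     overs D \<subseteq> double_params (curve D) \<and>
     (\<forall>s\<in>S1. \<forall>t\<in>S1. s \<noteq> t \<and> curve D s = curve D t \<longrightarrow>
        transverse_at F (curve D) s t \<and> (s \<in> overs D \<longleftrightarrow> t \<notin> overs D))"

text \<open>The map \<open>h\<close> of the surface carries \<open>D\<close> to \<open>E\<close>, up to a reparametrisation of the circle
  which may reverse its orientation.\<close>

definition carries :: "('a \<Rightarrow> 'a) \<Rightarrow> 'a diagram \<Rightarrow> 'a diagram \<Rightarrow> bool" where
  "carries h D E \<longleftrightarrow>
     (\<exists>\<phi> \<psi>. homeomorphism S1 S1 \<phi> \<psi> \<and>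
        (\<forall>s\<in>S1. curve E (\<phi> s) = h (curve D s)) \<and> \<phi> ` overs D = overs E)"

definition isotopic_diagrams :: "'a::topological_space set \<Rightarrow> 'a diagram \<Rightarrow> 'a diagram \<Rightarrow> bool" where
  "isotopic_diagrams F D E \<longleftrightarrow> (\<exists>H. ambient_isotopy F H \<and> carries (H 1) D E)"

text \<open>
  A diagram represents the knots in \<open>S3\<close> obtained by separating the branches at each crossing
  in the direction normal to \<open>F\<close>.  The parameter \<open>L\<close> embeds \<open>F \<times> \<real>\<close> in \<open>S3\<close>, the last
  coordinate being the height.
\<close>

definition diagram_of ::
  "'a::topological_space set \<Rightarrow> ('a \<Rightarrow> real \<Rightarrow> (complex \<times> real) \<times> real) \<Rightarrow>
   ((complex \<times> real) \<times> real) set set \<Rightarrow> 'a diagram \<Rightarrow> bool" where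
  "diagram_of F L K D \<longleftrightarrow>
     is_diagram F D \<and>
     (\<exists>z. continuous_on S1 z \<and>
        (\<forall>s\<in>S1. \<forall>t\<in>S1. s \<noteq> t \<and> curve D s = curve D t \<and> s \<in> overs D \<longrightarrow> z t < z s) \<and>
        (\<lambda>s. L (curve D s) (z s)) ` S1 \<in> K)"

definition plane_lift :: "complex \<Rightarrow> real \<Rightarrow> (complex \<times> real) \<times> real" where
  "plane_lift p z = stereo (p, z)"

text \<open>On the sphere, the height is the logarithm of the distance to the centre, so that overpasses
  are on the outside.\<close>

definition sphere_lift :: "complex \<times> real \<Rightarrow> real \<Rightarrow> (complex \<times> real) \<times> real" where
  "sphere_lift p z = stereo (exp z *\<^sub>R p)"


section \<open>Reidemeister moves\<close>

text \<open>
  The local pictures live in the closed unit disc and consist of finitely many strands,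
  each parametrised by \<open>{-1..1}\<close>; \<open>(i, s)\<close> is the point with parameter \<open>s\<close> on strand \<open>i\<close>.
\<close>

datatype tangle = Tangle (strands: "(real \<Rightarrow> complex) list") (tovers: "(nat \<times> real) set")

abbreviation tangle_params :: "tangle \<Rightarrow> (nat \<times> real) set" where
  "tangle_params T \<equiv> {..<length (strands T)} \<times> {-1..1}"

text \<open>Strand \<open>i\<close> runs at level \<open>lev i\<close>, for strands without self-crossings.\<close>

definition layered :: "(real \<Rightarrow> complex) list \<Rightarrow> (nat \<Rightarrow> nat) \<Rightarrow> tangle" where
  "layered ps lev = Tangle ps
     {(i, s). i < length ps \<and> s \<in> {-1..1} \<and>
        (\<exists>j<length ps. \<exists>t\<in>{-1..1}. (ps ! j) t = (ps ! i) s \<and> lev j < lev i)}"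

text \<open>The nodal cubic below crosses itself for \<open>s = \<plusminus> 1 / sqrt 2\<close> only.  Mirror images of the
  pictures need not be listed, as the charts below may reverse the orientation.\<close>

definition R1_moves :: "(tangle \<times> tangle) set" where
  "R1_moves =
     {(Tangle [\<lambda>s. Complex s 0] {},
       Tangle [\<lambda>s. Complex (2 * s ^ 3 - s) ((1 - s\<^sup>2) / 2)] {(0, c)}) | c.
      c = 1 / sqrt 2 \<or> c = - 1 / sqrt 2}"

text \<open>The two crossed strands are the parabolas \<open>y = \<plusminus> (3/5 - 6/5 * s\<^sup>2)\<close> with \<open>x = 4/5 * s\<close>.\<close>

definition R2_moves :: "(tangle \<times> tangle) set" where
  "R2_moves =
     {(layered [\<lambda>s. Complex (4/5 * s) (-3/5), \<lambda>s. Complex (4/5 * s) (3/5)] lev,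
       layered [\<lambda>s. Complex (4/5 * s) (3/5 - 6/5 * s\<^sup>2),
                \<lambda>s. Complex (4/5 * s) (6/5 * s\<^sup>2 - 3/5)] lev) | lev. inj lev}"

text \<open>The last strand is moved across the crossing of the first two, which is at the origin.\<close>

definition R3_moves :: "(tangle \<times> tangle) set" where
  "R3_moves =
     {(layered [\<lambda>s. Complex (4/5 * s) (3/5 * s), \<lambda>s. Complex (4/5 * s) (-3/5 * s),
                \<lambda>s. Complex s ((s\<^sup>2 - 1) / 2)] lev,
       layered [\<lambda>s. Complex (4/5 * s) (3/5 * s), \<lambda>s. Complex (4/5 * s) (-3/5 * s),
                \<lambda>s. Complex s ((1 - s\<^sup>2) / 2)] lev) | lev. inj lev}"

definition local_moves :: "(tangle \<times> tangle) set" where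
  "local_moves = R1_moves \<union> R2_moves \<union> R3_moves"

text \<open>Through the chart \<open>\<theta>\<close> of a disc and the parametrisation \<open>\<alpha>\<close> of the pieces of the
  diagram \<open>D\<close> contained in that disc, \<open>D\<close> looks like \<open>T\<close>.\<close>

definition looks_like ::
  "'a diagram \<Rightarrow> 'a set \<Rightarrow> ('a \<Rightarrow> complex) \<Rightarrow> (nat \<times> real \<Rightarrow> complex) \<Rightarrow> tangle \<Rightarrow> bool" where
  "looks_like D B \<theta> \<alpha> T \<longleftrightarrow>
     (\<forall>(i, s)\<in>tangle_params T.
        curve D (\<alpha> (i, s)) \<in> B \<and> \<theta> (curve D (\<alpha> (i, s))) = (strands T ! i) s \<and>
        (\<alpha> (i, s) \<in> overs D \<longleftrightarrow> (i, s) \<in> tovers T))"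

text \<open>
  A move \<open>(D, D', B)\<close> replaces \<open>D\<close> by \<open>D'\<close> within the disc \<open>B\<close>.  That both diagrams use the
  same parameters inside \<open>B\<close> and the same parametrisation outside \<open>B\<close> is no restriction, as
  diagrams matter up to reparametrisation only.
\<close>

type_synonym 'a move = "'a diagram \<times> 'a diagram \<times> 'a set"

definition reidemeister_move :: "'a::topological_space set \<Rightarrow> 'a move \<Rightarrow> bool" where
  "reidemeister_move F = (\<lambda>(D, D', B).
     is_diagram F D \<and> is_diagram F D' \<and> B \<subseteq> F \<and>
     (\<exists>T T' \<theta> \<theta>' \<alpha>.
        ((T, T') \<in> local_moves \<or> (T', T) \<in> local_moves) \<and>
        homeomorphism B (cball (0::complex) 1) \<theta> \<theta>' \<and>
        \<alpha> ` tangle_params T \<subseteq> S1 \<and> inj_on \<alpha> (tangle_params T) \<and>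
        (\<forall>i<length (strands T). continuous_on {-1..1} (\<lambda>s. \<alpha> (i, s))) \<and>
        looks_like D B \<theta> \<alpha> T \<and> looks_like D' B \<theta> \<alpha> T' \<and>
        (\<forall>s\<in>S1 - \<alpha> ` tangle_params T.
           curve D s \<notin> B \<and> curve D' s = curve D s \<and> (s \<in> overs D' \<longleftrightarrow> s \<in> overs D))))"

text \<open>
  Two moves coincide up to isotopy if isotopies of the surface match their discs and their
  diagrams before and after the move; the final maps of the two isotopies may differ inside
  the disc only.  A move and its inverse are the same (undirected) edge.
\<close>

definition isotopic_moves :: "'a::topological_space set \<Rightarrow> 'a move \<Rightarrow> 'a move \<Rightarrow> bool" where
  "isotopic_moves F = (\<lambda>(D, D', B) (E, E', C).
     \<exists>H H'. ambient_isotopy F H \<and> ambient_isotopy F H' \<and>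
        H 1 ` B = C \<and> H' 1 ` B = C \<and> (\<forall>x\<in>F - B. H 1 x = H' 1 x) \<and>
        carries (H 1) D E \<and> carries (H' 1) D' E')"

definition same_move :: "'a::topological_space set \<Rightarrow> 'a move \<Rightarrow> 'a move \<Rightarrow> bool" where
  "same_move F m m' \<longleftrightarrow>
     isotopic_moves F m m' \<or> isotopic_moves F m (case m' of (E, E', C) \<Rightarrow> (E', E, C))"


section \<open>Planar multigraphs and the Reidemeister graphs\<close>

text \<open>Undirected multigraphs; an edge has one end if it is a loop, and two ends otherwise.\<close>

datatype ('v, 'e) multigraph =
  Multigraph (vertices: "'v set") (edges: "'e set") (ends: "'e \<Rightarrow> 'v set")

text \<open>A graph is planar if it can be drawn in the plane without crossings.  A simple path may
  be closed, which is the case here exactly for loops.\<close>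

definition planar :: "('v, 'e) multigraph \<Rightarrow> bool" where
  "planar G \<longleftrightarrow>
     (\<exists>(pos :: 'v \<Rightarrow> complex) (draw :: 'e \<Rightarrow> real \<Rightarrow> complex).
        inj_on pos (vertices G) \<and>
        (\<forall>e\<in>edges G. simple_path (draw e) \<and>
           {pathstart (draw e), pathfinish (draw e)} = pos ` ends G e \<and>
           draw e ` {0<..<1} \<inter> pos ` vertices G = {}) \<and>
        (\<forall>e\<in>edges G. \<forall>e'\<in>edges G. e \<noteq> e' \<longrightarrow> draw e ` {0<..<1} \<inter> draw e' ` {0<..<1} = {}))"

definition reidemeister_graph ::
  "'a::topological_space set \<Rightarrow> ('a \<Rightarrow> real \<Rightarrow> (complex \<times> real) \<times> real) \<Rightarrow>
   ((complex \<times> real) \<times> real) set set \<Rightarrow> ('a diagram set, 'a move set) multigraph" where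
  "reidemeister_graph F L K =
     (let X = {D. diagram_of F L K D};
          r = {(D, E). D \<in> X \<and> E \<in> X \<and> isotopic_diagrams F D E};
          M = {(D, D', B). D \<in> X \<and> D' \<in> X \<and> reidemeister_move F (D, D', B)};
          q = {(m, m'). m \<in> M \<and> m' \<in> M \<and> same_move F m m'}
      in Multigraph (X // r) (M // q) (\<lambda>e. \<Union>(D, D', B)\<in>e. {r `` {D}, r `` {D'}}))"

definition plane_reidemeister_graph ::
  "((complex \<times> real) \<times> real) set set \<Rightarrow> (complex diagram set, complex move set) multigraph" where
  "plane_reidemeister_graph K = reidemeister_graph UNIV plane_lift K"

definition sphere_reidemeister_graph ::
  "((complex \<times> real) \<times> real) set set \<Rightarrow>
   ((complex \<times> real) diagram set, (complex \<times> real) move set) multigraph" where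
  "sphere_reidemeister_graph K = reidemeister_graph S2 sphere_lift K"

end

theory Submission
  imports Defs
begin

text \<open>
  Wherever a diagram contains a straight strand, a Reidemeister move of type 1 inserts a curl, and the
  loop of the curl contains a straight strand again.  If the height increases along the strand, then
  the knot type does not change: at every height, the new point of the knot can be pushed
  back to the old one within its horizontal disc.  Four curls at disjoint places can be inserted
  independently, which gives a 4-cube of moves.  It contains a subdivision of the complete bipartite
  graph on 3 + 3 vertices, and this is not planar, because no point of the plane can be joined to
  the three branches of a theta curve.

  It remains to tell the 16 diagrams of the cube apart.  A crossing cuts the circle of parameters into
  two arcs; the number of crossings for which one of the arcs contains exactly \<open>2 * k\<close> parameters of
  crossings is invariant under isotopy.  In a nest of \<open>k\<close> curls, each in the loop of the previous one,
  these numbers of parameters are 0, 2, ..., \<open>2 * (k - 1)\<close>, and one more curl in the innermost loop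
  adds \<open>2 * k\<close>.  Hence curls are added to nests of 0, 1, 2 and 3 curls; two more nests
  of 4 curls make sure that the complementary arcs are longer.

  A first diagram is obtained by projecting a polygonal knot in a direction in general position.  On the
  sphere, the same diagram arises by central projection from a point far below the knot.
\<close>

section \<open>Ambient isotopies\<close>

text \<open>Three cube directions would not suffice, since the 3-cube is planar. The crossings of
  the initial diagram are unknown, so the sixteen diagrams are only compared with each other: old
  crossings contribute the same number to all of them, because a loop of an old crossing that
  contains the curled strand is too long to be counted. The deep nests are two in number because one
  of them must lie outside the nest under consideration. A curl has its overpass at the later of its
  node parameters, so a height that increases along the strand stays correct after the insertion:
  all diagrams of the cube share a single \<open>z\<close>, and the isotopy of \<open>S3\<close>
  only moves positions in the surface. On the sphere the height is the logarithm of the distance to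
  the centre, which in the perspective view depends on the planar position as well; this is why the
  planar strand is placed on a ray, along which the norm increases too. Edges of the cube need no
  invariant of their own, since they differ in their ends.\<close>

lemma ambient_isotopy_bij:
  assumes "ambient_isotopy X H" "t \<in> {0..1}"
  shows "bij_betw (H t) X X"
  using assms unfolding ambient_isotopy_def homeomorphism_def bij_betw_def inj_on_def
  by metis

text \<open>A continuous bijection of a compact Hausdorff space is a homeomorphism, so the inverses
  of the stages need no continuity proof.\<close>

lemma ambient_isotopy_compactI:
  fixes X :: "'a::t2_space set"
  assumes X: "compact X"
    and cont: "continuous_on ({0..1} \<times> X) (\<lambda>(t, x). H t x)"
    and bij: "\<And>t. t \<in> {0..1} \<Longrightarrow> bij_betw (H t) X X"
    and "\<And>x. x \<in> X \<Longrightarrow> H 0 x = x"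
  shows "ambient_isotopy X H"
  unfolding ambient_isotopy_def
proof (intro conjI ballI)
  fix t :: real assume t: "t \<in> {0..1}"
  have "continuous_on X ((\<lambda>(t, x). H t x) \<circ> (\<lambda>x. (t, x)))"
    by (rule continuous_on_compose; intro continuous_intros continuous_on_subset[OF cont])
      (use t in auto)
  then have "continuous_on X (H t)" by (simp add: o_def)
  then show "\<exists>g. homeomorphism X X (H t) g"
    using homeomorphism_compact[OF X, of "H t" X] bij[OF t] by (auto simp: bij_betw_def)
qed (use assms in auto)

text \<open>Running the isotopy backwards involves the inverse of \<open>H 1\<close> only, whereas the continuity in \<open>t\<close> of the
  inverses of all the \<open>H t\<close> would require invariance of domain.\<close>

lemma ambient_isotopy_inverse:
  assumes H: "ambient_isotopy X H"
  obtains G where "ambient_isotopy X G" "\<And>x. x \<in> X \<Longrightarrow> G 1 (H 1 x) = x"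
    "\<And>x. x \<in> X \<Longrightarrow> H 1 (G 1 x) = x"
proof -
  obtain g where g: "homeomorphism X X (H 1) g"
    using H unfolding ambient_isotopy_def by force
  define G where "G = (\<lambda>t x. H (1 - t) (g x))"
  have gX: "g x \<in> X" "H 1 (g x) = x" "g (H 1 x) = x" "H 1 x \<in> X" if "x \<in> X" for x
    using g that unfolding homeomorphism_def by blast+
  have cg: "continuous_on X g" using g by (simp add: homeomorphism_def)
  have "ambient_isotopy X G"
    unfolding ambient_isotopy_def
  proof (intro conjI ballI)
    have c: "continuous_on ({0..1} \<times> X) (\<lambda>(t, x). H t x)"
      using H by (simp add: ambient_isotopy_def)
    have "continuous_on ({0..1} \<times> X) ((\<lambda>(t, x). H t x) \<circ> (\<lambda>p. (1 - fst p, g (snd p))))"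
      by (rule continuous_on_compose;
          intro continuous_intros continuous_on_subset[OF c] continuous_on_compose2[OF cg])
        (auto simp: gX)
    then show "continuous_on ({0..1} \<times> X) (\<lambda>(t, x). G t x)"
      by (simp add: o_def G_def case_prod_beta)
  next
    fix t :: real assume "t \<in> {0..1}"
    then have "1 - t \<in> {0..1}" by auto
    then obtain k where k: "homeomorphism X X (H (1 - t)) k"
      using H unfolding ambient_isotopy_def by metis
    have "homeomorphism X X (H (1 - t) \<circ> g) (H 1 \<circ> k)"
      using homeomorphism_compose[OF homeomorphism_symD[OF g] k] .
    then show "\<exists>g. homeomorphism X X (G t) g"
      by (auto simp: G_def o_def)
  next
    fix x assume "x \<in> X"
    then show "G 0 x = x" by (simp add: G_def gX)
  qed
  moreover have "G 1 x = g x" if "x \<in> X" for x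
    using H gX that by (simp add: G_def ambient_isotopy_def)
  ultimately show ?thesis using that[of G] gX by simp
qed

text \<open>The stages are composed at equal times; running one isotopy after the other would
  require gluing at an intermediate time.\<close>

lemma ambient_isotopy_compose:
  assumes H: "ambient_isotopy X H" and G: "ambient_isotopy X G"
  obtains L where "ambient_isotopy X L" "\<And>x. x \<in> X \<Longrightarrow> L 1 x = G 1 (H 1 x)"
proof -
  define L where "L = (\<lambda>t x. G t (H t x))"
  have HX: "H t x \<in> X" if "x \<in> X" "t \<in> {0..1}" for t x
    using ambient_isotopy_bij[OF H that(2)] that(1) by (auto simp: bij_betw_def)
  have cH: "continuous_on ({0..1} \<times> X) (\<lambda>p. H (fst p) (snd p))"
    and cG: "continuous_on ({0..1} \<times> X) (\<lambda>p. G (fst p) (snd p))"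
    using H G by (simp_all add: ambient_isotopy_def case_prod_beta)
  have "ambient_isotopy X L"
    unfolding ambient_isotopy_def
  proof (intro conjI ballI)
    have "continuous_on ({0..1} \<times> X) ((\<lambda>p. G (fst p) (snd p)) \<circ> (\<lambda>p. (fst p, H (fst p) (snd p))))"
      by (rule continuous_on_compose; intro continuous_intros cH continuous_on_subset[OF cG])
        (auto simp: HX)
    then show "continuous_on ({0..1} \<times> X) (\<lambda>(t, x). L t x)"
      by (simp add: o_def L_def case_prod_beta)
  next
    fix t :: real assume "t \<in> {0..1}"
    then obtain h g where "homeomorphism X X (H t) h" "homeomorphism X X (G t) g"
      using H G unfolding ambient_isotopy_def by metis
    then have "homeomorphism X X (G t \<circ> H t) (h \<circ> g)"
      by (rule homeomorphism_compose)
    then show "\<exists>g. homeomorphism X X (L t) g"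
      by (auto simp: L_def o_def)
  next
    fix x assume "x \<in> X"
    then show "L 0 x = x" using H G by (simp add: L_def ambient_isotopy_def)
  qed
  then show ?thesis using that[of L] by (simp add: L_def)
qed

lemma ambient_isotopic_sym:
  assumes "ambient_isotopic X k k'" "k \<subseteq> X"
  shows "ambient_isotopic X k' k"
proof -
  obtain H where H: "ambient_isotopy X H" "H 1 ` k = k'"
    using assms(1) by (auto simp: ambient_isotopic_def)
  obtain G where G: "ambient_isotopy X G" "\<And>x. x \<in> X \<Longrightarrow> G 1 (H 1 x) = x"
    using ambient_isotopy_inverse[OF H(1)] by metis
  have "G 1 ` k' = k"
    using G(2) assms(2) unfolding H(2)[symmetric] image_image by force
  then show ?thesis using G(1) by (auto simp: ambient_isotopic_def)
qed

lemma ambient_isotopic_trans: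
  assumes "ambient_isotopic X k k'" "ambient_isotopic X k' k''" "k \<subseteq> X"
  shows "ambient_isotopic X k k''"
proof -
  obtain H G where H: "ambient_isotopy X H" "H 1 ` k = k'"
    and G: "ambient_isotopy X G" "G 1 ` k' = k''"
    using assms(1,2) by (auto simp: ambient_isotopic_def)
  obtain L where L: "ambient_isotopy X L" "\<And>x. x \<in> X \<Longrightarrow> L 1 x = G 1 (H 1 x)"
    using ambient_isotopy_compose[OF H(1) G(1)] by metis
  have "L 1 ` k = k''"
    unfolding G(2)[symmetric] H(2)[symmetric] image_image
    using L(2) assms(3) by (intro image_cong) auto
  then show ?thesis using L(1) by (auto simp: ambient_isotopic_def)
qed

lemma ambient_isotopic_subset:
  assumes "ambient_isotopic X k k'" "k \<subseteq> X"
  shows "k' \<subseteq> X"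
proof -
  obtain H where H: "ambient_isotopy X H" "H 1 ` k = k'"
    using assms(1) by (auto simp: ambient_isotopic_def)
  have "bij_betw (H 1) X X" using ambient_isotopy_bij[OF H(1), of 1] by simp
  then show ?thesis using H(2) assms(2) by (auto simp: bij_betw_def)
qed

section \<open>Knot types as isotopy classes of polygons\<close>

lemma norm_stereo: "norm (stereo x) = 1"
proof -
  define r where "r = (norm x)\<^sup>2"
  have r: "r \<ge> 0" by (simp add: r_def)
  have "(norm (stereo x))\<^sup>2 = (2 / (1 + r) * norm x)\<^sup>2 + ((r - 1) / (1 + r))\<^sup>2"
    using r by (simp add: stereo_def norm_Pair r_def[symmetric] power_divide)
  also have "\<dots> = (4 * r + (r - 1)\<^sup>2) / (1 + r)\<^sup>2"
    by (simp add: power_mult_distrib power_divide r_def[symmetric] add_divide_distrib)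
  also have "\<dots> = 1"
    using r by (auto simp: power2_eq_square algebra_simps divide_simps) (smt (verit) mult_nonneg_nonneg)
  finally show ?thesis by (simp add: power2_eq_1_iff) (smt (verit) norm_ge_zero)
qed

lemma stereo_in_S3: "stereo x \<in> S3"
  by (simp add: norm_stereo)

lemma tame_knot_subset: "tame_knot k \<Longrightarrow> k \<subseteq> S3"
  unfolding tame_knot_def using ambient_isotopic_subset stereo_in_S3
  by (metis image_subset_iff)

text \<open>Tameness is itself an isotopy from a polygonal knot. Hence isotopic images of a tame
  knot are tame, and a class consists of all isotopic images of one polygon.\<close>

lemma knot_types_polygonal:
  assumes "K \<in> knot_types"
  obtains P where "polygonal_knot P" "\<And>k. ambient_isotopic S3 (stereo ` P) k \<Longrightarrow> k \<in> K"
    "\<And>k. k \<in> K \<Longrightarrow> ambient_isotopic S3 (stereo ` P) k"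
proof -
  obtain k0 where k0: "tame_knot k0"
    "K = {(k, k'). tame_knot k \<and> tame_knot k' \<and> ambient_isotopic S3 k k'} `` {k0}"
    using assms by (auto simp: knot_types_def quotient_def)
  obtain P where P: "polygonal_knot P" "ambient_isotopic S3 (stereo ` P) k0"
    using k0(1) by (auto simp: tame_knot_def)
  have PS: "stereo ` P \<subseteq> S3" using stereo_in_S3 by blast
  show ?thesis
  proof (rule that[OF P(1)])
    fix k assume k: "ambient_isotopic S3 (stereo ` P) k"
    then have "ambient_isotopic S3 k0 k"
      using ambient_isotopic_trans[OF ambient_isotopic_sym[OF P(2) PS] k]
        tame_knot_subset[OF k0(1)] by simp
    then show "k \<in> K" using k P(1) k0 by (auto simp: tame_knot_def)
  next
    fix k assume "k \<in> K"
    then show "ambient_isotopic S3 (stereo ` P) k"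
      using k0(2) ambient_isotopic_trans[OF P(2) _ PS] by auto
  qed
qed

lemma knot_types_isotopic:
  assumes "K \<in> knot_types" "k \<in> K" "ambient_isotopic S3 k k'"
  shows "k' \<in> K"
  using knot_types_polygonal[OF assms(1)] ambient_isotopic_trans[OF _ assms(3)] assms(2) stereo_in_S3
  by (metis image_subset_iff)


section \<open>Isotopic diagrams\<close>

lemma carries_inverse:
  assumes "carries h D E" "curve D ` S1 \<subseteq> F" "\<And>x. x \<in> F \<Longrightarrow> g (h x) = x"
    "overs D \<subseteq> S1"
  shows "carries g E D"
proof -
  obtain \<phi> \<psi> where *: "homeomorphism S1 S1 \<phi> \<psi>"
    "\<And>s. s \<in> S1 \<Longrightarrow> curve E (\<phi> s) = h (curve D s)" "\<phi> ` overs D = overs E"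
    using assms(1) by (auto simp: carries_def)
  have \<psi>: "\<psi> s \<in> S1" "\<phi> (\<psi> s) = s" if "s \<in> S1" for s
    using *(1) that unfolding homeomorphism_def by blast+
  have \<phi>: "\<psi> (\<phi> s) = s" if "s \<in> S1" for s
    using *(1) that unfolding homeomorphism_def by blast
  have "curve D (\<psi> s) = g (curve E s)" if "s \<in> S1" for s
    using *(2)[OF \<psi>(1)[OF that]] assms(2,3) \<psi>[OF that]
    by (metis image_subset_iff)
  moreover have "\<psi> ` overs E = overs D"
    unfolding *(3)[symmetric] image_image using \<phi> assms(4) by force
  ultimately show ?thesis
    unfolding carries_def using homeomorphism_symD[OF *(1)] by blast
qed

lemma carries_compose:
  assumes "carries h D E" "carries g E E'"
  shows "carries (g \<circ> h) D E'"
proof -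
  obtain \<phi> \<psi> where *: "homeomorphism S1 S1 \<phi> \<psi>"
    "\<And>s. s \<in> S1 \<Longrightarrow> curve E (\<phi> s) = h (curve D s)" "\<phi> ` overs D = overs E"
    using assms(1) by (auto simp: carries_def)
  obtain \<phi>' \<psi>' where **: "homeomorphism S1 S1 \<phi>' \<psi>'"
    "\<And>s. s \<in> S1 \<Longrightarrow> curve E' (\<phi>' s) = g (curve E s)" "\<phi>' ` overs E = overs E'"
    using assms(2) by (auto simp: carries_def)
  have "\<phi> s \<in> S1" if "s \<in> S1" for s
    using *(1) that unfolding homeomorphism_def by blast
  then have "homeomorphism S1 S1 (\<phi>' \<circ> \<phi>) (\<psi> \<circ> \<psi>')"
    "\<And>s. s \<in> S1 \<Longrightarrow> curve E' ((\<phi>' \<circ> \<phi>) s) = (g \<circ> h) (curve D s)"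
    "(\<phi>' \<circ> \<phi>) ` overs D = overs E'"
    using homeomorphism_compose[OF *(1) **(1)] * ** by (simp_all only: image_comp[symmetric] o_apply)
  then show ?thesis unfolding carries_def by blast
qed

lemma carries_cong:
  assumes "carries h D E" "curve D ` S1 \<subseteq> F" "\<And>x. x \<in> F \<Longrightarrow> g x = h x"
  shows "carries g D E"
proof -
  have "g (curve D s) = h (curve D s)" if "s \<in> S1" for s
    using assms(2,3) that by blast
  then show ?thesis using assms(1) unfolding carries_def by metis
qed

lemma is_diagram_subset:
  assumes "is_diagram F D"
  shows "curve D ` S1 \<subseteq> F" "overs D \<subseteq> S1"
  using assms by (auto simp: is_diagram_def double_params_def)

lemma isotopic_diagrams_refl: "isotopic_diagrams F D D"
proof -
  have "ambient_isotopy F (\<lambda>t x. x)"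
    unfolding ambient_isotopy_def case_prod_beta
    by (intro conjI ballI continuous_intros) (use homeomorphism_ident[of F] in auto)
  moreover have "carries (\<lambda>x. x) D D"
    unfolding carries_def by (intro exI[of _ "\<lambda>x. x"]) (auto simp: homeomorphism_ident)
  ultimately show ?thesis unfolding isotopic_diagrams_def by blast
qed

lemma isotopic_diagrams_sym:
  assumes "isotopic_diagrams F D E" "is_diagram F D"
  shows "isotopic_diagrams F E D"
proof -
  obtain H where H: "ambient_isotopy F H" "carries (H 1) D E"
    using assms(1) by (auto simp: isotopic_diagrams_def)
  obtain G where "ambient_isotopy F G" "\<And>x. x \<in> F \<Longrightarrow> G 1 (H 1 x) = x"
    using ambient_isotopy_inverse[OF H(1)] by metis
  then show ?thesis
    using carries_inverse[OF H(2)] is_diagram_subset[OF assms(2)]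
    unfolding isotopic_diagrams_def by blast
qed

lemma isotopic_diagrams_trans:
  assumes "isotopic_diagrams F D E" "isotopic_diagrams F E E'" "is_diagram F D"
  shows "isotopic_diagrams F D E'"
proof -
  obtain H G where H: "ambient_isotopy F H" "carries (H 1) D E"
    and G: "ambient_isotopy F G" "carries (G 1) E E'"
    using assms(1,2) by (auto simp: isotopic_diagrams_def)
  obtain L where L: "ambient_isotopy F L" "\<And>x. x \<in> F \<Longrightarrow> L 1 x = G 1 (H 1 x)"
    using ambient_isotopy_compose[OF H(1) G(1)] by metis
  have "carries (L 1) D E'"
    by (rule carries_cong[OF carries_compose[OF H(2) G(2)]])
      (use is_diagram_subset[OF assms(3)] L(2) in auto)
  then show ?thesis using L(1) unfolding isotopic_diagrams_def by blast
qed


section \<open>Theta curves in the plane\<close>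

definition arc_between :: "(real \<Rightarrow> complex) \<Rightarrow> complex \<Rightarrow> complex \<Rightarrow> bool" where
  "arc_between c a b \<longleftrightarrow> arc c \<and> pathstart c = a \<and> pathfinish c = b"

lemma arc_between_ends: "arc_between c a b \<Longrightarrow> a \<in> path_image c \<and> b \<in> path_image c \<and> a \<noteq> b"
  by (metis arc_between_def arc_distinct_ends pathfinish_in_path_image pathstart_in_path_image)

lemma arc_between_interior_nonempty:
  assumes "arc_between c a b"
  shows "path_image c - {a, b} \<noteq> {}"
  using nonempty_simple_path_endless[of c] assms by (auto simp: arc_between_def arc_imp_simple_path)

text \<open>The first arc followed by the reversed second one is a simple closed curve, to which the
  Jordan curve theorem applies; the closures follow because the curve is the frontier of both
  sides.\<close>

lemma two_arcs_Jordan: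
  assumes "arc_between c a b" "arc_between d a b" "path_image c \<inter> path_image d = {a, b}"
  defines "C \<equiv> path_image c \<union> path_image d"
  shows "compact C" "inside C \<noteq> {}" "open (inside C)" "connected (inside C)" "bounded (inside C)"
    "open (outside C)" "connected (outside C)"
    "inside C \<inter> outside C = {}" "inside C \<union> outside C = - C"
    "closure (inside C) = inside C \<union> C" "closure (outside C) = outside C \<union> C"
proof -
  let ?l = "c +++ reversepath d"
  have "simple_path ?l"
    by (rule simple_path_join_loop) (use assms in \<open>auto simp: arc_between_def arc_reversepath\<close>)
  moreover have "pathfinish ?l = pathstart ?l"
    using assms by (auto simp: arc_between_def)
  moreover have "path_image ?l = C"
    using assms by (simp add: C_def path_image_join arc_between_def)
  ultimately have *: "inside C \<noteq> {} \<and> open (inside C) \<and> connected (inside C) \<and> outside C \<noteq> {} \<and>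
      open (outside C) \<and> connected (outside C) \<and> bounded (inside C) \<and> \<not> bounded (outside C) \<and>
      inside C \<inter> outside C = {} \<and> inside C \<union> outside C = - C \<and>
      frontier (inside C) = C \<and> frontier (outside C) = C"
    using Jordan_inside_outside[of ?l] by simp
  then show "inside C \<noteq> {}" "open (inside C)" "connected (inside C)" "bounded (inside C)"
    "open (outside C)" "connected (outside C)"
    "inside C \<inter> outside C = {}" "inside C \<union> outside C = - C" by auto
  show "closure (inside C) = inside C \<union> C" "closure (outside C) = outside C \<union> C"
    using * closure_Un_frontier[of "inside C"] closure_Un_frontier[of "outside C"] by auto
  show "compact C"
    using assms(1,2) unfolding C_def arc_between_def by (intro compact_Un compact_arc_image) auto
qed

lemma connected_in_side:
  assumes "open I" "open O'" "I \<union> O' = - C" "I \<inter> O' = {}"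
    and "connected G" "G \<inter> C = {}" "z \<in> G" "z \<in> I"
  shows "G \<subseteq> I"
proof (rule ccontr)
  assume "\<not> G \<subseteq> I"
  then have "O' \<inter> G \<noteq> {}" using assms(3,6) by blast
  moreover have "I \<inter> G \<noteq> {}" using assms(7,8) by blast
  ultimately show False
    using connectedD[OF assms(5,1,2)] assms(3,4,6) by blast
qed

text \<open>If no arc entered the inside of the other two, the three insides would be pairwise
  disjoint. Two of them, glued along their common arc, would then not separate the plane, so that
  the rest of the plane would be confined to the third, bounded one.\<close>

lemma theta_one_arc_inside:
  assumes c1: "arc_between c1 a b" and c2: "arc_between c2 a b" and c3: "arc_between c3 a b"
    and i12: "path_image c1 \<inter> path_image c2 = {a, b}"
    and i13: "path_image c1 \<inter> path_image c3 = {a, b}"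
    and i23: "path_image c2 \<inter> path_image c3 = {a, b}"
    and o1: "path_image c1 \<inter> inside (path_image c2 \<union> path_image c3) = {}"
    and o2: "path_image c2 \<inter> inside (path_image c1 \<union> path_image c3) = {}"
    and o3: "path_image c3 \<inter> inside (path_image c1 \<union> path_image c2) = {}"
  shows False
proof -
  let ?c1 = "path_image c1" and ?c2 = "path_image c2" and ?c3 = "path_image c3"
  define I12 where "I12 = inside (?c1 \<union> ?c2)"
  define I13 where "I13 = inside (?c1 \<union> ?c3)"
  define I23 where "I23 = inside (?c2 \<union> ?c3)"
  note J12 = two_arcs_Jordan[OF c1 c2 i12, folded I12_def]
  note J13 = two_arcs_Jordan[OF c1 c3 i13, folded I13_def]
  note J23 = two_arcs_Jordan[OF c2 c3 i23, folded I23_def]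
  note o = o1[folded I23_def] o2[folded I13_def] o3[folded I12_def]
  have ends: "a \<in> ?c1" "b \<in> ?c1" "a \<in> ?c2" "b \<in> ?c2"
    using arc_between_ends[OF c1] arc_between_ends[OF c2] by auto
  \<comment> \<open>If two insides met, one would be contained in the other, and passing to closures
    would put the arc \<open>c\<close> into \<open>I' \<union> C'\<close>; but part of
    \<open>c\<close> lies in neither set.\<close>
  have disj: "I \<inter> I' = {}"
    if I: "connected I" "I \<inter> C' = {}" "closure I = I \<union> C" and I': "open I'" "open O'" "I' \<union> O' = - C'"
      "I' \<inter> O' = {}" "closure I' = I' \<union> C'" and c: "c \<subseteq> C" "c \<inter> I' = {}" "c - C' \<noteq> {}"
    for I I' O' C C' c :: "complex set"
  proof (rule ccontr)
    assume "I \<inter> I' \<noteq> {}"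
    then obtain z where "z \<in> I" "z \<in> I'" by blast
    then have "I \<subseteq> I'" using connected_in_side[OF I'(1,2,3,4) I(1,2)] by blast
    then have "I \<union> C \<subseteq> I' \<union> C'" using closure_mono[of I I'] I(3) I'(5) by simp
    then show False using c by blast
  qed
  have ne1: "?c1 - (?c2 \<union> ?c3) \<noteq> {}"
    using arc_between_interior_nonempty[OF c1] i12 i13 by blast
  have ne2: "?c2 - (?c1 \<union> ?c3) \<noteq> {}"
    using arc_between_interior_nonempty[OF c2] i12 i23 by blast
  have c: "I12 \<inter> (?c1 \<union> ?c2 \<union> ?c3) = {}" "I13 \<inter> (?c1 \<union> ?c2 \<union> ?c3) = {}"
    "I23 \<inter> (?c1 \<union> ?c2 \<union> ?c3) = {}"
    using J12(9) J13(9) J23(9) o by blast+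
  have d: "I12 \<inter> I23 = {}" "I12 \<inter> I13 = {}" "I13 \<inter> I23 = {}"
  proof -
    show "I12 \<inter> I23 = {}"
      by (rule disj[OF J12(4) _ J12(10) J23(3,6,9,8,10), of ?c1]) (use c ne1 in blast)+
    show "I12 \<inter> I13 = {}"
      by (rule disj[OF J12(4) _ J12(10) J13(3,6,9,8,10), of ?c2]) (use c ne2 in blast)+
    show "I13 \<inter> I23 = {}"
      by (rule disj[OF J13(4) _ J13(10) J23(3,6,9,8,10), of ?c1]) (use c ne1 in blast)+
  qed
  define S where "S = I12 \<union> (?c1 \<union> ?c2)"
  define T where "T = I13 \<union> (?c1 \<union> ?c3)"
  have S: "compact S" and T: "compact T"
    using compact_closure[of I12] compact_closure[of I13] J12(5,10) J13(5,10) by (auto simp: S_def T_def)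
  have "S \<inter> T = ?c1"
    unfolding S_def T_def using c d i12 i13 i23 by blast
  then have conn: "connected (S \<inter> T)"
    using c1 connected_path_image arc_imp_path by (auto simp: arc_between_def)
  have cS: "- S = outside (?c1 \<union> ?c2)" and cT: "- T = outside (?c1 \<union> ?c3)"
    unfolding S_def T_def using J12(8,9) J13(8,9) by blast+
  \<comment> \<open>By Janiszewski's theorem: neither \<open>S\<close> nor \<open>T\<close>
    separates the plane, and their intersection is the connected arc \<open>c1\<close>. The
    complement of the union meets \<open>I23\<close> but not its boundary, hence would be contained
    in that bounded set.\<close>
  have "connected (- (S \<union> T))"
    by (rule Janiszewski_connected[OF S compact_imp_closed[OF T] conn])
      (simp_all add: cS cT J12 J13)
  obtain p where p: "p \<in> I23" using J23(2) by blast
  have "bounded (S \<union> T \<union> I23)"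
    using S T J23(5) by (simp add: compact_imp_bounded)
  then obtain q where q: "q \<notin> S \<union> T \<union> I23"
    by (metis UNIV_eq_I not_bounded_UNIV)
  have "- (S \<union> T) \<subseteq> I23"
  proof (rule connected_in_side[OF J23(3,6,9,8)])
    show "connected (- (S \<union> T))" by fact
    show "- (S \<union> T) \<inter> (?c2 \<union> ?c3) = {}" by (auto simp: S_def T_def)
    show "p \<in> - (S \<union> T)" using p c d by (auto simp: S_def T_def)
  qed (fact p)
  then show False using q by blast
qed

text \<open>The arc \<open>c3\<close> splits the inside of the closed curve formed by
  \<open>c1\<close> and \<open>c2\<close>, which leaves three faces, each having only two arcs on
  its boundary. The set that should lead from \<open>z\<close> to the interior of the missing arc
  stays in the face of \<open>z\<close>, and so its closure does not reach that arc.\<close>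

lemma theta_separation_aux:
  assumes c1: "arc_between c1 a b" and c2: "arc_between c2 a b" and c3: "arc_between c3 a b"
    and i12: "path_image c1 \<inter> path_image c2 = {a, b}"
    and i13: "path_image c1 \<inter> path_image c3 = {a, b}"
    and i23: "path_image c2 \<inter> path_image c3 = {a, b}"
    and inn: "path_image c3 \<inter> inside (path_image c1 \<union> path_image c2) \<noteq> {}"
    and G: "\<And>G. G \<in> {G1, G2, G3} \<Longrightarrow> connected G \<and> z \<in> G \<and>
      G \<inter> (path_image c1 \<union> path_image c2 \<union> path_image c3) = {}"
    and p: "p1 \<in> path_image c1 - {a, b}" "p2 \<in> path_image c2 - {a, b}" "p3 \<in> path_image c3 - {a, b}"
    and cl: "p1 \<in> closure G1" "p2 \<in> closure G2" "p3 \<in> closure G3"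
  shows False
proof -
  let ?c1 = "path_image c1" and ?c2 = "path_image c2" and ?c3 = "path_image c3"
  have split: "inside (?c1 \<union> ?c3) \<inter> inside (?c2 \<union> ?c3) = {}"
    "inside (?c1 \<union> ?c3) \<union> inside (?c2 \<union> ?c3) \<union> (?c3 - {a, b}) = inside (?c1 \<union> ?c2)"
    using split_inside_simple_closed_curve[of c1 a b c2 c3] c1 c2 c3 arc_between_ends[OF c1]
      i12 i13 i23 inn by (auto simp: arc_between_def arc_imp_simple_path)
  note J12 = two_arcs_Jordan[OF c1 c2 i12]
  note J13 = two_arcs_Jordan[OF c1 c3 i13]
  note J23 = two_arcs_Jordan[OF c2 c3 i23]
  have z: "z \<notin> ?c1 \<union> ?c2 \<union> ?c3" using G by blast
  consider "z \<in> inside (?c1 \<union> ?c3)" | "z \<in> inside (?c2 \<union> ?c3)" | "z \<in> outside (?c1 \<union> ?c2)"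
    using z J12(9) split by blast
  then show False
  proof cases
    case 1
    have "G2 \<subseteq> inside (?c1 \<union> ?c3)"
      by (rule connected_in_side[OF J13(3,6,9,8) _ _ _ 1]) (use G[of G2] in auto)
    then have "p2 \<in> inside (?c1 \<union> ?c3) \<union> (?c1 \<union> ?c3)"
      using cl(2) closure_mono J13(10) by blast
    then show False using p(2) i12 i23 split(2) J12(9) by blast
  next
    case 2
    have "G1 \<subseteq> inside (?c2 \<union> ?c3)"
      by (rule connected_in_side[OF J23(3,6,9,8) _ _ _ 2]) (use G[of G1] in auto)
    then have "p1 \<in> inside (?c2 \<union> ?c3) \<union> (?c2 \<union> ?c3)"
      using cl(1) closure_mono J23(10) by blast
    then show False using p(1) i12 i13 split(2) J12(9) by blast
  next
    case 3
    have J: "outside (?c1 \<union> ?c2) \<union> inside (?c1 \<union> ?c2) = - (?c1 \<union> ?c2)"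
      "outside (?c1 \<union> ?c2) \<inter> inside (?c1 \<union> ?c2) = {}"
      using J12(8,9) by blast+
    have "G3 \<subseteq> outside (?c1 \<union> ?c2)"
      by (rule connected_in_side[OF J12(6,3) J _ _ _ 3]) (use G[of G3] in auto)
    then have "p3 \<in> outside (?c1 \<union> ?c2) \<union> (?c1 \<union> ?c2)"
      using cl(3) closure_mono J12(11) by blast
    then show False using p(3) i13 i23 split(2) J12(8) by blast
  qed
qed

text \<open>No point of the plane can be joined to the three branches of a theta curve, because each face
  has only two of them on its boundary.\<close>

lemma theta_separation:
  assumes c1: "arc_between c1 a b" and c2: "arc_between c2 a b" and c3: "arc_between c3 a b"
    and i12: "path_image c1 \<inter> path_image c2 = {a, b}"
    and i13: "path_image c1 \<inter> path_image c3 = {a, b}"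
    and i23: "path_image c2 \<inter> path_image c3 = {a, b}"
    and G: "\<And>G. G \<in> {G1, G2, G3} \<Longrightarrow> connected G \<and> z \<in> G \<and>
      G \<inter> (path_image c1 \<union> path_image c2 \<union> path_image c3) = {}"
    and p: "p1 \<in> path_image c1 - {a, b}" "p2 \<in> path_image c2 - {a, b}" "p3 \<in> path_image c3 - {a, b}"
    and cl: "p1 \<in> closure G1" "p2 \<in> closure G2" "p3 \<in> closure G3"
  shows False
proof -
  have i21: "path_image c2 \<inter> path_image c1 = {a, b}" and i31: "path_image c3 \<inter> path_image c1 = {a, b}"
    and i32: "path_image c3 \<inter> path_image c2 = {a, b}" using i12 i13 i23 by blast+
  consider "path_image c3 \<inter> inside (path_image c1 \<union> path_image c2) \<noteq> {}"
    | "path_image c2 \<inter> inside (path_image c1 \<union> path_image c3) \<noteq> {}"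
    | "path_image c1 \<inter> inside (path_image c2 \<union> path_image c3) \<noteq> {}"
    using theta_one_arc_inside[OF c1 c2 c3 i12 i13 i23] by metis
  then show False
  proof cases
    case 1
    show False
      by (rule theta_separation_aux[OF c1 c2 c3 i12 i13 i23 1 _ p cl]) (use G in auto)
  next
    case 2
    show False
      by (rule theta_separation_aux[OF c1 c3 c2 i13 i12 i32 2 _ p(1,3,2) cl(1,3,2)]) (use G in blast)
  next
    case 3
    show False
      by (rule theta_separation_aux[OF c2 c3 c1 i23 i21 i31 3 _ p(2,3,1) cl(2,3,1)]) (use G in blast)
  qed
qed

section \<open>A nonplanar subgraph of the 4-cube\<close>

text \<open>A path of a drawn graph is recorded by its cells: the singletons and doubletons of its
  vertices and edges.\<close>

fun cells :: "nat list \<Rightarrow> nat set set" where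
  "cells [] = {}"
| "cells [x] = {{x}}"
| "cells (x # y # ns) = insert {x} (insert {x, y} (cells (y # ns)))"

lemma cells_subset: "c \<in> cells ns \<Longrightarrow> c \<subseteq> set ns"
  by (induction ns rule: cells.induct) auto

fun walk_in :: "nat set set \<Rightarrow> nat list \<Rightarrow> bool" where
  "walk_in A (x # y # ns) \<longleftrightarrow> {x, y} \<in> A \<and> walk_in A (y # ns)"
| "walk_in A ns \<longleftrightarrow> True"

text \<open>\<open>R\<close> sends a singleton to the point of its vertex and an edge to the open
  arc without its ends. Distinct cells are disjoint in the plane, so intersections of paths reduce
  to intersections of finite sets of cells.\<close>

locale drawn_graph =
  fixes A :: "nat set set" and p :: "nat \<Rightarrow> complex" and R :: "nat set \<Rightarrow> complex set"
  assumes point: "R {x} = {p x}"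
    and edge: "{x, y} \<in> A \<Longrightarrow> x \<noteq> y \<Longrightarrow> \<exists>g. arc_between g (p x) (p y) \<and> path_image g = {p x, p y} \<union> R {x, y}"
    and disjoint: "c \<in> A \<union> range (\<lambda>x. {x}) \<Longrightarrow> d \<in> A \<union> range (\<lambda>x. {x}) \<Longrightarrow> c \<noteq> d \<Longrightarrow> R c \<inter> R d = {}"
begin

definition realize :: "nat list \<Rightarrow> complex set" where
  "realize ns = \<Union> (R ` cells ns)"

lemma cells_allowed: "walk_in A ns \<Longrightarrow> cells ns \<subseteq> A \<union> range (\<lambda>x. {x})"
  by (induction ns rule: cells.induct) auto

lemma realize_Int:
  assumes "walk_in A ns" "walk_in A ms"
  shows "realize ns \<inter> realize ms = \<Union> (R ` (cells ns \<inter> cells ms))"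
proof
  show "realize ns \<inter> realize ms \<subseteq> \<Union> (R ` (cells ns \<inter> cells ms))"
  proof
    fix z assume "z \<in> realize ns \<inter> realize ms"
    then obtain c d where cd: "c \<in> cells ns" "d \<in> cells ms" "z \<in> R c" "z \<in> R d"
      by (auto simp: realize_def)
    then have "c = d"
      using disjoint[of c d] cells_allowed[OF assms(1)] cells_allowed[OF assms(2)] by auto
    then show "z \<in> \<Union> (R ` (cells ns \<inter> cells ms))" using cd by auto
  qed
qed (auto simp: realize_def)

lemma arc_along_walk:
  "walk_in A (x # y # ns) \<Longrightarrow> distinct (x # y # ns) \<Longrightarrow>
    \<exists>g. arc_between g (p x) (p (last (y # ns))) \<and> path_image g = realize (x # y # ns)"
proof (induction ns arbitrary: x y)
  case Nil
  then show ?case using edge[of x y] point by (auto simp: realize_def)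
next
  case (Cons w ns)
  obtain g where g: "arc_between g (p y) (p (last (w # ns)))" "path_image g = realize (y # w # ns)"
    using Cons.IH[of y w] Cons.prems by auto
  obtain f where f: "arc_between f (p x) (p y)" "path_image f = {p x, p y} \<union> R {x, y}"
    using edge[of x y] Cons.prems by auto
  have fr: "path_image f = realize [x, y]"
    using f(2) point by (auto simp: realize_def)
  have "{x, y} \<notin> cells (y # w # ns)" "{x} \<notin> cells (y # w # ns)"
    using cells_subset[of _ "y # w # ns"] Cons.prems(2) by fastforce+
  then have c: "cells [x, y] \<inter> cells (y # w # ns) = {{y}}" by auto
  have "walk_in A [x, y]" "walk_in A (y # w # ns)" using Cons.prems(1) by auto
  then have int: "path_image f \<inter> path_image g = {p y}"
    unfolding fr g(2) by (simp only: realize_Int c) (simp add: point)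
  have "arc_between (f +++ g) (p x) (p (last (y # w # ns)))"
    using f(1) g(1) int by (auto simp: arc_between_def intro!: arc_join)
  moreover have "path_image (f +++ g) = realize (x # y # w # ns)"
    using f(1) g(1) fr g(2) by (subst path_image_join) (auto simp: arc_between_def realize_def)
  ultimately show ?case by blast
qed

lemma point_in_realize: "x \<in> set ns \<Longrightarrow> p x \<in> realize ns"
  by (induction ns rule: cells.induct) (auto simp: realize_def point)

lemma realize_walk:
  assumes "walk_in A ns" "distinct ns" "length ns \<ge> 2" "x = hd ns" "y = last ns"
  obtains g where "arc_between g (p x) (p y)" "path_image g = realize ns"
proof (cases ns rule: cells.cases)
  case (3 u v ms)
  then show ?thesis using arc_along_walk[of u v ms] assms that by auto
qed (use assms in auto)

text \<open>The arc is taken without its last point. It remains connected and has \<open>p y\<close>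
  in its closure, while the condition on cells makes it miss all paths of \<open>T\<close>, which
  the full arc may touch at \<open>p y\<close>.\<close>

lemma leg:
  assumes "walk_in A ns" "distinct ns" "length ns \<ge> 2" "x = hd ns" "y = last ns"
    and T: "\<forall>ms\<in>T. walk_in A ms" "\<forall>ms\<in>T. cells ns \<inter> cells ms \<subseteq> {{y}}"
  shows "\<exists>G. connected G \<and> p x \<in> G \<and> G \<inter> (\<Union>ms\<in>T. realize ms) = {} \<and> p y \<in> closure G"
proof -
  obtain g where g: "arc_between g (p x) (p y)" "path_image g = realize ns"
    using realize_walk[OF assms(1-5)] .
  define G where "G = g ` {0..<1}"
  have cont: "continuous_on {0..1} g" and inj: "inj_on g {0..1}" and ends: "g 0 = p x" "g 1 = p y"
    using g(1) by (auto simp: arc_between_def arc_def path_def pathstart_def pathfinish_def)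
  have 1: "connected G" unfolding G_def
    by (intro connected_continuous_image continuous_on_subset[OF cont]) auto
  have 2: "p x \<in> G" using ends by (force simp: G_def)
  have "p y \<notin> G"
    using inj_onD[OF inj, of 1] ends(2) unfolding G_def by force
  moreover have "G \<subseteq> realize ns"
    using g(2) by (auto simp: G_def path_image_def)
  moreover have "realize ns \<inter> realize ms \<subseteq> {p y}" if "ms \<in> T" for ms
    using realize_Int[of ns ms] T that assms(1) point by blast
  ultimately have 3: "G \<inter> (\<Union>ms\<in>T. realize ms) = {}" by blast
  have "g ` closure {0..<1} \<subseteq> closure G"
    unfolding G_def by (rule image_closure_subset) (use cont closure_subset[of "g ` {0..<1}"] in auto)
  then have "g 1 \<in> closure G" by (auto simp: image_subset_iff)
  then have "p y \<in> closure G" using ends by simp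
  with 1 2 3 show ?thesis by blast
qed

end

text \<open>Vertices are numbers below 16, read as four binary digits; the ends of an edge differ in
  one digit. This is a subdivision of the complete bipartite graph with sides 1, 4, 9 and 0, 3, 5;
  its subdivided edges are 4-6-2-3, 9-8-0, 9-11-3 and 9-13-5.\<close>

definition cube_edges :: "nat set set" where
  "cube_edges = {{0,1},{0,4},{1,3},{1,5},{4,5},{4,6},{2,6},{2,3},{9,11},{3,11},{9,13},{5,13},{8,9},{0,8}}"

text \<open>The three paths from 4 to 1 form a theta curve whose branches contain 0, 3 and 5 in
  their interiors, and three legs start from the vertex 9 to exactly these points.\<close>

lemma (in drawn_graph) cube_not_drawn:
  assumes "A = cube_edges"
  shows False
proof -
  have w: "walk_in A [4,0,1]" "walk_in A [4,6,2,3,1]" "walk_in A [4,5,1]"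
    "walk_in A [9,8,0]" "walk_in A [9,11,3]" "walk_in A [9,13,5]"
    by (simp_all add: assms cube_edges_def doubleton_eq_iff)
  obtain c1 where c1: "arc_between c1 (p 4) (p 1)" "path_image c1 = realize [4,0,1]"
    using realize_walk[OF w(1), of 4 1] by auto
  obtain c2 where c2: "arc_between c2 (p 4) (p 1)" "path_image c2 = realize [4,6,2,3,1]"
    using realize_walk[OF w(2), of 4 1] by auto
  obtain c3 where c3: "arc_between c3 (p 4) (p 1)" "path_image c3 = realize [4,5,1]"
    using realize_walk[OF w(3), of 4 1] by auto
  let ?T = "{[4,0,1], [4,6,2,3,1], [4,5,1]} :: nat list set"
  have t: "\<forall>ms\<in>?T. walk_in A ms" using w by blast
  have "\<forall>ms\<in>?T. cells [9,8,0] \<inter> cells ms \<subseteq> {{0}}" by code_simp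
  then obtain G1 where G1: "connected G1" "p 9 \<in> G1" "G1 \<inter> (\<Union>ms\<in>?T. realize ms) = {}" "p 0 \<in> closure G1"
    using leg[OF w(4) _ _ _ _ t, of 9 0] by (auto simp del: cells.simps)
  have "\<forall>ms\<in>?T. cells [9,11,3] \<inter> cells ms \<subseteq> {{3}}" by code_simp
  then obtain G2 where G2: "connected G2" "p 9 \<in> G2" "G2 \<inter> (\<Union>ms\<in>?T. realize ms) = {}" "p 3 \<in> closure G2"
    using leg[OF w(5) _ _ _ _ t, of 9 3] by (auto simp del: cells.simps)
  have "\<forall>ms\<in>?T. cells [9,13,5] \<inter> cells ms \<subseteq> {{5}}" by code_simp
  then obtain G3 where G3: "connected G3" "p 9 \<in> G3" "G3 \<inter> (\<Union>ms\<in>?T. realize ms) = {}" "p 5 \<in> closure G3"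
    using leg[OF w(6) _ _ _ _ t, of 9 5] by (auto simp del: cells.simps)
  have "cells [4,0,1] \<inter> cells [4,6,2,3,1] = {{4},{1}}" by code_simp
  moreover have "cells [4,0,1] \<inter> cells [4,5,1] = {{4},{1}}" by code_simp
  moreover have "cells [4,6,2,3,1] \<inter> cells [4,5,1] = {{4},{1}}" by code_simp
  ultimately have int: "path_image c1 \<inter> path_image c2 = {p 4, p 1}" "path_image c1 \<inter> path_image c3 = {p 4, p 1}"
    "path_image c2 \<inter> path_image c3 = {p 4, p 1}"
    using realize_Int[OF w(1,2)] realize_Int[OF w(1,3)] realize_Int[OF w(2,3)]
    by (simp_all add: c1 c2 c3 point insert_commute)
  have pn: "p x \<noteq> p y" if "x \<noteq> y" for x y
    using disjoint[of "{x}" "{y}"] that point by simp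
  show False
  proof (rule theta_separation[OF c1(1) c2(1) c3(1) int, of G1 G2 G3 "p 9" "p 0" "p 3" "p 5"])
    show "connected G \<and> p 9 \<in> G \<and> G \<inter> (path_image c1 \<union> path_image c2 \<union> path_image c3) = {}"
      if "G \<in> {G1, G2, G3}" for G
      using that G1 G2 G3 unfolding c1(2) c2(2) c3(2) by auto
    show "p 0 \<in> path_image c1 - {p 4, p 1}" "p 3 \<in> path_image c2 - {p 4, p 1}"
      "p 5 \<in> path_image c3 - {p 4, p 1}"
      using pn by (auto simp: c1 c2 c3 intro: point_in_realize)
  qed (fact G1 G2 G3)+
qed

lemma planar_no_cube:
  assumes v: "inj_on v {..<16::nat}" "v ` {..<16} \<subseteq> vertices G"
    and e: "\<And>c. c \<in> cube_edges \<Longrightarrow> e c \<in> edges G \<and> ends G (e c) = v ` c"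
  shows "\<not> planar G"
proof
  assume "planar G"
  then obtain pos :: "_ \<Rightarrow> complex" and draw where pos: "inj_on pos (vertices G)"
    and *: "\<forall>e\<in>edges G. simple_path (draw e) \<and>
           {pathstart (draw e), pathfinish (draw e)} = pos ` ends G e \<and>
           draw e ` {0<..<1} \<inter> pos ` vertices G = {}"
      "\<forall>e\<in>edges G. \<forall>e'\<in>edges G. e \<noteq> e' \<longrightarrow> draw e ` {0<..<1} \<inter> draw e' ` {0<..<1} = {}"
    unfolding planar_def by (elim exE conjE) (rule that; assumption)
  note draw = *(1)[rule_format] and disj = *(2)[rule_format]
  have small: "c \<subseteq> {..<16}" "card c = 2" if "c \<in> cube_edges" for c
    using that by (auto simp: cube_edges_def)
  text \<open>Beyond 16 the points are irrelevant; they only have to be new.\<close>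
  obtain p where p: "\<And>x. x < 16 \<Longrightarrow> p x = pos (v x)" "inj p"
    "\<And>x c. c \<in> cube_edges \<Longrightarrow> p x \<notin> draw (e c) ` {0<..<1}"
  proof -
    define X where "X = (\<Union>c\<in>cube_edges. draw (e c) ` {0..1}) \<union> pos ` v ` {..<16}"
    have "compact (draw (e c) ` {0..1})" if "c \<in> cube_edges" for c
      using draw[of "e c"] e[OF that]
      by (intro compact_continuous_image) (auto simp: simple_path_def path_def)
    then have "compact (\<Union>c\<in>cube_edges. draw (e c) ` {0..1})"
      by (intro compact_UN) (auto simp: cube_edges_def)
    then have "compact X"
      unfolding X_def by (rule compact_Un[OF _ finite_imp_compact]) auto
    then obtain r where r: "X \<subseteq> ball 0 r"
      by (metis bounded_subset_ballD compact_imp_bounded)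
    define p where "p = (\<lambda>x. if x < 16 then pos (v x) else of_real (\<bar>r\<bar> + real x))"
    have big: "of_real (\<bar>r\<bar> + real x) \<notin> X" for x
      using r by (force simp del: of_real_add)
    show ?thesis
    proof (rule that[of p])
      show "inj p"
      proof (rule injI)
        fix x y assume eq: "p x = p y"
        have X: "pos (v x) \<in> X" if "x < 16" for x using that by (auto simp: X_def)
        have "x = y" if "x < 16" "y < 16"
        proof -
          have "v x = v y"
            using eq that inj_onD[OF pos, of "v x" "v y"] v(2) by (auto simp: p_def)
          then show ?thesis using inj_onD[OF v(1)] that by auto
        qed
        moreover have "p x \<noteq> p y" if "x < 16" "\<not> y < 16"
          using X[OF that(1)] big[of y] that by (metis p_def)
        moreover have "p x \<noteq> p y" if "y < 16" "\<not> x < 16"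
          using X[OF that(1)] big[of x] that by (metis p_def)
        moreover have "x = y" if "\<not> x < 16" "\<not> y < 16"
          using eq that by (simp add: p_def of_real_eq_iff del: of_real_add)
        ultimately show "x = y" using eq by blast
      qed
      fix x c assume c: "c \<in> cube_edges"
      have "draw (e c) ` {0<..<1} \<subseteq> X" using c unfolding X_def by fastforce
      moreover have "pos (v x) \<notin> draw (e c) ` {0<..<1}" if "x < 16"
      proof -
        have "pos (v x) \<in> pos ` vertices G" using v(2) that by auto
        then show ?thesis using draw[of "e c"] e[OF c] by blast
      qed
      ultimately show "p x \<notin> draw (e c) ` {0<..<1}" using big[of x] unfolding p_def by auto
    qed (auto simp: p_def)
  qed
  define R where "R = (\<lambda>c. if c \<in> cube_edges then draw (e c) ` {0<..<1} else p ` c)"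
  have single: "{x} \<notin> cube_edges" for x using small(2)[of "{x}"] by auto
  \<comment> \<open>Different pairs of vertices force different edges through \<open>ends\<close>,
    so injectivity of \<open>e\<close> need not be assumed.\<close>
  have e_inj: "e c \<noteq> e d" if "c \<in> cube_edges" "d \<in> cube_edges" "c \<noteq> d" for c d
  proof
    assume "e c = e d"
    then have "v ` c = v ` d" using e that by metis
    then show False
      using inj_on_image_eq_iff[OF v(1)] small(1) that by blast
  qed
  interpret drawn_graph cube_edges p R
  proof
    show "R {x} = {p x}" for x by (simp add: R_def single)
  next
    fix x y assume c: "{x, y} \<in> cube_edges" "x \<noteq> y"
    let ?g = "draw (e {x, y})"
    have xy: "x < 16" "y < 16" using small(1)[OF c(1)] by auto
    have "{pathstart ?g, pathfinish ?g} = {p x, p y}" and sp: "simple_path ?g"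
      using draw[of "e {x,y}"] e[OF c(1)] p(1) xy by auto
    moreover have "p x \<noteq> p y" using p(2) c(2) by (simp add: inj_eq)
    \<comment> \<open>Planarity fixes the ends of a drawn edge only as a set, so the direction in
      which it is traversed is open.\<close>
    ultimately have "arc_between ?g (p x) (p y) \<or> arc_between (reversepath ?g) (p x) (p y)"
      and ends: "{?g 0, ?g 1} = {p x, p y}"
      by (auto simp: arc_between_def doubleton_eq_iff intro!: simple_path_imp_arc arc_reversepath)
        (auto simp: pathstart_def pathfinish_def)
    moreover have "{0..1::real} = {0,1} \<union> {0<..<1}" by auto
    then have "path_image ?g = {?g 0, ?g 1} \<union> ?g ` {0<..<1}"
      unfolding path_image_def by (metis image_Un image_insert image_empty)
    then have "path_image ?g = {p x, p y} \<union> R {x, y}"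
      using c(1) ends by (simp add: R_def)
    ultimately show "\<exists>g. arc_between g (p x) (p y) \<and> path_image g = {p x, p y} \<union> R {x, y}"
      by (metis path_image_reversepath)
  next
    fix c d assume cd: "c \<in> cube_edges \<union> range (\<lambda>x. {x})" "d \<in> cube_edges \<union> range (\<lambda>x. {x})" "c \<noteq> d"
    have pt: "R {x} \<inter> R d = {}" if "d \<in> cube_edges" for x d
      using p(3)[OF that, of x] that by (simp add: R_def single)
    consider "c \<in> cube_edges" "d \<in> cube_edges" | x where "c = {x}" "d \<in> cube_edges"
      | x where "c \<in> cube_edges" "d = {x}" | x y where "c = {x}" "d = {y}"
      using cd by blast
    then show "R c \<inter> R d = {}"
    proof cases
      case 1
      then show ?thesis using disj[of "e c" "e d"] e e_inj cd(3) by (simp add: R_def)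
    next
      case 2
      then show ?thesis using pt by simp
    next
      case 3
      then show ?thesis using pt[of c x] by (simp add: Int_commute)
    next
      case 4
      then show ?thesis using cd(3) p(2) single by (auto simp: R_def inj_eq)
    qed
  qed
  show False using cube_not_drawn by simp
qed


section \<open>Inserting a curl\<close>

definition cubic :: "real \<Rightarrow> complex" where
  "cubic s = Complex (2 * s ^ 3 - s) ((1 - s\<^sup>2) / 2)"

abbreviation node :: real where "node \<equiv> 1 / sqrt 2"

lemma node_bounds: "7/10 < node" "node < 71/100" "node\<^sup>2 = 1/2"
proof -
  show n: "node\<^sup>2 = 1/2" by (simp add: power_divide)
  have "0 < node" by simp
  then show "7/10 < node" "node < 71/100"
    using power2_less_imp_less[of "7/10" node] power2_less_imp_less[of node "71/100"]
    unfolding n by (simp_all add: power2_eq_square)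
qed

text \<open>The second coordinate is even and determines \<open>s\<close> up to sign. The first one
  is odd, so it must vanish if the signs differ.\<close>

lemma cubic_eq_iff: "cubic s = cubic t \<longleftrightarrow> s = t \<or> s\<^sup>2 = 1/2 \<and> t = - s"
proof
  assume eq: "cubic s = cubic t"
  then have "s\<^sup>2 = t\<^sup>2" by (simp add: cubic_def)
  then consider "t = s" | "t = - s" by (auto simp: power2_eq_iff)
  then show "s = t \<or> s\<^sup>2 = 1/2 \<and> t = - s"
  proof cases
    case 2
    then have "s * (2 * s\<^sup>2 - 1) = 0"
      using eq by (simp add: cubic_def power2_eq_square power3_eq_cube algebra_simps)
    then show ?thesis using 2 by auto
  qed simp
next
  assume "s = t \<or> s\<^sup>2 = 1/2 \<and> t = - s"
  moreover have "2 * s ^ 3 = s" if "s\<^sup>2 = 1/2"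
    using that by (simp add: power3_eq_cube power2_eq_square)
  ultimately show "cubic s = cubic t" by (auto simp: cubic_def)
qed

lemma cubic_ends: "cubic 1 = 1" "cubic (- 1) = - 1"
  by (simp_all add: cubic_def complex_eq_iff)

text \<open>With \<open>u = s\<^sup>2\<close> the squared norm is at most
  \<open>u + ((1 - u) / 2)\<^sup>2\<close>, which is below 1 because
  \<open>(1 - u) / 4 < 1\<close>.\<close>

lemma norm_cubic:
  assumes "\<bar>s\<bar> < 1"
  shows "norm (cubic s) < 1"
proof -
  define u where "u = s\<^sup>2"
  have u: "0 \<le> u" "u < 1"
    using assms by (auto simp: u_def abs_square_less_1)
  have "(norm (cubic s))\<^sup>2 = u * (2 * u - 1)\<^sup>2 + ((1 - u) / 2)\<^sup>2"
    by (simp add: cubic_def cmod_power2 u_def) algebra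
  also have "\<dots> \<le> u * 1 + ((1 - u) / 2)\<^sup>2"
  proof -
    have "\<bar>2 * u - 1\<bar> \<le> 1" using u by (simp add: abs_if)
    then have "(2 * u - 1)\<^sup>2 \<le> 1" by (simp add: abs_square_le_1)
    then show ?thesis using u by (intro add_right_mono mult_left_mono) auto
  qed
  also have "\<dots> < 1"
  proof -
    have "(1 - u) * (1 - u) < (1 - u) * 4" using u by (intro mult_strict_left_mono) auto
    then show ?thesis by (simp add: power2_eq_square)
  qed
  finally show ?thesis by (simp add: abs_square_less_1)
qed

lemma cubic_in_cball: "s \<in> {-1..1} \<Longrightarrow> cubic s \<in> cball 0 1"
  using norm_cubic[of s] cubic_ends by (cases "\<bar>s\<bar> < 1") (auto simp: abs_if split: if_splits)

lemma continuous_cubic [continuous_intros]: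
  "continuous_on S f \<Longrightarrow> continuous_on S (\<lambda>x. cubic (f x))"
  unfolding cubic_def Complex_eq by (intro continuous_intros) auto

text \<open>Inside the disc \<open>\<beta> ` cball 0 1\<close> the diagram is the single straight strand \<open>\<alpha>\<close>.\<close>

definition flat_disc ::
  "'a::t2_space set \<Rightarrow> 'a diagram \<Rightarrow> (complex \<Rightarrow> 'a) \<Rightarrow> (real \<Rightarrow> complex) \<Rightarrow> bool" where
  "flat_disc F D \<beta> \<alpha> \<longleftrightarrow>
     continuous_on (cball 0 1) \<beta> \<and> inj_on \<beta> (cball 0 1) \<and> \<beta> ` cball 0 1 \<subseteq> F \<and>
     openin (top_of_set F) (\<beta> ` ball 0 1) \<and>
     continuous_on {-1..1} \<alpha> \<and> inj_on \<alpha> {-1..1} \<and> \<alpha> ` {-1..1} \<subseteq> S1 \<and>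
     (\<forall>s\<in>{-1..1}. curve D (\<alpha> s) = \<beta> (of_real s)) \<and>
     (\<forall>s\<in>S1 - \<alpha> ` {-1..1}. curve D s \<notin> \<beta> ` cball 0 1)"

text \<open>Of the two passages through the node, the later one is the overpass, in agreement with
  heights that increase along the strand.\<close>

definition curl :: "(complex \<Rightarrow> 'a) \<Rightarrow> (real \<Rightarrow> complex) \<Rightarrow> 'a diagram \<Rightarrow> 'a diagram" where
  "curl \<beta> \<alpha> D = Diagram
     (\<lambda>s. if s \<in> \<alpha> ` {-1..1} then \<beta> (cubic (inv_into {-1..1} \<alpha> s)) else curve D s)
     (insert (\<alpha> node) (overs D))"

text \<open>Multiplying the chart by \<open>\<i>\<close> exchanges the coordinate axes.\<close>

lemma transverse_at_sym:
  assumes "transverse_at F \<gamma> s t"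
  shows "transverse_at F \<gamma> t s"
proof -
  obtain U h g A B where *: "openin (top_of_set F) U" "homeomorphism U (ball (0::complex) 1) h g"
    "openin (top_of_set S1) A" "s \<in> A" "\<gamma> ` A \<subseteq> U" "\<forall>a\<in>A. Im (h (\<gamma> a)) = 0"
    "openin (top_of_set S1) B" "t \<in> B" "\<gamma> ` B \<subseteq> U" "\<forall>b\<in>B. Re (h (\<gamma> b)) = 0"
    using assms unfolding transverse_at_def by blast
  have "homeomorphism (ball 0 1) (ball (0::complex) 1) (\<lambda>x. \<i> * x) (\<lambda>x. - \<i> * x)"
    by (rule homeomorphismI) (auto intro!: continuous_intros simp: norm_mult)
  from homeomorphism_compose[OF *(2) this] show ?thesis
    unfolding transverse_at_def using * by (intro exI[of _ U] exI[of _ "(*) \<i> \<circ> h"] exI conjI) auto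
qed

lemma looks_like_single:
  "looks_like D B \<theta> (\<lambda>(i, s). \<alpha> s) (Tangle [f] ov) \<longleftrightarrow>
    (\<forall>s\<in>{-1..1}. curve D (\<alpha> s) \<in> B \<and> \<theta> (curve D (\<alpha> s)) = f s \<and> (\<alpha> s \<in> overs D \<longleftrightarrow> (0, s) \<in> ov))"
  unfolding looks_like_def by (auto simp: lessThan_Suc)

locale flat =
  fixes F :: "'a::t2_space set" and D :: "'a diagram" and \<beta> :: "complex \<Rightarrow> 'a" and \<alpha> :: "real \<Rightarrow> complex"
  assumes flat: "flat_disc F D \<beta> \<alpha>" and diagram: "is_diagram F D"
begin

lemma \<beta>: "continuous_on (cball 0 1) \<beta>" "inj_on \<beta> (cball 0 1)" "\<beta> ` cball 0 1 \<subseteq> F"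
    "openin (top_of_set F) (\<beta> ` ball 0 1)"
  and \<alpha>: "continuous_on {-1..1} \<alpha>" "inj_on \<alpha> {-1..1}" "\<alpha> ` {-1..1} \<subseteq> S1"
  and curve_in: "s \<in> {-1..1} \<Longrightarrow> curve D (\<alpha> s) = \<beta> (of_real s)"
  and curve_out: "t \<in> S1 \<Longrightarrow> t \<notin> \<alpha> ` {-1..1} \<Longrightarrow> curve D t \<notin> \<beta> ` cball 0 1"
  using flat unfolding flat_disc_def by blast+

abbreviation "D' \<equiv> curl \<beta> \<alpha> D"

lemma curve'_in: "s \<in> {-1..1} \<Longrightarrow> curve D' (\<alpha> s) = \<beta> (cubic s)"
  by (simp add: curl_def inv_into_f_f[OF \<alpha>(2)] del: atLeastAtMost_iff)

lemma curve'_out: "s \<notin> \<alpha> ` {-1..1} \<Longrightarrow> curve D' s = curve D s"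
  by (simp add: curl_def)

lemma of_real_cball: "s \<in> {-1..1} \<Longrightarrow> of_real s \<in> cball (0::complex) 1"
  by auto

lemma \<beta>_homeomorphism: obtains \<theta> where "homeomorphism (\<beta> ` cball 0 1) (cball 0 1) \<theta> \<beta>"
  using homeomorphism_compact[OF compact_cball \<beta>(1) refl \<beta>(2)] homeomorphism_symD by blast

text \<open>\<open>flat_disc\<close> provides openness in \<open>F\<close> for the whole open disc;
  smaller open sets inherit it, as \<open>\<beta>\<close> is a homeomorphism onto its image.\<close>

lemma openin_\<beta>:
  assumes "open U" "U \<subseteq> ball 0 1"
  shows "openin (top_of_set F) (\<beta> ` U)"
proof -
  obtain \<theta> where "homeomorphism (cball 0 1) (\<beta> ` cball 0 1) \<beta> \<theta>"
    using homeomorphism_compact[OF compact_cball \<beta>(1) refl \<beta>(2)] by blast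
  then have hom: "homeomorphism (ball 0 1) (\<beta> ` ball 0 1) \<beta> \<theta>"
    by (rule homeomorphism_of_subsets) (use ball_subset_cball in auto)
  have "openin (top_of_set (ball 0 1)) U"
    using assms by (simp add: open_subset)
  from openin_trans[OF homeomorphism_imp_open_map[OF hom this] \<beta>(4)] show ?thesis .
qed

lemma compact_\<alpha>: "compact (\<alpha> ` {-1..1})"
  by (intro compact_continuous_image \<alpha> compact_Icc)

lemma curve_in_iff: "s \<in> S1 \<Longrightarrow> curve D s \<in> \<beta> ` cball 0 1 \<longleftrightarrow> s \<in> \<alpha> ` {-1..1}"
proof
  assume "s \<in> \<alpha> ` {-1..1}"
  then obtain u where "u \<in> {-1..1}" "s = \<alpha> u" by (rule imageE)
  then show "curve D s \<in> \<beta> ` cball 0 1" using curve_in of_real_cball by simp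
qed (use curve_out in blast)

lemma \<alpha>_S1: "s \<in> {-1..1} \<Longrightarrow> \<alpha> s \<in> S1"
  by (rule subsetD[OF \<alpha>(3)]) (rule imageI)

lemma curve'_in_iff: "s \<in> S1 \<Longrightarrow> curve D' s \<in> \<beta> ` cball 0 1 \<longleftrightarrow> s \<in> \<alpha> ` {-1..1}"
proof
  assume "s \<in> \<alpha> ` {-1..1}"
  then obtain u where "u \<in> {-1..1}" "s = \<alpha> u" by (rule imageE)
  then show "curve D' s \<in> \<beta> ` cball 0 1" using curve'_in cubic_in_cball by simp
qed (use curve_out curve'_out in metis)

text \<open>As a preimage under the continuous curve, the open strand is open in the circle.\<close>

lemma \<alpha>_open_eq: "\<alpha> ` {-1<..<1} = S1 \<inter> curve D -` (\<beta> ` ball 0 1)"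
proof (intro equalityI subsetI)
  fix s assume "s \<in> \<alpha> ` {-1<..<1}"
  then obtain u where u: "s = \<alpha> u" "-1 < u" "u < 1" by auto
  then have "of_real u \<in> ball (0::complex) 1" by auto
  then show "s \<in> S1 \<inter> curve D -` (\<beta> ` ball 0 1)"
    using u curve_in[of u] \<alpha>_S1[of u] by auto
next
  fix s assume s: "s \<in> S1 \<inter> curve D -` (\<beta> ` ball 0 1)"
  then obtain x where x: "x \<in> ball 0 1" "curve D s = \<beta> x" by auto
  then have "curve D s \<in> \<beta> ` cball 0 1" using ball_subset_cball by blast
  then obtain u where u: "u \<in> {-1..1}" "s = \<alpha> u" using curve_in_iff s by blast
  then have "of_real u = x"
    using x curve_in[OF u(1)] inj_onD[OF \<beta>(2)] of_real_cball[OF u(1)] by (metis ball_subset_cball subsetD)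
  then have "u \<in> {-1<..<1}" using x(1) by auto
  then show "s \<in> \<alpha> ` {-1<..<1}" using u(2) by (rule image_eqI[rotated])
qed

lemma openin_\<alpha>:
  assumes "-1 \<le> a" "b \<le> 1"
  shows "openin (top_of_set S1) (\<alpha> ` {a<..<b})"
proof -
  have "openin (top_of_set S1) (\<alpha> ` {-1<..<1})"
    unfolding \<alpha>_open_eq
    by (rule continuous_openin_preimage[OF _ _ \<beta>(4)]) (use diagram in \<open>auto simp: is_diagram_def\<close>)
  moreover obtain \<alpha>' where "homeomorphism {-1..1} (\<alpha> ` {-1..1}) \<alpha> \<alpha>'"
    using homeomorphism_compact[OF compact_Icc \<alpha>(1) refl \<alpha>(2)] by blast
  then have "homeomorphism {-1<..<1} (\<alpha> ` {-1<..<1}) \<alpha> \<alpha>'"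
    by (rule homeomorphism_of_subsets) auto
  moreover have "openin (top_of_set {-1<..<1}) {a<..<b}"
    using assms by (intro open_subset) auto
  ultimately show ?thesis
    using homeomorphism_imp_open_map openin_trans by blast
qed

text \<open>Gluing over two closed sets that share only the ends of the strand, where the cubic
  takes the values 1 and -1 of the straight strand.\<close>

lemma continuous_curve': "continuous_on S1 (curve D')"
proof -
  have "closed (S1 - \<alpha> ` {-1<..<1})"
    using openin_\<alpha>[of "-1" 1] by (metis closed_sphere closedin_closed_trans closedin_diff
        closedin_subtopology_refl closedin_topspace dual_order.refl openin_closedin_eq topspace_euclidean_subtopology)
  moreover have inv: "continuous_on (\<alpha> ` {-1..1}) (inv_into {-1..1} \<alpha>)"
    by (rule continuous_on_inv[OF \<alpha>(1) compact_Icc]) (use \<alpha>(2) in \<open>simp add: inv_into_f_f del: atLeastAtMost_iff\<close>)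
  have "continuous_on (\<alpha> ` {-1..1}) (\<lambda>s. \<beta> (cubic (inv_into {-1..1} \<alpha> s)))"
    by (rule continuous_on_compose2[OF \<beta>(1) continuous_cubic[OF inv]])
      (intro image_subsetI cubic_in_cball inv_into_into)
  moreover have "continuous_on (S1 - \<alpha> ` {-1<..<1}) (curve D)"
    using diagram by (auto simp: is_diagram_def intro: continuous_on_subset)
  moreover have "\<beta> (cubic (inv_into {-1..1} \<alpha> s)) = curve D s"
    if s: "s \<in> S1 - \<alpha> ` {-1<..<1}" "s \<in> \<alpha> ` {-1..1}" for s
  proof -
    obtain u where u: "u \<in> {-1..1}" "s = \<alpha> u" using s by auto
    have "u \<notin> {-1<..<1}" using s u by blast
    then have "u = 1 \<or> u = -1" using u(1) by auto
    then have "\<beta> (cubic u) = curve D s"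
      using curve_in[OF u(1)] u(2) by (auto simp: cubic_ends)
    then show ?thesis using inv_into_f_f[OF \<alpha>(2) u(1)] u(2) by simp
  qed
  ultimately have "continuous_on (\<alpha> ` {-1..1} \<union> (S1 - \<alpha> ` {-1<..<1})) (curve D')"
    unfolding curl_def diagram.sel
    by (intro continuous_on_cases) (use compact_\<alpha> compact_imp_closed in auto)
  moreover have "\<alpha> ` {-1..1} \<union> (S1 - \<alpha> ` {-1<..<1}) = S1"
    using \<alpha>(3) by auto
  ultimately show ?thesis by simp
qed

lemma old_crossing_outside:
  assumes "s \<in> S1" "t \<in> S1" "s \<noteq> t" "curve D s = curve D t"
  shows "s \<notin> \<alpha> ` {-1..1}"
proof
  assume s: "s \<in> \<alpha> ` {-1..1}"
  then have "t \<in> \<alpha> ` {-1..1}" using curve_in_iff assms by metis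
  with s obtain u v where uv: "u \<in> {-1..1}" "s = \<alpha> u" "v \<in> {-1..1}" "t = \<alpha> v" by auto
  then have "of_real u = (of_real v :: complex)"
    using curve_in assms(4) inj_onD[OF \<beta>(2)] of_real_cball by metis
  then show False using uv assms(3) by simp
qed

lemma \<alpha>_not_double: "s \<in> {-1..1} \<Longrightarrow> \<alpha> s \<notin> double_params (curve D)"
  using old_crossing_outside by (auto simp: double_params_def) (metis atLeastAtMost_iff image_eqI)

lemma node_in: "node \<in> {-1..1}" "- node \<in> {-1..1}"
  using node_bounds by auto

text \<open>The new strand stays within the disc, which the rest of the curve avoids; so
  coincidences arise either outside, as before, or between two points of the cubic.\<close>

lemma curve'_eq_iff:
  assumes st: "s \<in> S1" "t \<in> S1" "s \<noteq> t"
  shows "curve D' s = curve D' t \<longleftrightarrow> curve D s = curve D t \<or> {s, t} = {\<alpha> node, \<alpha> (- node)}"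
proof (cases "s \<in> \<alpha> ` {-1..1} \<and> t \<in> \<alpha> ` {-1..1}")
  case True
  then obtain u v where uv: "u \<in> {-1..1}" "s = \<alpha> u" "v \<in> {-1..1}" "t = \<alpha> v" by auto
  have "curve D s \<noteq> curve D t" using old_crossing_outside[OF st] True by blast
  moreover have "curve D' s = curve D' t \<longleftrightarrow> cubic u = cubic v"
    using curve'_in uv inj_on_eq_iff[OF \<beta>(2)] cubic_in_cball by metis
  moreover have "cubic u = cubic v \<longleftrightarrow> {u, v} = {node, - node}"
  proof -
    have "u \<noteq> v" using uv st(3) by auto
    moreover have "u\<^sup>2 = 1/2 \<longleftrightarrow> u = node \<or> u = - node"
      using node_bounds(3) power2_eq_iff[of u node] by metis
    ultimately show ?thesis by (auto simp: cubic_eq_iff doubleton_eq_iff)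
  qed
  moreover have "{u, v} = {node, - node} \<longleftrightarrow> {s, t} = {\<alpha> node, \<alpha> (- node)}"
    using uv node_in inj_on_eq_iff[OF \<alpha>(2)] unfolding doubleton_eq_iff by metis
  ultimately show ?thesis by blast
next
  case False
  then have ne: "{s, t} \<noteq> {\<alpha> node, \<alpha> (- node)}"
    using node_in by (metis doubleton_eq_iff image_eqI)
  show ?thesis
  proof (cases "s \<in> \<alpha> ` {-1..1} \<or> t \<in> \<alpha> ` {-1..1}")
    case True
    then show ?thesis using False ne st curve_in_iff curve'_in_iff by metis
  qed (use ne in \<open>simp add: curve'_out\<close>)
qed

lemma new_nodes: "\<alpha> node \<noteq> \<alpha> (- node)" "\<alpha> node \<in> S1" "\<alpha> (- node) \<in> S1"
  using node_in inj_onD[OF \<alpha>(2) _ node_in] node_bounds(1) \<alpha>_S1 by auto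

lemma double_params': "double_params (curve D') = double_params (curve D) \<union> {\<alpha> node, \<alpha> (- node)}"
proof -
  have "s \<in> double_params (curve D') \<longleftrightarrow> s \<in> double_params (curve D) \<union> {\<alpha> node, \<alpha> (- node)}" for s
  proof (cases "s \<in> S1")
    case True
    have dp: "s \<in> double_params \<gamma> \<longleftrightarrow> (\<exists>t\<in>S1. t \<noteq> s \<and> \<gamma> s = \<gamma> t)" for \<gamma> :: "complex \<Rightarrow> 'a"
      unfolding double_params_def mem_Collect_eq using True by metis
    have "curve D' s = curve D' t \<longleftrightarrow> curve D s = curve D t \<or> {s, t} = {\<alpha> node, \<alpha> (- node)}"
      if "t \<in> S1" "t \<noteq> s" for t
      by (rule curve'_eq_iff[OF True that(1) that(2)[symmetric]])
    then have "s \<in> double_params (curve D') \<longleftrightarrow>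
        (\<exists>t\<in>S1. t \<noteq> s \<and> (curve D s = curve D t \<or> {s, t} = {\<alpha> node, \<alpha> (- node)}))"
      unfolding dp[of "curve D'"] by (intro bex_cong conj_cong refl) simp
    also have "\<dots> \<longleftrightarrow> s \<in> double_params (curve D) \<or> (\<exists>t\<in>S1. t \<noteq> s \<and> {s, t} = {\<alpha> node, \<alpha> (- node)})"
      unfolding dp[of "curve D"] by blast
    also have "(\<exists>t\<in>S1. t \<noteq> s \<and> {s, t} = {\<alpha> node, \<alpha> (- node)}) \<longleftrightarrow> s \<in> {\<alpha> node, \<alpha> (- node)}"
      using new_nodes unfolding doubleton_eq_iff by auto
    finally show ?thesis by blast
  qed (use new_nodes in \<open>auto simp: double_params_def\<close>)
  then show ?thesis by blast
qed

lemma overs': "overs D' = insert (\<alpha> node) (overs D)"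
  by (simp add: curl_def)

text \<open>A chart at the node, in which the coordinate axes are the two branches of the cubic.\<close>

definition node_chart :: "complex \<Rightarrow> complex" where
  "node_chart w = cubic (node + Re w / 20) + cubic (- node + Im w / 20) - cubic node"

text \<open>Since \<open>node\<close> lies between 7/10 and 71/100, the factor 1/20 keeps the
  parameters of both branches, up to sign, between 65/100 and 76/100, where the cubic is close to
  its node.\<close>

lemma node_chart_range:
  assumes "w \<in> ball 0 1"
  shows "node_chart w \<in> ball 0 1"
proof -
  define s where "s = node + Re w / 20"
  define t where "t = node - Im w / 20"
  have w: "\<bar>Re w\<bar> < 1" "\<bar>Im w\<bar> < 1"
    using assms abs_Re_le_cmod[of w] abs_Im_le_cmod[of w] by auto
  have *: "\<bar>2 * r ^ 3 - r\<bar> \<le> 3/20 \<and> \<bar>(1 - r\<^sup>2) / 2 - 1/4\<bar> \<le> 1/20" if r: "65/100 < r" "r < 76/100" for r :: real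
  proof -
    have "(65/100)\<^sup>2 \<le> r\<^sup>2" "r\<^sup>2 \<le> (76/100)\<^sup>2"
      using r by (intro power_mono; simp)+
    then have q: "\<bar>2 * r\<^sup>2 - 1\<bar> \<le> 17/100" "\<bar>(1 - r\<^sup>2) / 2 - 1/4\<bar> \<le> 1/20"
      by (auto simp: power2_eq_square abs_if)
    have "\<bar>2 * r ^ 3 - r\<bar> = r * \<bar>2 * r\<^sup>2 - 1\<bar>"
    proof -
      have "2 * r ^ 3 - r = r * (2 * r\<^sup>2 - 1)" by (simp add: power2_eq_square power3_eq_cube algebra_simps)
      then show ?thesis using r by (simp add: abs_mult)
    qed
    also have "\<dots> \<le> (76/100) * (17/100)"
      using r q by (intro mult_mono) auto
    finally show ?thesis using q by simp
  qed
  have st: "65/100 < s" "s < 76/100" "65/100 < t" "t < 76/100"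
    using w node_bounds unfolding s_def t_def by auto
  have t': "- node + Im w / 20 = - t" by (simp add: t_def)
  have cn: "cubic node = Complex 0 (1/4)"
    using node_bounds(3) by (simp add: cubic_def power3_eq_cube power2_eq_square)
  have "Re (node_chart w) = (2 * s ^ 3 - s) - (2 * t ^ 3 - t)"
    "Im (node_chart w) = ((1 - s\<^sup>2) / 2 - 1/4) + ((1 - t\<^sup>2) / 2 - 1/4) + 1/4"
    unfolding node_chart_def t' cn by (simp_all add: cubic_def s_def[symmetric])
  then have "\<bar>Re (node_chart w)\<bar> \<le> 3/10" "\<bar>Im (node_chart w)\<bar> \<le> 4/10"
    using *[OF st(1,2)] *[OF st(3,4)] by linarith+
  then have "norm (node_chart w) < 1"
    using cmod_le[of "node_chart w"] by linarith
  then show ?thesis by simp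
qed

text \<open>Equality of imaginary parts forces \<open>s - s'\<close> and \<open>t - t'\<close> to
  have opposite signs, equality of real parts forces equal signs. Hence both differences
  vanish.\<close>

lemma inj_node_chart: "inj_on node_chart (ball 0 1)"
proof (rule inj_onI)
  fix w w' assume ww: "w \<in> ball 0 1" "w' \<in> ball 0 1" "node_chart w = node_chart w'"
  have w: "\<bar>Re w\<bar> < 1" "\<bar>Im w\<bar> < 1" "\<bar>Re w'\<bar> < 1" "\<bar>Im w'\<bar> < 1"
    using ww(1,2) abs_Re_le_cmod[of w] abs_Im_le_cmod[of w] abs_Re_le_cmod[of w'] abs_Im_le_cmod[of w']
    by auto
  define s where "s = node + Re w / 20"
  define s' where "s' = node + Re w' / 20"
  define t where "t = node - Im w / 20"
  define t' where "t' = node - Im w' / 20"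
  have st: "65/100 < s" "65/100 < t" "65/100 < s'" "65/100 < t'"
    using w node_bounds unfolding s_def t_def s'_def t'_def by auto
  have n: "- node + Im w / 20 = - t" "- node + Im w' / 20 = - t'" by (simp_all add: t_def t'_def)
  have eq: "cubic s + cubic (- t) = cubic s' + cubic (- t')"
    using ww(3) unfolding node_chart_def n s_def s'_def by simp
  have y: "(s - s') * (s + s') + (t - t') * (t + t') = 0"
    using arg_cong[OF eq, of Im] by (simp add: cubic_def power2_eq_square field_simps)
  have x: "(s - s') * (2 * (s * s + s * s' + s' * s') - 1) = (t - t') * (2 * (t * t + t * t' + t' * t') - 1)"
    using arg_cong[OF eq, of Re] by (simp add: cubic_def power3_eq_cube algebra_simps)
  have pos: "2 * (a * a + a * b + b * b) - 1 > 0" if "65/100 < a" "65/100 < b" for a b :: real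
  proof -
    have "(65/100) * (65/100) \<le> a * a" "(65/100) * (65/100) \<le> a * b" "(65/100) * (65/100) \<le> b * b"
      using that by (intro mult_mono; simp)+
    then show ?thesis by simp
  qed
  have "s + s' > 0" "t + t' > 0" using st by auto
  have "s = s' \<and> t = t'"
  proof (cases "s - s'" "0::real" rule: linorder_cases)
    case less
    then have "(s - s') * (s + s') < 0" "(s - s') * (2 * (s * s + s * s' + s' * s') - 1) < 0"
      using \<open>s + s' > 0\<close> pos[OF st(1,3)] by (simp_all add: mult_neg_pos)
    then have "(t - t') * (t + t') > 0" "(t - t') * (2 * (t * t + t * t' + t' * t') - 1) < 0"
      using x y by linarith+
    then show ?thesis
      using \<open>t + t' > 0\<close> pos[OF st(2,4)] by (simp add: zero_less_mult_iff mult_less_0_iff)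
  next
    case equal
    then have "(t - t') * (t + t') = 0" using y by simp
    then show ?thesis using equal \<open>t + t' > 0\<close> by simp
  next
    case greater
    then have "(s - s') * (s + s') > 0" "(s - s') * (2 * (s * s + s * s' + s' * s') - 1) > 0"
      using \<open>s + s' > 0\<close> pos[OF st(1,3)] by simp_all
    then have "(t - t') * (t + t') < 0" "(t - t') * (2 * (t * t + t * t' + t' * t') - 1) > 0"
      using x y by linarith+
    then show ?thesis
      using \<open>t + t' > 0\<close> pos[OF st(2,4)] by (simp add: zero_less_mult_iff mult_less_0_iff)
  qed
  then show "w = w'" by (simp add: s_def s'_def t_def t'_def complex_eq_iff)
qed

text \<open>By invariance of domain \<open>node_chart\<close> is a homeomorphism onto an open set.
  On either axis one of its first two summands has the constant value \<open>cubic node\<close>,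
  which the third summand cancels, so that the other branch of the cubic remains.\<close>

lemma transverse_at_node: "transverse_at F (curve D') (\<alpha> node) (\<alpha> (- node))"
proof -
  define G where "G = node_chart ` ball 0 1"
  have cont: "continuous_on (ball 0 1) node_chart"
    unfolding node_chart_def by (intro continuous_intros) auto
  have "open G"
    unfolding G_def by (rule invariance_of_domain[OF cont open_ball inj_node_chart])
  have G: "G \<subseteq> ball 0 1" using node_chart_range by (auto simp: G_def)
  obtain k where k: "homeomorphism (ball 0 1) G node_chart k"
    using invariance_of_domain_homeomorphism[OF open_ball cont _ inj_node_chart] unfolding G_def by auto
  obtain \<theta> where \<theta>: "homeomorphism (\<beta> ` cball 0 1) (cball 0 1) \<theta> \<beta>"
    using \<beta>_homeomorphism .
  have \<theta>\<beta>: "\<theta> (\<beta> x) = x" if "x \<in> ball 0 1" for x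
    using \<theta> that unfolding homeomorphism_def by (metis ball_subset_cball image_eqI subsetD)
  have "homeomorphism (\<beta> ` G) G \<theta> \<beta>"
    by (rule homeomorphism_of_subsets[OF \<theta>]) (use G ball_subset_cball \<theta>\<beta> in \<open>auto simp: image_image subset_iff\<close>)
  then have hom: "homeomorphism (\<beta> ` G) (ball 0 1) (k \<circ> \<theta>) (\<beta> \<circ> node_chart)"
    using homeomorphism_compose[OF _ homeomorphism_symD[OF k]] by blast
  have kn: "k (node_chart x) = x" if "x \<in> ball 0 1" for x
    using k that by (auto simp: homeomorphism_def)
  define A where "A = \<alpha> ` {node - 1/20<..<node + 1/20}"
  define B where "B = \<alpha> ` {- node - 1/20<..<- node + 1/20}"
  have AB: "openin (top_of_set S1) A" "openin (top_of_set S1) B"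
    unfolding A_def B_def by (rule openin_\<alpha>; use node_bounds in simp)+
  have a: "curve D' a \<in> \<beta> ` G \<and> Im ((k \<circ> \<theta>) (curve D' a)) = 0" if a: "a \<in> A" for a
  proof -
    obtain u where "u \<in> {node - 1/20<..<node + 1/20}" "a = \<alpha> u"
      using a unfolding A_def by (rule imageE)
    then have u: "a = \<alpha> u" "\<bar>u - node\<bar> < 1/20" unfolding greaterThanLessThan_iff abs_less_iff by linarith+
    define w where "w = complex_of_real (20 * (u - node))"
    have "norm w = 20 * \<bar>u - node\<bar>" unfolding w_def norm_of_real abs_mult by simp
    then have w: "w \<in> ball 0 1" using u(2) by simp
    have "u \<in> {-1..1}" using u(2) node_bounds(1,2) unfolding atLeastAtMost_iff by linarith
    moreover have "cubic u = node_chart w"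
    proof -
      have "a + 20 * (u - a) / 20 = u" for a :: real by (simp add: field_simps)
      then have "node + Re w / 20 = u" unfolding w_def Re_complex_of_real .
      moreover have "cubic (- node + Im w / 20) = cubic node"
        using node_bounds(3) by (simp add: w_def cubic_eq_iff power2_eq_square)
      ultimately show ?thesis unfolding node_chart_def by simp
    qed
    ultimately have "curve D' a = \<beta> (node_chart w)" using u(1) curve'_in by simp
    then show ?thesis using w kn[OF w] \<theta>\<beta>[OF node_chart_range[OF w]]
      by (simp add: G_def w_def)
  qed
  have b: "curve D' a \<in> \<beta> ` G \<and> Re ((k \<circ> \<theta>) (curve D' a)) = 0" if a: "a \<in> B" for a
  proof -
    obtain u where "u \<in> {- node - 1/20<..<- node + 1/20}" "a = \<alpha> u"
      using a unfolding B_def by (rule imageE)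
    then have u: "a = \<alpha> u" "\<bar>u + node\<bar> < 1/20" unfolding greaterThanLessThan_iff abs_less_iff by linarith+
    define w where "w = Complex 0 (20 * (u + node))"
    have "norm (Complex 0 r) = \<bar>r\<bar>" for r by (simp add: cmod_def)
    then have "norm w = 20 * \<bar>u + node\<bar>" unfolding w_def by (simp only: abs_mult abs_numeral)
    then have w: "w \<in> ball 0 1" using u(2) by simp
    have "u \<in> {-1..1}" using u(2) node_bounds(1,2) unfolding atLeastAtMost_iff by linarith
    moreover have "cubic u = node_chart w"
    proof -
      have "- a + 20 * (u + a) / 20 = u" for a :: real by (simp add: field_simps)
      then have "- node + Im w / 20 = u" unfolding w_def complex.sel .
      then show ?thesis unfolding node_chart_def by (simp add: w_def)
    qed
    ultimately have "curve D' a = \<beta> (node_chart w)" using u(1) curve'_in by simp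
    then show ?thesis using w kn[OF w] \<theta>\<beta>[OF node_chart_range[OF w]]
      by (simp add: G_def w_def)
  qed
  show ?thesis
    unfolding transverse_at_def
  proof (intro exI conjI)
    show "openin (top_of_set F) (\<beta> ` G)" by (rule openin_\<beta>[OF \<open>open G\<close> G])
    show "homeomorphism (\<beta> ` G) (ball 0 1) (k \<circ> \<theta>) (\<beta> \<circ> node_chart)" by (fact hom)
    show "\<alpha> node \<in> A" "\<alpha> (- node) \<in> B" by (simp_all add: A_def B_def)
  qed (use AB a b in auto)
qed

lemma is_diagram': "is_diagram F D'"
proof -
  have fin: "finite (double_params (curve D'))"
    using diagram by (simp add: double_params' is_diagram_def)
  have card2: "card {t \<in> S1. curve D' t = curve D' s} \<le> 2" if s: "s \<in> S1" for s
  proof (cases "s \<in> {\<alpha> node, \<alpha> (- node)}")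
    case True
    have "t \<in> {\<alpha> node, \<alpha> (- node)}" if t: "t \<in> S1" "curve D' t = curve D' s" for t
    proof (rule ccontr)
      assume n: "t \<notin> {\<alpha> node, \<alpha> (- node)}"
      then have "curve D s = curve D t"
        using curve'_eq_iff[OF s t(1)] t(2) True by (metis doubleton_eq_iff insertI1)
      then have "s \<notin> \<alpha> ` {-1..1}" using old_crossing_outside[OF s t(1)] n True by blast
      then show False using True node_in by blast
    qed
    then have "{t \<in> S1. curve D' t = curve D' s} \<subseteq> {\<alpha> node, \<alpha> (- node)}" by blast
    then have "card {t \<in> S1. curve D' t = curve D' s} \<le> card {\<alpha> node, \<alpha> (- node)}"
      by (intro card_mono) auto
    then show ?thesis using card_insert_le_m1[of 2] by (simp add: card_insert_if split: if_splits)
  next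
    case False
    have "curve D' t = curve D' s \<longleftrightarrow> curve D t = curve D s" if "t \<in> S1" for t
      using curve'_eq_iff[OF that s] False by (metis insertI1 insert_commute)
    then have "{t \<in> S1. curve D' t = curve D' s} = {t \<in> S1. curve D t = curve D s}" by blast
    then show ?thesis using diagram s by (simp add: is_diagram_def)
  qed
  have tr: "transverse_at F (curve D') s t \<and> (s \<in> overs D' \<longleftrightarrow> t \<notin> overs D')"
    if st: "s \<in> S1" "t \<in> S1" "s \<noteq> t" "curve D' s = curve D' t" for s t
  proof (cases "curve D s = curve D t")
    case True
    have out: "s \<notin> \<alpha> ` {-1..1}" "t \<notin> \<alpha> ` {-1..1}"
      using old_crossing_outside[OF st(1,2,3) True] old_crossing_outside[OF st(2,1)] st(3) True by auto
    have D: "transverse_at F (curve D) s t" "s \<in> overs D \<longleftrightarrow> t \<notin> overs D"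
      using diagram st True unfolding is_diagram_def by blast+
    obtain U h g A B where *: "openin (top_of_set F) U" "homeomorphism U (ball (0::complex) 1) h g"
      "openin (top_of_set S1) A" "s \<in> A" "curve D ` A \<subseteq> U" "\<forall>a\<in>A. Im (h (curve D a)) = 0"
      "openin (top_of_set S1) B" "t \<in> B" "curve D ` B \<subseteq> U" "\<forall>b\<in>B. Re (h (curve D b)) = 0"
      using D(1) unfolding transverse_at_def by blast
    \<comment> \<open>The neighbourhoods of an old crossing are shrunk so as to avoid the strand;
      there the curve is unchanged and the old chart still works.\<close>
    have "open (- \<alpha> ` {-1..1})" using compact_\<alpha> compact_imp_closed by blast
    then have "openin (top_of_set S1) (A \<inter> - \<alpha> ` {-1..1})" "openin (top_of_set S1) (B \<inter> - \<alpha> ` {-1..1})"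
      using *(3,7) openin_Int_open by blast+
    then have "transverse_at F (curve D') s t"
      unfolding transverse_at_def
      using * out curve'_out
      by (intro exI[of _ U] exI[of _ h] exI[of _ g] exI[of _ "A \<inter> - \<alpha> ` {-1..1}"]
          exI[of _ "B \<inter> - \<alpha> ` {-1..1}"]) auto
    moreover have "s \<noteq> \<alpha> node" "t \<noteq> \<alpha> node" using out node_in by auto
    ultimately show ?thesis using D(2) by (simp add: overs')
  next
    case False
    then have "{s, t} = {\<alpha> node, \<alpha> (- node)}" using curve'_eq_iff[OF st(1-3)] st(4) by blast
    moreover have "\<alpha> (- node) \<notin> overs D"
      using \<alpha>_not_double[OF node_in(2)] diagram by (auto simp: is_diagram_def)
    ultimately show ?thesis
      using transverse_at_node transverse_at_sym[OF transverse_at_node] new_nodes(1)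
      by (auto simp: doubleton_eq_iff overs')
  qed
  have "curve D' s \<in> F" if "s \<in> S1" for s
  proof (cases "s \<in> \<alpha> ` {-1..1}")
    case True
    then show ?thesis using curve'_in_iff[OF that] \<beta>(3) by blast
  next
    case False
    then show ?thesis using curve'_out that is_diagram_subset(1)[OF diagram] by auto
  qed
  moreover have "overs D' \<subseteq> double_params (curve D')"
    using diagram by (auto simp: double_params' overs' is_diagram_def)
  ultimately show ?thesis
    unfolding is_diagram_def using continuous_curve' fin card2 tr by blast
qed

text \<open>The inverse of \<open>\<beta>\<close> is the chart of the move. Among the type 1
  pictures it is the one with its overpass at the positive parameter.\<close>

lemma reidemeister_move_curl: "reidemeister_move F (D, D', \<beta> ` cball 0 1)"
proof -
  let ?T = "Tangle [\<lambda>s. Complex s 0] {}"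
  let ?T' = "Tangle [\<lambda>s. Complex (2 * s ^ 3 - s) ((1 - s\<^sup>2) / 2)] {(0, node)}"
  let ?a = "\<lambda>(i::nat, s). \<alpha> s"
  obtain \<theta> where \<theta>: "homeomorphism (\<beta> ` cball 0 1) (cball 0 1) \<theta> \<beta>"
    using \<beta>_homeomorphism .
  have \<theta>\<beta>: "\<theta> (\<beta> x) = x" if "x \<in> cball 0 1" for x
    using \<theta> that unfolding homeomorphism_def by blast
  have params: "tangle_params ?T = {0} \<times> {-1..1}" "tangle_params ?T' = {0} \<times> {-1..1}"
    by auto
  have img: "?a ` ({0} \<times> {-1..1}) = \<alpha> ` {-1..1}" by force
  have "(?T, ?T') \<in> local_moves"
    unfolding local_moves_def R1_moves_def by blast
  moreover have "inj_on ?a ({0} \<times> {-1..1})"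
    using \<alpha>(2) by (auto simp: inj_on_def)
  moreover have "looks_like D (\<beta> ` cball 0 1) \<theta> ?a ?T"
    unfolding looks_like_single
  proof
    fix s assume s: "(s::real) \<in> {-1..1}"
    have "\<alpha> s \<notin> overs D"
      using \<alpha>_not_double[OF s] diagram by (auto simp: is_diagram_def)
    then show "curve D (\<alpha> s) \<in> \<beta> ` cball 0 1 \<and> \<theta> (curve D (\<alpha> s)) = Complex s 0 \<and>
       (\<alpha> s \<in> overs D \<longleftrightarrow> (0, s) \<in> {})"
      using \<theta>\<beta>[OF of_real_cball[OF s]] curve_in[OF s] of_real_cball[OF s]
      by (auto simp: complex_of_real_def)
  qed
  moreover have "looks_like D' (\<beta> ` cball 0 1) \<theta> ?a ?T'"
    unfolding looks_like_single
  proof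
    fix s assume s: "(s::real) \<in> {-1..1}"
    have "\<alpha> s \<notin> overs D"
      using \<alpha>_not_double[OF s] diagram by (auto simp: is_diagram_def)
    moreover have "\<alpha> s = \<alpha> node \<longleftrightarrow> s = node"
      using inj_on_eq_iff[OF \<alpha>(2) s node_in(1)] .
    ultimately show "curve D' (\<alpha> s) \<in> \<beta> ` cball 0 1 \<and>
       \<theta> (curve D' (\<alpha> s)) = Complex (2 * s ^ 3 - s) ((1 - s\<^sup>2) / 2) \<and>
       (\<alpha> s \<in> overs D' \<longleftrightarrow> (0, s) \<in> {(0, node)})"
      using \<theta>\<beta>[OF cubic_in_cball[OF s]] curve'_in[OF s] cubic_in_cball[OF s]
      by (auto simp: overs' cubic_def)
  qed
  moreover have "curve D s \<notin> \<beta> ` cball 0 1 \<and> curve D' s = curve D s \<and> (s \<in> overs D' \<longleftrightarrow> s \<in> overs D)"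
    if "s \<in> S1 - \<alpha> ` {-1..1}" for s
    using that curve_out curve'_out node_in by (auto simp: overs')
  ultimately have "\<exists>T T' \<theta> \<theta>' a.
        ((T, T') \<in> local_moves \<or> (T', T) \<in> local_moves) \<and>
        homeomorphism (\<beta> ` cball 0 1) (cball (0::complex) 1) \<theta> \<theta>' \<and>
        a ` tangle_params T \<subseteq> S1 \<and> inj_on a (tangle_params T) \<and>
        (\<forall>i<length (strands T). continuous_on {-1..1} (\<lambda>s. a (i, s))) \<and>
        looks_like D (\<beta> ` cball 0 1) \<theta> a T \<and> looks_like D' (\<beta> ` cball 0 1) \<theta> a T' \<and>
        (\<forall>s\<in>S1 - a ` tangle_params T.
           curve D s \<notin> \<beta> ` cball 0 1 \<and> curve D' s = curve D s \<and> (s \<in> overs D' \<longleftrightarrow> s \<in> overs D))"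
    using \<theta> \<alpha>
    apply -
    apply (rule exI[of _ ?T], rule exI[of _ ?T'], rule exI[of _ \<theta>], rule exI[of _ \<beta>], rule exI[of _ ?a])
    apply (simp only: params img)
    apply simp
    done
  then show ?thesis
    unfolding reidemeister_move_def prod.case using diagram is_diagram' \<beta>(3) by blast
qed

end


section \<open>Curls do not change the knot type\<close>

text \<open>Parametrise the unit disc as the cone from \<open>q\<close> over its boundary: \<open>cone_height q x\<close> is
  the number \<open>\<tau>\<close> for which \<open>x - \<tau> *\<^sub>R q\<close> lies on the circle of radius \<open>1 - \<tau>\<close>.  Moving the tip
  of the cone gives a homeomorphism of the disc.\<close>

definition cone_height :: "complex \<Rightarrow> complex \<Rightarrow> real" where
  "cone_height q x = (1 - (norm x)\<^sup>2) /
     ((1 - x \<bullet> q) + sqrt ((1 - x \<bullet> q)\<^sup>2 - (1 - (norm q)\<^sup>2) * (1 - (norm x)\<^sup>2)))"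

lemma inner_less_1:
  fixes x q :: complex
  assumes "norm x \<le> 1" "norm q < 1"
  shows "x \<bullet> q < 1"
proof -
  have "x \<bullet> q \<le> norm x * norm q" by (rule norm_cauchy_schwarz)
  also have "\<dots> \<le> 1 * norm q" using assms by (intro mult_right_mono) auto
  finally show ?thesis using assms by simp
qed

text \<open>With \<open>norm x * norm q\<close> in place of the inner product, the claim is
  \<open>(norm x - norm q)\<^sup>2 \<ge> 0\<close>; the rest is the Cauchy-Schwarz
  inequality.\<close>

lemma cone_discriminant:
  fixes x q :: complex
  assumes "norm x \<le> 1" "norm q < 1"
  shows "(1 - (norm q)\<^sup>2) * (1 - (norm x)\<^sup>2) \<le> (1 - x \<bullet> q)\<^sup>2"
proof -
  have "(1 - (norm q)\<^sup>2) * (1 - (norm x)\<^sup>2) \<le> (1 - norm x * norm q)\<^sup>2"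
  proof -
    have "0 \<le> (norm x - norm q)\<^sup>2" by simp
    then show ?thesis by (simp add: power2_eq_square algebra_simps)
  qed
  also have "\<dots> \<le> (1 - x \<bullet> q)\<^sup>2"
  proof (rule power_mono)
    show "1 - norm x * norm q \<le> 1 - x \<bullet> q" using norm_cauchy_schwarz[of x q] by simp
    have "norm x * norm q \<le> 1 * 1" using assms by (intro mult_mono) auto
    then show "0 \<le> 1 - norm x * norm q" by simp
  qed
  finally show ?thesis .
qed

text \<open>Squaring the cone condition gives the quadratic equation
  \<open>A * \<tau>\<^sup>2 - 2 * b * \<tau> + C = 0\<close>. Its smaller root is written as
  \<open>C / (b + d)\<close>, a form with positive denominator that shows sign and
  continuity.\<close>

lemma cone_height:
  assumes x: "norm x \<le> 1" and q: "norm q < 1"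
  shows "0 \<le> cone_height q x" "cone_height q x \<le> 1"
    "norm (x - cone_height q x *\<^sub>R q) = 1 - cone_height q x"
proof -
  define A where "A = 1 - (norm q)\<^sup>2"
  define b where "b = 1 - x \<bullet> q"
  define C where "C = 1 - (norm x)\<^sup>2"
  define d where "d = sqrt (b\<^sup>2 - A * C)"
  define \<tau> where "\<tau> = cone_height q x"
  have \<tau>: "\<tau> = C / (b + d)" by (simp add: \<tau>_def cone_height_def A_def b_def C_def d_def)
  have A: "A > 0" using q by (simp add: A_def abs_square_less_1)
  have C: "C \<ge> 0" using x by (simp add: C_def abs_square_le_1)
  have b: "b > 0" using inner_less_1[OF x q] by (simp add: b_def)
  have disc: "A * C \<le> b\<^sup>2" using cone_discriminant[OF x q] by (simp add: A_def b_def C_def)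
  have d: "d \<ge> 0" "d\<^sup>2 = b\<^sup>2 - A * C" using disc by (simp_all add: d_def)
  have bd: "b + d > 0" using b d by simp
  have "C \<le> b + d"
  proof (cases "C \<le> b")
    case False
    \<comment> \<open>This is \<open>A + C \<le> 2 * b\<close>, precisely what turns
      \<open>(C - b)\<^sup>2 \<le> d\<^sup>2\<close> into a true inequality after multiplication by
      \<open>C\<close>.\<close>
    have "0 \<le> (norm (x - q))\<^sup>2" by simp
    then have "A + C \<le> 2 * b"
      by (simp add: A_def C_def b_def power2_norm_eq_inner inner_diff_left inner_diff_right inner_commute)
    then have "C * (A + C) \<le> C * (2 * b)" using C by (intro mult_left_mono)
    then have "(C - b)\<^sup>2 \<le> d\<^sup>2" using d(2) by (simp add: power2_eq_square algebra_simps)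
    then have "C - b \<le> d" using d(1) power2_le_imp_le by blast
    then show ?thesis by simp
  qed (use d in simp)
  then have le1: "\<tau> \<le> 1" and ge0: "0 \<le> \<tau>" using bd C by (simp_all add: \<tau>)
  have "A * \<tau>\<^sup>2 - 2 * b * \<tau> + C = 0"
  proof -
    have tw: "\<tau> * (b + d) = C" using bd by (simp add: \<tau>)
    have "(A * \<tau>\<^sup>2 - 2 * b * \<tau> + C) * (b + d)\<^sup>2 =
        A * (\<tau> * (b + d))\<^sup>2 - 2 * b * (\<tau> * (b + d)) * (b + d) + C * (b + d)\<^sup>2"
      by (simp add: power2_eq_square algebra_simps)
    also have "\<dots> = C * (A * C - 2 * b * (b + d) + (b + d)\<^sup>2)"
      unfolding tw by (simp add: power2_eq_square algebra_simps)
    also have "A * C - 2 * b * (b + d) + (b + d)\<^sup>2 = 0"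
      using d(2) by (simp add: power2_eq_square algebra_simps)
    finally show ?thesis using bd by simp
  qed
  then have "(norm (x - \<tau> *\<^sub>R q))\<^sup>2 = (1 - \<tau>)\<^sup>2"
    unfolding power2_norm_eq_inner A_def b_def C_def
    by (simp add: inner_diff_left inner_diff_right inner_commute power2_eq_square algebra_simps)
  then have "norm (x - \<tau> *\<^sub>R q) = 1 - \<tau>"
    using le1 by (simp add: power2_eq_iff_nonneg)
  then show "0 \<le> cone_height q x" "cone_height q x \<le> 1"
    "norm (x - cone_height q x *\<^sub>R q) = 1 - cone_height q x"
    using le1 ge0 by (simp_all add: \<tau>_def)
qed

text \<open>By the triangle inequality, two solutions would differ by at most \<open>norm q\<close>
  times their difference, and \<open>norm q\<close> is less than 1.\<close>

lemma cone_height_unique: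
  assumes x: "norm x \<le> 1" and q: "norm q < 1" and t: "norm (x - t *\<^sub>R q) = 1 - t"
  shows "cone_height q x = t"
proof (rule ccontr)
  let ?s = "cone_height q x"
  assume ne: "?s \<noteq> t"
  have "\<bar>?s - t\<bar> = \<bar>norm (x - t *\<^sub>R q) - norm (x - ?s *\<^sub>R q)\<bar>"
    using cone_height(3)[OF x q] t by simp
  also have "\<dots> \<le> norm ((x - t *\<^sub>R q) - (x - ?s *\<^sub>R q))" by (rule norm_triangle_ineq3)
  also have "(x - t *\<^sub>R q) - (x - ?s *\<^sub>R q) = (?s - t) *\<^sub>R q" by (simp add: algebra_simps)
  also have "norm \<dots> = \<bar>?s - t\<bar> * norm q" by simp
  also have "\<dots> < \<bar>?s - t\<bar>" using ne q by simp
  finally show False by simp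
qed

text \<open>Moves the tip of the cone from \<open>q\<close> to \<open>q + v\<close>, and each point
  in proportion to its height. The default 0 covers tips on the boundary circle, which occur at the
  ends of the strand with \<open>v = 0\<close>.\<close>

definition push :: "complex \<Rightarrow> complex \<Rightarrow> complex \<Rightarrow> complex" where
  "push q v x = x + (if norm q < 1 then cone_height q x else 0) *\<^sub>R v"

text \<open>Point and tip move such that \<open>x - \<tau> *\<^sub>R q\<close> is unchanged. So the
  height with respect to the new tip is the old one, and the push with \<open>- v\<close> undoes the
  first.\<close>

lemma push_in_cball:
  assumes "norm x \<le> 1" "norm q < 1" "norm (q + v) < 1"
  shows "norm (push q v x) \<le> 1" "push (q + v) (- v) (push q v x) = x"
proof -
  let ?t = "cone_height q x"
  note t = cone_height[OF assms(1,2)]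
  have p: "push q v x = x + ?t *\<^sub>R v" using assms(2) by (simp add: push_def)
  have eq: "push q v x - ?t *\<^sub>R (q + v) = x - ?t *\<^sub>R q" by (simp add: p algebra_simps)
  have "norm (push q v x) \<le> norm (push q v x - ?t *\<^sub>R (q + v)) + norm (?t *\<^sub>R (q + v))"
    using norm_triangle_ineq[of "push q v x - ?t *\<^sub>R (q + v)" "?t *\<^sub>R (q + v)"] by simp
  also have "\<dots> \<le> (1 - ?t) + ?t * 1"
    unfolding eq t(3) norm_scaleR using t assms(3)
    by (intro add_left_mono mult_mono) auto
  finally show n: "norm (push q v x) \<le> 1" by simp
  have "cone_height (q + v) (push q v x) = ?t"
    by (rule cone_height_unique[OF n assms(3)]) (simp add: eq t(3))
  then show "push (q + v) (- v) (push q v x) = x"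
    using assms(3) by (subst push_def) (simp add: p)
qed

lemma push_boundary: "norm x = 1 \<Longrightarrow> push q v x = x"
  by (simp add: push_def cone_height_def)

lemma push_zero [simp]: "push q 0 x = x"
  by (simp add: push_def)

lemma push_tip: "norm q < 1 \<Longrightarrow> push q v q = q + v"
  using cone_height_unique[of q q 1] by (simp add: push_def)

text \<open>Needed when the tip approaches the boundary circle: the cone height is not controlled
  there beyond being bounded, but the displacement \<open>v\<close> tends to 0.\<close>

lemma continuous_on_bounded_scaleR:
  fixes v :: "'a::t2_space \<Rightarrow> 'b::real_normed_vector"
  assumes v: "continuous_on A v" and b: "\<And>y. y \<in> A \<Longrightarrow> \<bar>f y\<bar> \<le> 1"
    and f: "continuous_on {y \<in> A. v y \<noteq> 0} f"
  shows "continuous_on A (\<lambda>y. f y *\<^sub>R v y)"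
  unfolding continuous_on_eq_continuous_within
proof
  fix y assume y: "y \<in> A"
  show "continuous (at y within A) (\<lambda>y. f y *\<^sub>R v y)"
  proof (cases "v y = 0")
    case True
    have v0: "(v \<longlongrightarrow> 0) (at y within A)"
      using v y True by (metis continuous_on_def)
    have "((\<lambda>y. f y *\<^sub>R v y) \<longlongrightarrow> 0) (at y within A)"
    proof (rule Lim_null_comparison[OF _ tendsto_norm_zero[OF v0]])
      show "\<forall>\<^sub>F x in at y within A. norm (f x *\<^sub>R v x) \<le> norm (v x)"
        unfolding eventually_at_filter
        by (rule always_eventually) (use b in \<open>auto intro: mult_left_le_one_le\<close>)
    qed
    then show ?thesis using True by (simp add: continuous_within)
  next
    case False
    have "openin (top_of_set A) (A \<inter> v -` (- {0}))"
      by (rule continuous_openin_preimage_gen[OF v]) auto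
    then obtain T where T: "open T" "A \<inter> v -` (- {0}) = A \<inter> T"
      by (auto simp: openin_open)
    have "y \<in> T" "{y \<in> A. v y \<noteq> 0} \<inter> T - {y} = A \<inter> T - {y}" "{y \<in> A. v y \<noteq> 0} = A \<inter> T"
      using T(2) y False by auto
    then have "at y within A = at y within {y \<in> A. v y \<noteq> 0}"
      using T(1) by (intro at_within_nhd[of y T]) auto
    moreover have "continuous_on {y \<in> A. v y \<noteq> 0} (\<lambda>y. f y *\<^sub>R v y)"
      by (intro continuous_intros f continuous_on_subset[OF v]) auto
    ultimately show ?thesis
      using y False by (simp add: continuous_on_eq_continuous_within)
  qed
qed

lemma continuous_on_push:
  fixes q v x :: "'a::t2_space \<Rightarrow> complex"
  assumes q: "continuous_on A q" and v: "continuous_on A v" and x: "continuous_on A x"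
    and nx: "\<And>y. y \<in> A \<Longrightarrow> norm (x y) \<le> 1" and nq: "\<And>y. y \<in> A \<Longrightarrow> v y \<noteq> 0 \<Longrightarrow> norm (q y) < 1"
  shows "continuous_on A (\<lambda>y. push (q y) (v y) (x y))"
  unfolding push_def
proof (rule continuous_on_add[OF x], rule continuous_on_bounded_scaleR[OF v])
  show "\<bar>if norm (q y) < 1 then cone_height (q y) (x y) else 0\<bar> \<le> 1" if "y \<in> A" for y
    using cone_height[OF nx[OF that], of "q y"] by auto
  let ?A = "{y \<in> A. v y \<noteq> 0}"
  have c: "continuous_on ?A q" "continuous_on ?A x"
    using q x by (auto intro: continuous_on_subset)
  have "continuous_on ?A (\<lambda>y. cone_height (q y) (x y))"
    unfolding cone_height_def
  proof (intro continuous_intros c ballI)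
    fix y assume y: "y \<in> ?A"
    then have "x y \<bullet> q y < 1" by (intro inner_less_1 nx nq) auto
    moreover have "0 \<le> sqrt ((1 - x y \<bullet> q y)\<^sup>2 - (1 - (norm (q y))\<^sup>2) * (1 - (norm (x y))\<^sup>2))"
      using cone_discriminant[OF nx nq, of y y] y by simp
    ultimately show "1 - x y \<bullet> q y + sqrt ((1 - x y \<bullet> q y)\<^sup>2 - (1 - (norm (q y))\<^sup>2) * (1 - (norm (x y))\<^sup>2)) \<noteq> 0"
      by linarith
  qed
  then show "continuous_on ?A (\<lambda>y. if norm (q y) < 1 then cone_height (q y) (x y) else 0)"
    by (rule continuous_on_eq) (use nq in auto)
qed

lemma bij_betw_push:
  assumes "norm q < 1" "norm (q + v) < 1"
  shows "bij_betw (push q v) (cball 0 1) (cball 0 1)"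
proof (rule bij_betw_byWitness[where f' = "push (q + v) (- v)"])
  show "\<forall>x\<in>cball 0 1. push (q + v) (- v) (push q v x) = x"
    using push_in_cball[OF _ assms] by simp
  show "\<forall>x\<in>cball 0 1. push q v (push (q + v) (- v) x) = x"
    using push_in_cball(2)[of _ "q + v" "- v"] assms by simp
  show "push q v ` cball 0 1 \<subseteq> cball 0 1"
    using push_in_cball[OF _ assms] by auto
  show "push (q + v) (- v) ` cball 0 1 \<subseteq> cball 0 1"
    using push_in_cball(1)[of _ "q + v" "- v"] assms by auto
qed

text \<open>What both embeddings of the thickened surface have in common. Openness of the images of
  boxes allows an isotopy inside a cylinder to be extended by the identity to
  \<open>S3\<close>.\<close>

definition lift :: "'a::t2_space set \<Rightarrow> ('a \<Rightarrow> real \<Rightarrow> (complex \<times> real) \<times> real) \<Rightarrow> bool" where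
  "lift F L \<longleftrightarrow> continuous_on (F \<times> UNIV) (\<lambda>(p, z). L p z) \<and>
     (\<forall>p\<in>F. \<forall>z. L p z \<in> S3) \<and>
     (\<forall>p\<in>F. \<forall>z. \<forall>p'\<in>F. \<forall>z'. L p z = L p' z' \<longrightarrow> p = p' \<and> z = z') \<and>
     (\<forall>U V. openin (top_of_set F) U \<and> open V \<longrightarrow>
        openin (top_of_set S3) ((\<lambda>(p, z). L p z) ` (U \<times> V)))"

text \<open>As \<open>diagram_of\<close>, but with explicit heights, which inserting curls leaves unchanged.\<close>

definition height_diagram ::
  "'a::topological_space set \<Rightarrow> ('a \<Rightarrow> real \<Rightarrow> (complex \<times> real) \<times> real) \<Rightarrow>
   ((complex \<times> real) \<times> real) set set \<Rightarrow> (complex \<Rightarrow> real) \<Rightarrow> 'a diagram \<Rightarrow> bool" where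
  "height_diagram F L K z D \<longleftrightarrow>
     is_diagram F D \<and> continuous_on S1 z \<and>
     (\<forall>s\<in>S1. \<forall>t\<in>S1. s \<noteq> t \<and> curve D s = curve D t \<and> s \<in> overs D \<longrightarrow> z t < z s) \<and>
     (\<lambda>s. L (curve D s) (z s)) ` S1 \<in> K"

lemma diagram_of_iff: "diagram_of F L K D \<longleftrightarrow> (\<exists>z. height_diagram F L K z D)"
  by (auto simp: diagram_of_def height_diagram_def)

context flat
begin

text \<open>As \<open>z\<close> increases strictly along the strand, every level of the cylinder
  over the disc contains exactly one point of the strand. This point becomes the tip of the cone of
  its level and is pushed to the cubic. Other pieces of the knot miss the cylinder at all heights,
  since their projections avoid the disc.\<close>

lemma curl_isotopic:
  assumes L: "lift F L" and z: "continuous_on S1 z" and mono: "strict_mono_on {-1..1} (z \<circ> \<alpha>)"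
  shows "ambient_isotopic S3 ((\<lambda>s. L (curve D s) (z s)) ` S1) ((\<lambda>s. L (curve D' s) (z s)) ` S1)"
proof -
  define \<zeta> where "\<zeta> = z \<circ> \<alpha>"
  define a where "a = \<zeta> (- 1)"
  define b where "b = \<zeta> 1"
  have c\<zeta>: "continuous_on {-1..1} \<zeta>"
    unfolding \<zeta>_def by (intro continuous_on_compose \<alpha> continuous_on_subset[OF z \<alpha>(3)])
  have inj: "inj_on \<zeta> {-1..1}"
    using mono strict_mono_on_imp_inj_on unfolding \<zeta>_def by blast
  have mono': "\<zeta> s < \<zeta> t" if "s < t" "s \<in> {-1..1}" "t \<in> {-1..1}" for s t
    using mono that unfolding \<zeta>_def strict_mono_on_def by blast
  have mono'': "\<zeta> s \<le> \<zeta> t" if "s \<le> t" "s \<in> {-1..1}" "t \<in> {-1..1}" for s t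
    using mono'[of s t] that by (cases "s = t") auto
  have ab: "a < b" unfolding a_def b_def by (rule mono') auto
  have img: "\<zeta> ` {-1..1} = {a..b}"
  proof
    show "\<zeta> ` {-1..1} \<subseteq> {a..b}" using mono'' by (auto simp: a_def b_def)
    have "connected (\<zeta> ` {-1..1})" by (rule connected_continuous_image[OF c\<zeta>]) simp
    then show "{a..b} \<subseteq> \<zeta> ` {-1..1}"
      by (rule connected_contains_Icc) (auto simp: a_def b_def)
  qed
  obtain \<sigma> where \<sigma>: "homeomorphism {-1..1} {a..b} \<zeta> \<sigma>"
    using homeomorphism_compact[OF compact_Icc c\<zeta> img inj] by blast
  have \<sigma>\<zeta>: "\<sigma> (\<zeta> s) = s" if "s \<in> {-1..1}" for s using \<sigma> that by (auto simp: homeomorphism_def)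
  have \<zeta>\<sigma>: "\<zeta> (\<sigma> h) = h" "\<sigma> h \<in> {-1..1}" if "h \<in> {a..b}" for h
    using \<sigma> that unfolding homeomorphism_def by blast+
  have c\<sigma>: "continuous_on {a..b} \<sigma>" using \<sigma> by (simp add: homeomorphism_def)

  \<comment> \<open>The tip moves along the segment from the straight strand to the cubic and stays
    inside the disc by convexity. At the bottom and top levels the two agree, so \<open>v\<close>
    vanishes there.\<close>
  define v where "v = (\<lambda>t h. t *\<^sub>R (cubic (\<sigma> h) - of_real (\<sigma> h)) :: complex)"
  define P where "P = (\<lambda>t (x, h). (push (of_real (\<sigma> h)) (v t h) x, h))"
  have v0: "v t h = 0" if "\<bar>\<sigma> h\<bar> = 1" for t h
    using that cubic_ends by (auto simp: v_def abs_if split: if_splits)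
  have v1: "norm (of_real (\<sigma> h) + v t h) < 1" if "\<bar>\<sigma> h\<bar> < 1" "t \<in> {0..1}" for t h
  proof -
    have "of_real (\<sigma> h) + v t h = (1 - t) *\<^sub>R of_real (\<sigma> h) + t *\<^sub>R cubic (\<sigma> h)"
      by (simp add: v_def algebra_simps)
    moreover have "convex (ball (0::complex) 1)" by simp
    ultimately show ?thesis
      using convexD_alt[of "ball (0::complex) 1" "of_real (\<sigma> h)" "cubic (\<sigma> h)" t] that norm_cubic[of "\<sigma> h"]
      by simp
  qed
  have end_h: "\<bar>\<sigma> h\<bar> = 1" if "h \<in> {a..b}" "\<not> (a < h \<and> h < b)" for h
  proof -
    have "h = a \<or> h = b" using that by auto
    then show ?thesis using \<sigma>\<zeta>[of 1] \<sigma>\<zeta>[of "-1"] by (auto simp: a_def b_def)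
  qed
  have lt_or_eq: "\<bar>\<sigma> h\<bar> < 1 \<or> \<bar>\<sigma> h\<bar> = 1" if "h \<in> {a..b}" for h
    using \<zeta>\<sigma>(2)[OF that] by auto
  have push_bij: "bij_betw (push (of_real (\<sigma> h)) (v t h)) (cball 0 1) (cball 0 1)"
    if "h \<in> {a..b}" "t \<in> {0..1}" for t h
  proof (cases "\<bar>\<sigma> h\<bar> = 1")
    case True
    then have "push (of_real (\<sigma> h)) (v t h) = (\<lambda>x. x)" by (simp add: v0 fun_eq_iff)
    then show ?thesis by (simp add: bij_betw_def)
  next
    case False
    then have "\<bar>\<sigma> h\<bar> < 1" using lt_or_eq[OF that(1)] by simp
    then show ?thesis using v1[of h t] that(2) by (intro bij_betw_push) auto
  qed

  define C where "C = cball (0::complex) 1 \<times> {a..b}"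
  define E where "E = (\<lambda>(x, h). L (\<beta> x) h)"
  have Lc: "continuous_on (F \<times> UNIV) (\<lambda>(p, z). L p z)"
    and LS: "\<And>p z. p \<in> F \<Longrightarrow> L p z \<in> S3"
    and Linj: "\<And>p z p' z'. p \<in> F \<Longrightarrow> p' \<in> F \<Longrightarrow> L p z = L p' z' \<Longrightarrow> p = p' \<and> z = z'"
    and Lop: "\<And>U V. openin (top_of_set F) U \<Longrightarrow> open V \<Longrightarrow>
        openin (top_of_set S3) ((\<lambda>(p, z). L p z) ` (U \<times> V))"
    using L unfolding lift_def by blast+
  have \<beta>F: "\<beta> x \<in> F" if "x \<in> cball 0 1" for x using \<beta>(3) that by blast
  have \<beta>F': "\<beta> x \<in> F" if "norm x \<le> 1" for x using \<beta>F that by simp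
  have "compact C" by (simp add: C_def compact_Times)
  have cE: "continuous_on C E"
  proof -
    have "continuous_on C (\<lambda>y. (\<beta> (fst y), snd y))"
      by (intro continuous_intros continuous_on_compose2[OF \<beta>(1)]) (auto simp: C_def)
    then have "continuous_on C (\<lambda>y. (\<lambda>(p, z). L p z) (\<beta> (fst y), snd y))"
      by (rule continuous_on_compose2[OF Lc]) (auto simp: C_def \<beta>F')
    then show ?thesis by (simp add: E_def case_prod_beta)
  qed
  have iE: "inj_on E C"
  proof (rule inj_onI, clarify)
    fix x h x' h' assume *: "(x, h) \<in> C" "(x', h') \<in> C" "E (x, h) = E (x', h')"
    then have x: "x \<in> cball 0 1" "x' \<in> cball 0 1" by (auto simp: C_def)
    have "\<beta> x = \<beta> x' \<and> h = h'" using * Linj[OF \<beta>F[OF x(1)] \<beta>F[OF x(2)]] by (simp add: E_def)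
    then show "x = x' \<and> h = h'" using inj_onD[OF \<beta>(2) _ x] by blast
  qed
  obtain R where R: "homeomorphism C (E ` C) E R"
    using homeomorphism_compact[OF \<open>compact C\<close> cE refl iE] by blast
  have RE: "R (E y) = y" if "y \<in> C" for y using R that by (auto simp: homeomorphism_def)
  have ER: "E (R y) = y" "R y \<in> C" if "y \<in> E ` C" for y
    using R that unfolding homeomorphism_def by blast+
  have cR: "continuous_on (E ` C) R" using R by (simp add: homeomorphism_def)
  have ECS: "E ` C \<subseteq> S3" using LS \<beta>F by (auto simp: E_def C_def)

  \<comment> \<open>The closed complement of the open cylinder. It overlaps the closed cylinder in
    the boundary only, where each stage is the identity, so that the two definitions of the isotopy
    fit together.\<close>
  define W where "W = S3 - E ` (ball 0 1 \<times> {a<..<b})"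
  have "closed W"
  proof -
    have "E ` (ball 0 1 \<times> {a<..<b}) = (\<lambda>(p, z). L p z) ` ((\<beta> ` ball 0 1) \<times> {a<..<b})"
      by (force simp: E_def)
    then have "openin (top_of_set S3) (E ` (ball 0 1 \<times> {a<..<b}))"
      using Lop[OF \<beta>(4), of "{a<..<b}"] by simp
    then obtain T where "open T" "E ` (ball 0 1 \<times> {a<..<b}) = S3 \<inter> T" by (auto simp: openin_open)
    then have "W = S3 \<inter> - T" by (auto simp: W_def)
    then show ?thesis using \<open>open T\<close> by (simp only: closed_Int closed_sphere closed_Compl)
  qed
  have P_fix: "P t (R y) = R y" if "y \<in> W" "y \<in> E ` C" for t y
  proof -
    obtain x h where xh: "R y = (x, h)" by force
    have y: "y = E (x, h)" "(x, h) \<in> C" using ER[OF that(2)] xh by auto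
    then have "x \<notin> ball 0 1 \<or> h \<notin> {a<..<b}" using that(1) by (auto simp: W_def)
    moreover have x: "norm x \<le> 1" "h \<in> {a..b}" using y(2) by (auto simp: C_def)
    ultimately have "norm x = 1 \<or> \<bar>\<sigma> h\<bar> = 1" using end_h[OF x(2)] by auto
    then show ?thesis using push_boundary v0 by (auto simp: xh P_def)
  qed
  have P_bij: "bij_betw (P t) C C" if t: "t \<in> {0..1}" for t
    unfolding bij_betw_def
  proof
    show "inj_on (P t) C"
      using push_bij[OF _ t] unfolding inj_on_def bij_betw_def by (auto simp: C_def P_def)
    show "P t ` C = C"
    proof (intro equalityI subsetI)
      fix y assume "y \<in> P t ` C"
      then show "y \<in> C"
        using push_bij[OF _ t] bij_betwE by (fastforce simp: C_def P_def simp del: mem_cball_0 mem_cball)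
    next
      fix y assume "y \<in> C"
      then obtain x h where y: "y = (x, h)" "x \<in> cball 0 1" "h \<in> {a..b}" by (auto simp: C_def)
      then obtain x' where "x' \<in> cball 0 1" "x = push (of_real (\<sigma> h)) (v t h) x'"
        using push_bij[OF y(3) t] unfolding bij_betw_def by blast
      then show "y \<in> P t ` C" using y by (force simp: C_def P_def)
    qed
  qed
  define H where "H = (\<lambda>t y. if y \<in> E ` C then E (P t (R y)) else y)"
  have "ambient_isotopy S3 H"
  proof (rule ambient_isotopy_compactI)
    show "compact S3" by simp
    have cov: "{0..1::real} \<times> S3 = {0..1} \<times> E ` C \<union> {0..1} \<times> W"
    proof -
      have "E ` (ball 0 1 \<times> {a<..<b}) \<subseteq> E ` C"
        by (rule image_mono) (auto simp: C_def)
      then show ?thesis using ECS by (auto simp: W_def)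
    qed
    have cP: "continuous_on ({0..1} \<times> E ` C) (\<lambda>y. P (fst y) (R (snd y)))"
    proof -
      let ?A = "{0..1::real} \<times> E ` C"
      have cr: "continuous_on ?A (\<lambda>y. R (snd y))"
        by (rule continuous_on_compose2[OF cR]) (auto intro!: continuous_intros)
      have ch: "continuous_on ?A (\<lambda>y. \<sigma> (snd (R (snd y))))"
      proof (rule continuous_on_compose2[OF c\<sigma> continuous_on_snd[OF cr]])
        show "(\<lambda>y. snd (R (snd y))) ` ?A \<subseteq> {a..b}"
        proof (rule image_subsetI)
          fix y assume "y \<in> ?A"
          then have "R (snd y) \<in> C" using ER(2) by (simp add: mem_Times_iff)
          then show "snd (R (snd y)) \<in> {a..b}" by (simp add: C_def mem_Times_iff)
        qed
      qed
      have "continuous_on ?A (\<lambda>y. push (of_real (\<sigma> (snd (R (snd y))))) (v (fst y) (snd (R (snd y)))) (fst (R (snd y))))"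
      proof (rule continuous_on_push)
        show "continuous_on ?A (\<lambda>y. complex_of_real (\<sigma> (snd (R (snd y)))))"
          by (intro continuous_intros ch)
        show "continuous_on ?A (\<lambda>y. v (fst y) (snd (R (snd y))))"
          unfolding v_def by (intro continuous_intros ch)
        show "continuous_on ?A (\<lambda>y. fst (R (snd y)))"
          by (intro continuous_intros cr)
        fix y assume y: "y \<in> ?A"
        then have "R (snd y) \<in> C" using ER(2) by (simp add: mem_Times_iff)
        then have xh: "fst (R (snd y)) \<in> cball 0 1" "snd (R (snd y)) \<in> {a..b}" by (simp_all add: C_def mem_Times_iff)
        then show "norm (fst (R (snd y))) \<le> 1" by simp
        assume "v (fst y) (snd (R (snd y))) \<noteq> 0"
        then show "norm (complex_of_real (\<sigma> (snd (R (snd y))))) < 1"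
          using v0 lt_or_eq[OF xh(2)] by auto
      qed
      then have "continuous_on ?A (\<lambda>y. (push (of_real (\<sigma> (snd (R (snd y))))) (v (fst y) (snd (R (snd y)))) (fst (R (snd y))),
          snd (R (snd y))))"
        by (intro continuous_on_Pair continuous_intros cr)
      then show ?thesis by (simp add: P_def case_prod_beta)
    qed
    have PC: "P t (R y) \<in> C" if "t \<in> {0..1}" "y \<in> E ` C" for t y
      using P_bij[OF that(1)] ER(2)[OF that(2)] by (auto simp: bij_betw_def)
    have "continuous_on ({0..1} \<times> E ` C \<union> {0..1} \<times> W)
        (\<lambda>y. if snd y \<in> E ` C then E (P (fst y) (R (snd y))) else snd y)"
    proof (rule continuous_on_cases)
      have "compact (E ` C)" by (rule compact_continuous_image[OF cE \<open>compact C\<close>])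
      then show "closed ({0..1::real} \<times> E ` C)" by (intro closed_Times compact_imp_closed) auto
      show "closed ({0..1::real} \<times> W)" by (intro closed_Times \<open>closed W\<close>) auto
      show "continuous_on ({0..1} \<times> E ` C) (\<lambda>y. E (P (fst y) (R (snd y))))"
        by (rule continuous_on_compose2[OF cE cP]) (intro image_subsetI PC; simp add: mem_Times_iff)
      show "continuous_on ({0..1} \<times> W) snd" by (intro continuous_intros)
      show "\<forall>x. x \<in> {0..1} \<times> E ` C \<and> snd x \<notin> E ` C \<or> x \<in> {0..1} \<times> W \<and> snd x \<in> E ` C \<longrightarrow>
          E (P (fst x) (R (snd x))) = snd x"
        using P_fix ER(1) by (metis mem_Times_iff)
    qed
    then show "continuous_on ({0..1} \<times> S3) (\<lambda>(t, x). H t x)"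
      unfolding cov H_def case_prod_beta .
  next
    fix t :: real assume t: "t \<in> {0..1}"
    have "bij_betw E C (E ` C)" using iE by (simp add: bij_betw_def)
    moreover have "bij_betw R (E ` C) C"
    proof (rule bij_betw_byWitness[where f' = E])
      show "\<forall>y\<in>E ` C. E (R y) = y" using ER(1) by blast
      show "\<forall>y\<in>C. R (E y) = y" using RE by blast
      show "R ` E ` C \<subseteq> C" using ER(2) by blast
    qed simp
    ultimately have "bij_betw (E \<circ> P t \<circ> R) (E ` C) (E ` C)"
      using bij_betw_trans[OF bij_betw_trans[OF _ P_bij[OF t]]] by (simp add: comp_assoc)
    then have "bij_betw (H t) (E ` C) (E ` C)"
      by (rule bij_betw_cong[THEN iffD1, rotated]) (simp add: H_def)
    moreover have "bij_betw (H t) (S3 - E ` C) (S3 - E ` C)"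
      by (rule bij_betw_cong[THEN iffD1, OF _ bij_betw_id]) (simp add: H_def)
    ultimately have "bij_betw (H t) (E ` C \<union> (S3 - E ` C)) (E ` C \<union> (S3 - E ` C))"
      by (rule bij_betw_combine) auto
    then show "bij_betw (H t) S3 S3" using ECS by (simp add: Un_absorb1)
  next
    fix y assume "y \<in> S3"
    have "P 0 w = w" for w by (cases w) (simp add: P_def v_def)
    then show "H 0 y = y" using ER by (simp add: H_def)
  qed
  moreover have "H 1 (L (curve D s) (z s)) = L (curve D' s) (z s)" if s: "s \<in> S1" for s
  proof (cases "s \<in> \<alpha> ` {-1..1}")
    case True
    then obtain u where u: "u \<in> {-1..1}" "s = \<alpha> u" by (rule imageE)
    have \<zeta>u: "z s = \<zeta> u" "\<zeta> u \<in> {a..b}" using u img by (auto simp: \<zeta>_def)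
    have inC: "(of_real u, \<zeta> u) \<in> C" using of_real_cball[OF u(1)] \<zeta>u(2) by (simp add: C_def)
    have "P 1 (of_real u, \<zeta> u) = (cubic u, \<zeta> u)"
    proof (cases "\<bar>u\<bar> < 1")
      case True
      then show ?thesis by (simp add: P_def \<sigma>\<zeta>[OF u(1)] push_tip v_def)
    next
      case False
      then have "u = 1 \<or> u = -1" using u(1) by auto
      then show ?thesis using \<sigma>\<zeta>[OF u(1)] by (auto simp: P_def v_def cubic_ends)
    qed
    moreover have "L (curve D s) (z s) = E (of_real u, \<zeta> u)"
      using curve_in[OF u(1)] u(2) \<zeta>u(1) by (simp add: E_def)
    moreover have "L (curve D' s) (z s) = E (cubic u, \<zeta> u)"
      using curve'_in[OF u(1)] u(2) \<zeta>u(1) by (simp add: E_def)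
    ultimately show ?thesis using inC RE[OF inC] by (simp add: H_def)
  next
    case False
    have "curve D s \<in> F" using is_diagram_subset(1)[OF diagram] s by blast
    have "L (curve D s) (z s) \<notin> E ` C"
    proof
      assume "L (curve D s) (z s) \<in> E ` C"
      then obtain x h where "x \<in> cball 0 1" "L (curve D s) (z s) = L (\<beta> x) h"
        by (auto simp: E_def C_def)
      then have "curve D s = \<beta> x" using Linj[OF \<open>curve D s \<in> F\<close> \<beta>F] by blast
      then show False using curve_out[OF s False] \<open>x \<in> cball 0 1\<close> by blast
    qed
    then show ?thesis using curve'_out[OF False] by (simp add: H_def)
  qed
  ultimately show ?thesis
    unfolding ambient_isotopic_def
    by (intro exI[of _ H]) (auto simp: image_image intro!: image_cong)
qed

text \<open>With \<open>z\<close> unchanged, the only new crossing has its underpass at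
  \<open>- node\<close> and its overpass at \<open>node\<close>, in the order of increasing
  height.\<close>

lemma height_diagram_curl:
  assumes L: "lift F L" and K: "K \<in> knot_types" and D: "height_diagram F L K z D"
    and mono: "strict_mono_on {-1..1} (z \<circ> \<alpha>)"
  shows "height_diagram F L K z D'"
proof -
  have z: "continuous_on S1 z" and
    c: "\<And>s t. s \<in> S1 \<Longrightarrow> t \<in> S1 \<Longrightarrow> s \<noteq> t \<Longrightarrow> curve D s = curve D t \<Longrightarrow> s \<in> overs D \<Longrightarrow> z t < z s"
    and k: "(\<lambda>s. L (curve D s) (z s)) ` S1 \<in> K"
    using D unfolding height_diagram_def by blast+
  have "z t < z s"
    if st: "s \<in> S1" "t \<in> S1" "s \<noteq> t" "curve D' s = curve D' t" "s \<in> overs D'" for s t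
  proof (cases "curve D s = curve D t")
    case True
    then have "s \<noteq> \<alpha> node"
      using old_crossing_outside[OF st(1-3)] node_in by blast
    then show ?thesis using c[OF st(1-3) True] st(5) by (simp add: overs')
  next
    case False
    then have "{s, t} = {\<alpha> node, \<alpha> (- node)}" using curve'_eq_iff[OF st(1-3)] st(4) by blast
    moreover have "\<alpha> (- node) \<notin> overs D"
      using \<alpha>_not_double[OF node_in(2)] diagram by (auto simp: is_diagram_def)
    ultimately have "s = \<alpha> node" "t = \<alpha> (- node)"
      using st(5) by (auto simp: overs' doubleton_eq_iff)
    moreover have "- node < node" using node_bounds by simp
    ultimately show ?thesis
      using mono node_in unfolding strict_mono_on_def by (metis comp_apply)
  qed
  moreover have "(\<lambda>s. L (curve D' s) (z s)) ` S1 \<in> K"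
    using knot_types_isotopic[OF K k curl_isotopic[OF L z mono]] .
  ultimately show ?thesis
    unfolding height_diagram_def using is_diagram' z by blast
qed

end


section \<open>New flat discs from old ones\<close>

lemma flat_disc_is_flat: "flat_disc F D \<beta> \<alpha> \<Longrightarrow> is_diagram F D \<Longrightarrow> flat F D \<beta> \<alpha>"
  by (simp add: flat_def)

context flat
begin

lemma flat_subdisc:
  assumes "0 < \<rho>" "\<bar>x\<bar> + \<rho> \<le> 1"
  shows "flat_disc F D (\<lambda>w. \<beta> (of_real x + of_real \<rho> * w)) (\<lambda>s. \<alpha> (x + \<rho> * s))"
proof -
  define f where "f = (\<lambda>w. complex_of_real x + of_real \<rho> * w)"
  have nf: "norm (f w) \<le> \<bar>x\<bar> + \<rho> * norm w" for w
    using norm_triangle_ineq[of "of_real x" "of_real \<rho> * w"] assms(1) by (simp add: f_def norm_mult)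
  have fc: "f w \<in> cball 0 1" if "w \<in> cball 0 1" for w
  proof -
    have "\<rho> * norm w \<le> \<rho> * 1" using that assms(1) by (intro mult_left_mono) auto
    then show ?thesis using nf[of w] assms(2) by simp
  qed
  have fb: "f w \<in> ball 0 1" if "w \<in> ball 0 1" for w
  proof -
    have "\<rho> * norm w < \<rho> * 1" using that assms(1) by (intro mult_strict_left_mono) auto
    then show ?thesis using nf[of w] assms(2) by simp
  qed
  have f_inj: "f w = f w' \<Longrightarrow> w = w'" for w w' using assms(1) by (simp add: f_def)
  have l: "x + \<rho> * s \<in> {-1..1}" if "s \<in> {-1..1}" for s
  proof -
    have "\<bar>\<rho> * s\<bar> \<le> \<rho> * 1" unfolding abs_mult using that assms(1) by (intro mult_mono) auto
    then show ?thesis using assms(2) by (auto simp: abs_le_iff)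
  qed
  have op: "openin (top_of_set F) (\<beta> ` f ` ball 0 1)"
  proof (rule openin_\<beta>)
    have "inj f" using f_inj by (auto simp: inj_def)
    then show "open (f ` ball 0 1)"
      by (intro invariance_of_domain) (auto simp: f_def intro!: continuous_intros intro: inj_on_subset)
  qed (use fb in blast)
  have c: "continuous_on (cball 0 1) (\<lambda>w. \<beta> (f w))"
    by (rule continuous_on_compose2[OF \<beta>(1)]) (use fc in \<open>auto simp: f_def intro!: continuous_intros\<close>)
  have i: "inj_on (\<lambda>w. \<beta> (f w)) (cball 0 1)"
    by (rule inj_onI) (use f_inj inj_onD[OF \<beta>(2)] fc in blast)
  have c': "continuous_on {-1..1} (\<lambda>s. \<alpha> (x + \<rho> * s))"
    by (rule continuous_on_compose2[OF \<alpha>(1)]) (use l in \<open>auto intro!: continuous_intros\<close>)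
  have i': "inj_on (\<lambda>s. \<alpha> (x + \<rho> * s)) {-1..1}"
  proof (rule inj_onI)
    fix s t assume "s \<in> {-1..1}" "t \<in> {-1..1}" "\<alpha> (x + \<rho> * s) = \<alpha> (x + \<rho> * t)"
    then have "x + \<rho> * s = x + \<rho> * t" using inj_onD[OF \<alpha>(2)] l by blast
    then show "s = t" using assms(1) by simp
  qed
  have cu: "curve D (\<alpha> (x + \<rho> * s)) = \<beta> (f (of_real s))" if "s \<in> {-1..1}" for s
    using curve_in[OF l[OF that]] by (simp add: f_def)
  have out: "curve D t \<notin> (\<lambda>w. \<beta> (f w)) ` cball 0 1"
    if t: "t \<in> S1" "t \<notin> (\<lambda>s. \<alpha> (x + \<rho> * s)) ` {-1..1}" for t
  proof
    assume "curve D t \<in> (\<lambda>w. \<beta> (f w)) ` cball 0 1"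
    then obtain w where w: "w \<in> cball 0 1" "curve D t = \<beta> (f w)" by (rule imageE)
    then have "t \<in> \<alpha> ` {-1..1}" using curve_in_iff[OF t(1)] fc by blast
    then obtain u where u: "u \<in> {-1..1}" "t = \<alpha> u" by (rule imageE)
    then have "of_real u = f w"
      using w curve_in[OF u(1)] inj_onD[OF \<beta>(2)] fc[OF w(1)] of_real_cball[OF u(1)] by metis
    then have "of_real (u - x) = of_real \<rho> * w" by (simp add: f_def)
    then have "w = of_real ((u - x) / \<rho>)" using assms(1) by (simp add: field_simps)
    then have "\<bar>(u - x) / \<rho>\<bar> \<le> 1" using w(1) by (simp only: mem_cball_0 norm_of_real)
    then have "(u - x) / \<rho> \<in> {-1..1}" unfolding atLeastAtMost_iff abs_le_iff by linarith
    moreover have "t = \<alpha> (x + \<rho> * ((u - x) / \<rho>))" using assms(1) u(2) by simp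
    ultimately show False using t(2) image_eqI by blast
  qed
  have "flat_disc F D (\<lambda>w. \<beta> (f w)) (\<lambda>s. \<alpha> (x + \<rho> * s))"
    unfolding flat_disc_def
    by (intro conjI c i c' i' op[unfolded image_image] ballI cu image_subsetI subsetD[OF \<beta>(3)] imageI fc \<alpha>_S1 l)
      (assumption | (erule DiffE, rule out))+
  then show ?thesis by (simp only: f_def)
qed

lemma flat_other:
  assumes "flat_disc F D \<beta>2 \<alpha>2" "\<beta>2 ` cball 0 1 \<inter> \<beta> ` cball 0 1 = {}"
  shows "flat_disc F D' \<beta>2 \<alpha>2"
proof -
  interpret o: flat F D \<beta>2 \<alpha>2 using assms(1) diagram by (rule flat_disc_is_flat)
  have "\<alpha>2 s \<notin> \<alpha> ` {-1..1}" if "s \<in> {-1..1}" for s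
  proof
    assume "\<alpha>2 s \<in> \<alpha> ` {-1..1}"
    then have "\<beta>2 (of_real s) \<in> \<beta> ` cball 0 1"
      using curve_in_iff[OF o.\<alpha>_S1[OF that]] unfolding o.curve_in[OF that] by blast
    then show False using imageI[OF o.of_real_cball[OF that], of \<beta>2] assms(2) by blast
  qed
  then have "curve D' (\<alpha>2 s) = \<beta>2 (of_real s)" if "s \<in> {-1..1}" for s
    using curve'_out o.curve_in that by metis
  moreover have "curve D' s \<notin> \<beta>2 ` cball 0 1" if "s \<in> S1 - \<alpha>2 ` {-1..1}" for s
    using curve'_in_iff[of s] curve'_out[of s] o.curve_out[of s] assms(2) that by (metis DiffD1 DiffD2 IntI empty_iff)
  ultimately show ?thesis using assms(1) unfolding flat_disc_def by blast
qed

text \<open>A strip around the top of the loop is again a flat disc.\<close>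

definition strip :: "complex \<Rightarrow> complex" where
  "strip w = cubic (Re w / 10) + \<i> * of_real (Im w / 10)"

lemma strip_sel: "Re (strip w) = 2 * (Re w / 10) ^ 3 - Re w / 10"
  "Im (strip w) = (1 - (Re w / 10)\<^sup>2) / 2 + Im w / 10"
  by (simp_all add: strip_def cubic_def)

lemma cball_abs: "w \<in> cball 0 1 \<Longrightarrow> \<bar>Re w\<bar> \<le> 1 \<and> \<bar>Im w\<bar> \<le> 1"
  using abs_Re_le_cmod[of w] abs_Im_le_cmod[of w] by auto

lemma small_square: "\<bar>r\<bar> \<le> 1/10 \<Longrightarrow> r\<^sup>2 \<le> (1/100 :: real)"
  using power_mono[of "\<bar>r\<bar>" "1/10" 2] by (simp add: power2_eq_square)

lemma strip_in_ball:
  assumes "w \<in> cball 0 1"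
  shows "strip w \<in> ball 0 1"
proof -
  define r where "r = Re w / 10"
  have w: "\<bar>r\<bar> \<le> 1/10" "\<bar>Im w / 10\<bar> \<le> 1/10" using cball_abs[OF assms] by (auto simp: r_def)
  have q: "0 \<le> r\<^sup>2" "r\<^sup>2 \<le> 1/100" using small_square[OF w(1)] by auto
  have "\<bar>2 * r ^ 3 - r\<bar> = \<bar>r\<bar> * \<bar>2 * r\<^sup>2 - 1\<bar>"
    by (simp add: abs_mult[symmetric] power2_eq_square power3_eq_cube algebra_simps)
  also have "\<dots> \<le> 1/10 * 1" using w q by (intro mult_mono) auto
  finally have "\<bar>Re (strip w)\<bar> \<le> 1/10" by (simp add: strip_sel r_def)
  moreover have "Im (strip w) \<le> 6/10" "- Im (strip w) \<le> 6/10"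
    using abs_le_D1[OF w(2)] abs_le_D2[OF w(2)] q unfolding strip_sel r_def[symmetric] by argo+
  ultimately have "norm (strip w) < 1" using cmod_le[of "strip w"] by linarith
  then show ?thesis by simp
qed

text \<open>For parameters of modulus at most 1/10, the divided difference
  \<open>2 * (r\<^sup>2 + r * t + t\<^sup>2) - 1\<close> of the first coordinate is negative; so
  \<open>Re w\<close>, and then \<open>Im w\<close>, can be recovered.\<close>

lemma inj_strip: "inj_on strip (cball 0 1)"
proof (rule inj_onI)
  fix w w' assume w: "w \<in> cball 0 1" "w' \<in> cball 0 1" "strip w = strip w'"
  define r where "r = Re w / 10"
  define t where "t = Re w' / 10"
  have rt: "\<bar>r\<bar> \<le> 1/10" "\<bar>t\<bar> \<le> 1/10" using cball_abs w(1,2) by (auto simp: r_def t_def)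
  have "2 * r ^ 3 - r = 2 * t ^ 3 - t"
    using arg_cong[OF w(3), of Re] unfolding strip_sel r_def t_def .
  then have "(r - t) * (2 * (r\<^sup>2 + r * t + t\<^sup>2) - 1) = 0"
    by (simp add: power2_eq_square power3_eq_cube algebra_simps)
  moreover have "2 * (r\<^sup>2 + r * t + t\<^sup>2) < 1"
  proof -
    have "0 \<le> (r - t)\<^sup>2" by simp
    then show ?thesis using small_square[OF rt(1)] small_square[OF rt(2)] by (simp add: power2_diff)
  qed
  ultimately have "r = t" by auto
  then have "Im w = Im w'"
    using arg_cong[OF w(3), of Im] unfolding strip_sel r_def[symmetric] t_def[symmetric] by simp
  then show "w = w'" using \<open>r = t\<close> by (simp add: complex_eq_iff r_def t_def)
qed

text \<open>The delicate point is that no other part of the cubic enters the strip. This is what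
  fixes its size: a tenth in both directions.\<close>

lemma flat_nested: "flat_disc F D' (\<lambda>w. \<beta> (strip w)) (\<lambda>s. \<alpha> (s / 10))"
proof -
  have sc: "strip w \<in> cball 0 1" if "w \<in> cball 0 1" for w
    using strip_in_ball[OF that] ball_subset_cball by blast
  have cs: "continuous_on A strip" for A
    unfolding strip_def by (intro continuous_intros) auto
  have c: "continuous_on (cball 0 1) (\<lambda>w. \<beta> (strip w))"
    by (rule continuous_on_compose2[OF \<beta>(1) cs]) (use sc in blast)
  have i: "inj_on (\<lambda>w. \<beta> (strip w)) (cball 0 1)"
    by (rule inj_onI) (use inj_onD[OF inj_strip] inj_onD[OF \<beta>(2)] sc in blast)
  have l: "s / 10 \<in> {-1..1}" if "s \<in> {-1..1}" for s :: real using that by auto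
  have c': "continuous_on {-1..1} (\<lambda>s. \<alpha> (s / 10))"
    by (rule continuous_on_compose2[OF \<alpha>(1)]) (use l in \<open>auto intro!: continuous_intros\<close>)
  have i': "inj_on (\<lambda>s. \<alpha> (s / 10)) {-1..1}"
  proof (rule inj_onI)
    fix s t :: real assume "s \<in> {-1..1}" "t \<in> {-1..1}" "\<alpha> (s / 10) = \<alpha> (t / 10)"
    then have "s / 10 = t / 10" using inj_onD[OF \<alpha>(2)] l by blast
    then show "s = t" by simp
  qed
  have op: "openin (top_of_set F) (\<beta> ` strip ` ball 0 1)"
  proof (rule openin_\<beta>)
    show "open (strip ` ball 0 1)"
      by (rule invariance_of_domain[OF cs open_ball inj_on_subset[OF inj_strip ball_subset_cball]])
  qed (use strip_in_ball ball_subset_cball in blast)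
  have cu: "curve D' (\<alpha> (s / 10)) = \<beta> (strip (of_real s))" if "s \<in> {-1..1}" for s
    using curve'_in[OF l[OF that]] by (simp add: strip_def)
  have out: "curve D' t \<notin> (\<lambda>w. \<beta> (strip w)) ` cball 0 1"
    if t: "t \<in> S1" "t \<notin> (\<lambda>s. \<alpha> (s / 10)) ` {-1..1}" for t
  proof
    assume "curve D' t \<in> (\<lambda>w. \<beta> (strip w)) ` cball 0 1"
    then obtain w where w: "w \<in> cball 0 1" "curve D' t = \<beta> (strip w)" by (rule imageE)
    then have "t \<in> \<alpha> ` {-1..1}" using curve'_in_iff[OF t(1)] sc by blast
    then obtain u where u: "u \<in> {-1..1}" "t = \<alpha> u" by (rule imageE)
    then have eq: "cubic u = strip w"
      using w curve'_in[OF u(1)] inj_onD[OF \<beta>(2)] sc[OF w(1)] cubic_in_cball[OF u(1)] by metis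
    define r where "r = Re w / 10"
    have wr: "\<bar>r\<bar> \<le> 1/10" "\<bar>Im w\<bar> \<le> 1" using cball_abs[OF w(1)] by (auto simp: r_def)
    have "u \<noteq> r"
    proof
      assume "u = r"
      moreover from this have "10 * r \<in> {-1..1}" using wr by (auto simp: abs_le_iff)
      ultimately show False using t(2) u(2) by force
    qed
    moreover have "2 * u ^ 3 - u = 2 * r ^ 3 - r"
      using arg_cong[OF eq, of Re] unfolding strip_sel r_def[symmetric] by (simp add: cubic_def)
    then have "(u - r) * (2 * (u\<^sup>2 + u * r + r\<^sup>2) - 1) = 0"
      by (simp add: power2_eq_square power3_eq_cube algebra_simps)
    \<comment> \<open>Impossible: the left-hand side is at most
      \<open>3 * (u\<^sup>2 + r\<^sup>2)\<close>, where \<open>r\<^sup>2\<close> is at most 1/100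
      and, by the second coordinate, \<open>u\<^sup>2\<close> exceeds \<open>r\<^sup>2\<close> by at
      most 1/5.\<close>
    ultimately have "2 * (u\<^sup>2 + u * r + r\<^sup>2) = 1" by auto
    moreover have "u\<^sup>2 = r\<^sup>2 - Im w / 5"
      using arg_cong[OF eq, of Im] unfolding strip_sel r_def[symmetric] by (simp add: cubic_def field_simps)
    moreover have "0 \<le> (u - r)\<^sup>2" by simp
    then have "2 * (u * r) \<le> u\<^sup>2 + r\<^sup>2" by (simp add: power2_diff)
    ultimately show False using small_square[OF wr(1)] wr(2) by (simp add: abs_le_iff)
  qed
  show ?thesis
    unfolding flat_disc_def
    by (intro conjI c i c' i' op[unfolded image_image] ballI cu image_subsetI subsetD[OF \<beta>(3)] imageI sc \<alpha>_S1 l)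
      (assumption | (erule DiffE, rule out))+
qed

end

lemma curl_commute:
  assumes "\<alpha> ` {-1..1} \<inter> \<alpha>2 ` {-1..1} = {}"
  shows "curl \<beta> \<alpha> (curl \<beta>2 \<alpha>2 D) = curl \<beta>2 \<alpha>2 (curl \<beta> \<alpha> D)"
proof -
  have "s \<notin> \<alpha> ` {-1..1} \<or> s \<notin> \<alpha>2 ` {-1..1}" for s using assms by blast
  then show ?thesis
    unfolding curl_def diagram.sel diagram.inject by (intro conjI ext insert_commute) auto
qed


section \<open>Nests of curls\<close>

text \<open>Six disjoint pieces of a strand carry nests of curls, the \<open>i\<close>-th curl of the nest \<open>j\<close> having its
  node at the parameters \<open>foot j i b\<close>.\<close>

definition centre :: "nat \<Rightarrow> real" where "centre j = (2 * real j - 5) / 6"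
text \<open>The first disc of a nest has radius 1/10, and each further curl takes place in a strip
  with a tenth of the parameters. Deeper curls thus have their feet nearer to the centre.\<close>

definition radius :: "nat \<Rightarrow> real" where "radius i = node / 10 ^ Suc i"
definition foot :: "nat \<Rightarrow> nat \<Rightarrow> bool \<Rightarrow> real" where
  "foot j i b = centre j + (if b then radius i else - radius i)"

lemma radius_pos: "0 < radius i"
  by (simp add: radius_def)

lemma radius_less_iff: "radius i < radius i' \<longleftrightarrow> i' < i"
proof -
  have "node > 0" by simp
  moreover have "(10::real) ^ Suc i' < 10 ^ Suc i \<longleftrightarrow> i' < i" by simp
  ultimately show ?thesis unfolding radius_def by (simp add: divide_less_eq less_divide_eq del: power_Suc)
qed

lemma radius_small: "radius i < 1/10"
proof -
  have "(10::real) \<le> 10 ^ Suc i" by (simp add: self_le_power)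
  then have "radius i \<le> node / 10" unfolding radius_def by (intro divide_left_mono) auto
  also have "node / 10 < 1 / 10"
    by (rule divide_strict_right_mono[OF order.strict_trans[OF node_bounds(2)]]) auto
  finally show ?thesis .
qed

lemma centre_separated:
  assumes "j \<noteq> j'"
  shows "\<bar>centre j - centre j'\<bar> \<ge> 1/3"
proof -
  have "1 \<le> \<bar>int j - int j'\<bar>" using assms by linarith
  then have "real_of_int 1 \<le> real_of_int \<bar>int j - int j'\<bar>" by (rule of_int_le_iff[THEN iffD2])
  then have "1 \<le> \<bar>real j - real j'\<bar>" by simp
  moreover have "centre j - centre j' = (real j - real j') / 3" by (simp add: centre_def field_simps)
  ultimately show ?thesis by (simp only: abs_divide) simp
qed

lemma centre_bound: "j < 6 \<Longrightarrow> \<bar>centre j\<bar> \<le> 5/6"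
  by (auto simp: centre_def abs_le_iff)

lemma foot_near: "\<bar>foot j i b - centre j\<bar> = radius i"
  using radius_pos[of i] by (simp add: foot_def)

lemma foot_eq_iff: "foot j i b = foot j' i' b' \<longleftrightarrow> j = j' \<and> i = i' \<and> b = b'"
proof
  assume eq: "foot j i b = foot j' i' b'"
  have "\<bar>centre j - centre j'\<bar> < 1/3"
    using foot_near[of j i b] foot_near[of j' i' b'] radius_small[of i] radius_small[of i'] eq by linarith
  then have j: "j = j'" using centre_separated[of j j'] by (cases "j = j'") auto
  then have "radius i = radius i'" using foot_near[of j i b] foot_near[of j' i' b'] eq by simp
  then have "i = i'" using radius_less_iff[of i i'] radius_less_iff[of i' i] by (cases i i' rule: linorder_cases) auto
  then show "j = j' \<and> i = i' \<and> b = b'"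
    using j eq radius_pos[of i] by (auto simp: foot_def split: if_splits)
qed auto

text \<open>Radii decrease with the depth, and different nests are kept apart because their centres
  have distance at least 1/3 while all radii are below 1/10. This determines which feet lie on the
  loop of a curl.\<close>

lemma foot_between_iff: "\<bar>foot j' i' b - centre j\<bar> < radius i \<longleftrightarrow> j' = j \<and> i < i'"
proof (cases "j' = j")
  case True
  then show ?thesis by (simp add: foot_near radius_less_iff)
next
  case False
  then have "\<not> \<bar>foot j' i' b - centre j\<bar> < radius i"
    using centre_separated[OF False] foot_near[of j' i' b] radius_small[of i] radius_small[of i'] by linarith
  then show ?thesis using False by simp
qed

lemma foot_in: "j < 6 \<Longrightarrow> foot j i b \<in> {-1..1}"
  using centre_bound[of j] foot_near[of j i b] radius_small[of i] by (auto simp: abs_le_iff abs_if split: if_splits)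

text \<open>The strand that is still straight when the nest \<open>j\<close> has \<open>n\<close>
  curls, and thus the place of the next curl.\<close>

definition nest_disc :: "(real \<Rightarrow> complex) \<Rightarrow> nat \<Rightarrow> nat \<Rightarrow> real \<Rightarrow> complex" where
  "nest_disc \<alpha> j n s = \<alpha> (centre j + s / 10 ^ Suc n)"

lemma nest_disc_node: "nest_disc \<alpha> j n node = \<alpha> (foot j n True)" "nest_disc \<alpha> j n (- node) = \<alpha> (foot j n False)"
  by (simp_all add: nest_disc_def foot_def radius_def)

text \<open>Apart from the crossings of \<open>D0\<close>, the only ones of \<open>D\<close> are those of nests of depths \<open>d j\<close>.\<close>

definition nested :: "'a diagram \<Rightarrow> (real \<Rightarrow> complex) \<Rightarrow> (nat \<Rightarrow> nat) \<Rightarrow> 'a diagram \<Rightarrow> bool" where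
  "nested D0 \<alpha> d D \<longleftrightarrow> (\<forall>s\<in>S1. \<forall>t\<in>S1. s \<noteq> t \<longrightarrow>
     (curve D s = curve D t \<longleftrightarrow> curve D0 s = curve D0 t \<or>
       (\<exists>j<6. \<exists>i<d j. {s, t} = {\<alpha> (foot j i True), \<alpha> (foot j i False)})))"

lemma nested_curl:
  assumes n: "nested D0 \<alpha> d D" and f: "flat_disc F D \<beta> (nest_disc \<alpha> j (d j))" and D: "is_diagram F D" and j: "j < 6"
  shows "nested D0 \<alpha> (d(j := Suc (d j))) (curl \<beta> (nest_disc \<alpha> j (d j)) D)"
proof -
  interpret flat F D \<beta> "nest_disc \<alpha> j (d j)" using f D by (rule flat_disc_is_flat)
  have "(\<exists>j'<6. \<exists>i<(d(j := Suc (d j))) j'. Q j' i) \<longleftrightarrow> (\<exists>j'<6. \<exists>i<d j'. Q j' i) \<or> Q j (d j)" for Q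
    using j by (auto simp: less_Suc_eq split: if_splits)
  then show ?thesis
    using n unfolding nested_def by (simp add: curve'_eq_iff nest_disc_node)
qed

definition nest_tower ::
  "'a::t2_space set \<Rightarrow> ('a \<Rightarrow> real \<Rightarrow> (complex \<times> real) \<times> real) \<Rightarrow> ((complex \<times> real) \<times> real) set set \<Rightarrow>
   (complex \<Rightarrow> real) \<Rightarrow> 'a diagram \<Rightarrow> (real \<Rightarrow> complex) \<Rightarrow> (nat \<Rightarrow> nat) \<Rightarrow> (nat \<Rightarrow> complex \<Rightarrow> 'a) \<Rightarrow> 'a diagram \<Rightarrow> bool" where
  "nest_tower F L K z D0 \<alpha> d \<beta> D \<longleftrightarrow>
     height_diagram F L K z D \<and> nested D0 \<alpha> d D \<and>
     (\<forall>j<6. flat_disc F D (\<beta> j) (nest_disc \<alpha> j (d j))) \<and>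
     (\<forall>i<6. \<forall>j<6. i \<noteq> j \<longrightarrow> \<beta> i ` cball 0 1 \<inter> \<beta> j ` cball 0 1 = {})"

locale nests =
  fixes F :: "'a::t2_space set" and L K z D0 \<beta>0 \<alpha>
  assumes lift: "lift F L" and K: "K \<in> knot_types"
    and D0: "height_diagram F L K z D0" "flat_disc F D0 \<beta>0 \<alpha>"
    and mono: "strict_mono_on {-1..1} (z \<circ> \<alpha>)"
begin

lemma is_diagram_D0: "is_diagram F D0" using D0(1) by (simp add: height_diagram_def)

sublocale base: flat F D0 \<beta>0 \<alpha>
  using D0(2) is_diagram_D0 by (rule flat_disc_is_flat)

lemma nest_disc_param: "j < 6 \<Longrightarrow> s \<in> {-1..1} \<Longrightarrow> centre j + s / 10 ^ Suc n \<in> {-1..1}"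
proof -
  assume a: "j < 6" "s \<in> {-1..1}"
  have "1 \<le> (10::real) ^ n" by (simp add: one_le_power)
  then have "\<bar>s\<bar> / 10 ^ Suc n \<le> 1 / 10" using a(2) by (intro frac_le) auto
  then have "\<bar>s / 10 ^ Suc n\<bar> \<le> 1/10" by (simp add: abs_divide)
  then show ?thesis using centre_bound[OF a(1)] unfolding atLeastAtMost_iff by linarith
qed

lemma mono_nest_disc: "j < 6 \<Longrightarrow> strict_mono_on {-1..1} (z \<circ> nest_disc \<alpha> j n)"
  unfolding strict_mono_on_def
proof (intro allI impI)
  fix r s :: real assume *: "j < 6" "r \<in> {-1..1} \<and> s \<in> {-1..1} \<and> r < s"
  then have "centre j + r / 10 ^ Suc n < centre j + s / 10 ^ Suc n" by (simp add: divide_strict_right_mono)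
  then show "(z \<circ> nest_disc \<alpha> j n) r < (z \<circ> nest_disc \<alpha> j n) s"
    using strict_mono_onD[OF mono nest_disc_param nest_disc_param, of j r j s n n] * by (simp add: nest_disc_def)
qed

text \<open>Discs of radius 1/10 fit into the unit disc, as the centres have modulus at most 5/6,
  and are disjoint, as the centres are at least 1/3 apart.\<close>

lemma nest_tower_start: "nest_tower F L K z D0 \<alpha> (\<lambda>_. 0) (\<lambda>j w. \<beta>0 (of_real (centre j) + of_real (1/10) * w)) D0"
proof -
  have "flat_disc F D0 (\<lambda>w. \<beta>0 (of_real (centre j) + of_real (1/10) * w)) (nest_disc \<alpha> j 0)" if "j < 6" for j
    using base.flat_subdisc[of "1/10" "centre j"] centre_bound[OF that] by (simp add: nest_disc_def[abs_def])
  moreover have "(\<lambda>w. \<beta>0 (of_real (centre i) + of_real (1/10) * w)) ` cball 0 1 \<inter>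
      (\<lambda>w. \<beta>0 (of_real (centre j) + of_real (1/10) * w)) ` cball 0 1 = {}" if "i < 6" "j < 6" "i \<noteq> j" for i j
  proof (rule ccontr)
    assume "\<not> ?thesis"
    then obtain w w' where w: "w \<in> cball 0 1" "w' \<in> cball 0 1"
      "\<beta>0 (of_real (centre i) + of_real (1/10) * w) = \<beta>0 (of_real (centre j) + of_real (1/10) * w')" by blast
    have "complex_of_real (centre k) + of_real (1/10) * w \<in> cball 0 1" if "k < 6" "w \<in> cball 0 1" for k w
      using norm_triangle_ineq[of "of_real (centre k)" "of_real (1/10) * w"] centre_bound[OF that(1)] that(2)
      by (simp add: norm_mult del: of_real_divide)
    then have "complex_of_real (centre i) + of_real (1/10) * w = of_real (centre j) + of_real (1/10) * w'"
      using inj_onD[OF base.\<beta>(2) w(3)] w that by blast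
    then have "complex_of_real (centre i - centre j) = of_real (1/10) * (w' - w)"
      by (simp add: algebra_simps del: of_real_divide)
    then have "\<bar>centre i - centre j\<bar> = 1/10 * norm (w' - w)"
      by (metis norm_of_real norm_mult abs_of_nonneg zero_le_divide_1_iff zero_le_numeral)
    also have "\<dots> \<le> 1/10 * 2" using norm_triangle_ineq4[of w' w] w by simp
    finally show False using centre_separated[OF that(3)] by simp
  qed
  ultimately show ?thesis
    using D0(1) unfolding nest_tower_def nested_def by auto
qed

lemma nest_tower_step:
  assumes T: "nest_tower F L K z D0 \<alpha> d \<beta> D" and j: "j < 6"
  shows "nest_tower F L K z D0 \<alpha> (d(j := Suc (d j))) (\<beta>(j := \<lambda>w. \<beta> j (flat.strip w))) (curl (\<beta> j) (nest_disc \<alpha> j (d j)) D)"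
proof -
  have D: "height_diagram F L K z D" "nested D0 \<alpha> d D"
    and f: "\<And>i. i < 6 \<Longrightarrow> flat_disc F D (\<beta> i) (nest_disc \<alpha> i (d i))"
    and disj: "\<And>i i'. i < 6 \<Longrightarrow> i' < 6 \<Longrightarrow> i \<noteq> i' \<Longrightarrow> \<beta> i ` cball 0 1 \<inter> \<beta> i' ` cball 0 1 = {}"
    using T unfolding nest_tower_def by blast+
  have dia: "is_diagram F D" using D(1) by (simp add: height_diagram_def)
  interpret flat F D "\<beta> j" "nest_disc \<alpha> j (d j)" using f[OF j] dia by (rule flat_disc_is_flat)
  have sub: "(\<beta>(j := \<lambda>w. \<beta> j (strip w))) i ` cball 0 1 \<subseteq> \<beta> i ` cball 0 1" for i
  proof -
    have "strip w \<in> cball 0 1" if "w \<in> cball 0 1" for w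
      using strip_in_ball[OF that] ball_subset_cball by blast
    then show ?thesis by (cases "i = j") (simp_all add: image_subset_iff del: mem_cball_0 mem_cball)
  qed
  have "nest_disc \<alpha> j (Suc (d j)) = (\<lambda>s. nest_disc \<alpha> j (d j) (s / 10))"
    by (simp add: nest_disc_def fun_eq_iff)
  then have "flat_disc F D' ((\<beta>(j := \<lambda>w. \<beta> j (strip w))) i) (nest_disc \<alpha> i ((d(j := Suc (d j))) i))" if "i < 6" for i
    using flat_nested flat_other[OF f[OF that] disj[OF that j]] by (cases "i = j") auto
  moreover have "(\<beta>(j := \<lambda>w. \<beta> j (strip w))) i ` cball 0 1 \<inter> (\<beta>(j := \<lambda>w. \<beta> j (strip w))) i' ` cball 0 1 = {}"
    if "i < 6" "i' < 6" "i \<noteq> i'" for i i'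
    using sub[of i] sub[of i'] disj[OF that] by blast
  ultimately show ?thesis
    unfolding nest_tower_def
    using height_diagram_curl[OF lift K D(1) mono_nest_disc[OF j]] nested_curl[OF D(2) f[OF j] dia j] by blast
qed

lemma nest_tower_raise:
  assumes "nest_tower F L K z D0 \<alpha> d \<beta> D" "j < 6"
  shows "\<exists>\<beta>' D'. nest_tower F L K z D0 \<alpha> (d(j := d j + n)) \<beta>' D'"
proof (induction n)
  case 0
  then show ?case using assms(1) by auto
next
  case (Suc n)
  then obtain \<beta>' D' where "nest_tower F L K z D0 \<alpha> (d(j := d j + n)) \<beta>' D'" by blast
  from nest_tower_step[OF this assms(2)] show ?case
    unfolding fun_upd_upd fun_upd_same add_Suc_right by blast
qed

definition depths :: "nat \<Rightarrow> nat" where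
  "depths = (\<lambda>_. 0)(1 := 1, 2 := 2, 3 := 3, 4 := 4, 5 := 4)"

lemma depths_eq: "depths j = (if j < 5 then j else if j = 5 then 4 else 0)"
  by (auto simp: depths_def)

lemma nest_tower_exists: obtains \<beta> D where "nest_tower F L K z D0 \<alpha> depths \<beta> D"
proof -
  have r: "\<exists>\<beta> D. nest_tower F L K z D0 \<alpha> (d(j := n)) \<beta> D"
    if "\<exists>\<beta> D. nest_tower F L K z D0 \<alpha> d \<beta> D" "j < 6" "d j = 0" for d j n
    using that nest_tower_raise[of d _ _ j n] by force
  have "\<exists>\<beta> D. nest_tower F L K z D0 \<alpha> depths \<beta> D"
    unfolding depths_def by (intro r; (use nest_tower_start in blast)?; simp)
  then show ?thesis using that by blast
qed

end


section \<open>An invariant of diagrams\<close>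

text \<open>The crossing at \<open>s\<close> and \<open>t\<close> cuts the curve into two loops.\<close>

definition has_loop :: "complex set \<Rightarrow> nat \<Rightarrow> complex \<Rightarrow> complex \<Rightarrow> bool" where
  "has_loop X k s t \<longleftrightarrow> (\<exists>A B. connected A \<and> connected B \<and> A \<union> B = S1 - {s, t} \<and> A \<inter> B = {} \<and> card (A \<inter> X) = k)"

text \<open>Either of the two loops may have length \<open>k\<close>, since reparametrisations can
  reverse the circle and nothing singles out one of the loops. A crossing is counted by its two
  parameters.\<close>

definition loop_params :: "'a diagram \<Rightarrow> nat \<Rightarrow> complex set" where
  "loop_params D k = {s \<in> S1. \<exists>t\<in>S1. t \<noteq> s \<and> curve D t = curve D s \<and> has_loop (double_params (curve D)) k s t}"

lemma loop_params_subset: "loop_params D k \<subseteq> double_params (curve D)"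
  by (auto simp: loop_params_def double_params_def)

lemma has_loop_homeomorphic:
  assumes \<phi>: "homeomorphism S1 S1 \<phi> \<psi>" and X: "X \<subseteq> S1" and st: "s \<in> S1" "t \<in> S1" and l: "has_loop X k s t"
  shows "has_loop (\<phi> ` X) k (\<phi> s) (\<phi> t)"
proof -
  obtain A B where AB: "connected A" "connected B" "A \<union> B = S1 - {s, t}" "A \<inter> B = {}" "card (A \<inter> X) = k"
    using l unfolding has_loop_def by blast
  have inj: "inj_on \<phi> S1" and img: "\<phi> ` S1 = S1" and c: "continuous_on S1 \<phi>"
    using \<phi> unfolding homeomorphism_def by (metis inj_on_def)+
  have sub: "A \<subseteq> S1" "B \<subseteq> S1" using AB(3) by auto
  have "connected (\<phi> ` A)" "connected (\<phi> ` B)"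
    using AB(1,2) sub c connected_continuous_image continuous_on_subset by blast+
  moreover have "\<phi> ` A \<union> \<phi> ` B = S1 - {\<phi> s, \<phi> t}"
    using inj_on_image_set_diff[OF inj, of S1 "{s, t}"] st unfolding image_Un[symmetric] AB(3) img by auto
  moreover have "\<phi> ` A \<inter> \<phi> ` B = {}"
    using inj_on_image_Int[OF inj sub] AB(4) by simp
  moreover have "card (\<phi> ` A \<inter> \<phi> ` X) = k"
    using inj_on_image_Int[OF inj sub(1) X] AB(5) card_image[OF inj_on_subset[OF inj, of "A \<inter> X"]] sub by auto
  ultimately show ?thesis unfolding has_loop_def by blast
qed

text \<open>The invariant only depends on which parameters coincide under the curve, and an
  injective map of the surface preserves this. The reparametrisation then carries double parameters
  and loops to such.\<close>

lemma card_loop_params_le: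
  assumes c: "carries h D E" and h: "inj_on h F" and D: "is_diagram F D" and E: "is_diagram F E"
  shows "card (loop_params D k) \<le> card (loop_params E k)"
proof -
  obtain \<phi> \<psi> where \<phi>: "homeomorphism S1 S1 \<phi> \<psi>"
    and cu: "\<And>s. s \<in> S1 \<Longrightarrow> curve E (\<phi> s) = h (curve D s)"
    using c by (auto simp: carries_def)
  have inj: "inj_on \<phi> S1" and img: "\<phi> ` S1 = S1"
    using \<phi> unfolding homeomorphism_def by (metis inj_on_def)+
  have eq: "curve E (\<phi> s) = curve E (\<phi> t) \<longleftrightarrow> curve D s = curve D t" if "s \<in> S1" "t \<in> S1" for s t
    using that cu inj_on_eq_iff[OF h] is_diagram_subset(1)[OF D] by (metis image_subset_iff)
  have dp: "double_params (curve E) = \<phi> ` double_params (curve D)"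
  proof (intro equalityI subsetI)
    fix u assume "u \<in> double_params (curve E)"
    then obtain v where uv: "u \<in> S1" "v \<in> S1" "v \<noteq> u" "curve E v = curve E u"
      by (auto simp: double_params_def simp del: mem_sphere_0)
    then obtain s t where st: "s \<in> S1" "u = \<phi> s" "t \<in> S1" "v = \<phi> t" using img by (metis imageE)
    then have "t \<noteq> s" "curve D t = curve D s" using uv eq by auto
    then have "s \<in> double_params (curve D)" using st(1,3) unfolding double_params_def by blast
    then show "u \<in> \<phi> ` double_params (curve D)" using st(2) by blast
  next
    fix u assume "u \<in> \<phi> ` double_params (curve D)"
    then obtain s t where st: "s \<in> S1" "t \<in> S1" "t \<noteq> s" "curve D t = curve D s" "u = \<phi> s"
      by (auto simp: double_params_def simp del: mem_sphere_0)
    then have "\<phi> s \<in> S1" "\<phi> t \<in> S1" "\<phi> t \<noteq> \<phi> s" "curve E (\<phi> t) = curve E (\<phi> s)"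
      using img inj_on_eq_iff[OF inj] eq by blast+
    then show "u \<in> double_params (curve E)" unfolding double_params_def st(5) mem_Collect_eq by blast
  qed
  have X: "double_params (curve D) \<subseteq> S1" by (auto simp: double_params_def)
  have "\<phi> ` loop_params D k \<subseteq> loop_params E k"
  proof (rule image_subsetI)
    fix s assume "s \<in> loop_params D k"
    then obtain t where st: "s \<in> S1" "t \<in> S1" "t \<noteq> s" "curve D t = curve D s"
      "has_loop (double_params (curve D)) k s t" unfolding loop_params_def by blast
    then have "\<phi> t \<noteq> \<phi> s" "curve E (\<phi> t) = curve E (\<phi> s)"
      using inj_on_eq_iff[OF inj] eq by auto
    moreover have "\<phi> s \<in> S1" "\<phi> t \<in> S1" using img st(1,2) by blast+
    moreover have "has_loop (double_params (curve E)) k (\<phi> s) (\<phi> t)"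
      using has_loop_homeomorphic[OF \<phi> X st(1,2,5)] unfolding dp .
    ultimately show "\<phi> s \<in> loop_params E k" unfolding loop_params_def by blast
  qed
  moreover have "finite (loop_params E k)"
    by (rule finite_subset[OF loop_params_subset]) (use E in \<open>simp add: is_diagram_def\<close>)
  moreover have "inj_on \<phi> (loop_params D k)"
    using inj by (rule inj_on_subset) (auto simp: loop_params_def)
  ultimately show ?thesis using card_inj_on_le by blast
qed

lemma card_loop_params_isotopic:
  assumes "isotopic_diagrams F D E" "is_diagram F D" "is_diagram F E"
  shows "card (loop_params D k) = card (loop_params E k)"
proof -
  have *: "card (loop_params D k) \<le> card (loop_params E k)"
    if iso: "isotopic_diagrams F D E" "is_diagram F D" "is_diagram F E" for D E
  proof -
    obtain H where H: "ambient_isotopy F H" "carries (H 1) D E"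
      using iso(1) by (auto simp: isotopic_diagrams_def)
    have "inj_on (H 1) F" using ambient_isotopy_bij[OF H(1), of 1] by (simp add: bij_betw_def)
    from card_loop_params_le[OF H(2) this iso(2,3)] show ?thesis .
  qed
  show ?thesis using *[OF assms] *[OF isotopic_diagrams_sym[OF assms(1,2)] assms(3,2)] by simp
qed

section \<open>Arcs of the circle\<close>

lemma circle_simple_path:
  defines "c \<equiv> \<lambda>x. cis (2 * pi * x)"
  shows "simple_path c" "pathfinish c = pathstart c" "path_image c = S1"
proof -
  have "x = y \<or> x = 0 \<and> y = 1 \<or> x = 1 \<and> y = 0"
    if xy: "x \<in> {0..1}" "y \<in> {0..1}" "c x = c y" for x y
  proof -
    obtain n :: int where "2 * pi * x = 2 * pi * y + 2 * pi * n"
      using xy(3) sin_cos_eq_iff[of "2 * pi * x" "2 * pi * y"] by (auto simp: c_def complex_eq_iff)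
    then have "2 * pi * (x - (y + n)) = 0" by (simp add: algebra_simps)
    then have "x = y + n" by simp
    moreover from this have "\<bar>real_of_int n\<bar> \<le> 1" using xy by (auto simp: abs_le_iff)
    then have "n = 0 \<or> n = 1 \<or> n = -1" by linarith
    ultimately show ?thesis using xy by auto
  qed
  then show "simple_path c"
    unfolding simple_path_def loop_free_def path_def c_def by (auto intro!: continuous_intros)
  show "pathfinish c = pathstart c" by (simp add: c_def pathfinish_def pathstart_def)
  show "path_image c = S1"
  proof (intro equalityI subsetI)
    fix z assume z: "z \<in> S1"
    define x where "x = Arg2pi z / (2 * pi)"
    have "0 \<le> x" "x \<le> 1" "z = c x"
      using Arg2pi[of z] z by (simp_all add: x_def c_def cis_conv_exp is_Arg_def)
    then show "z \<in> path_image c" by (simp add: path_image_def)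
  qed (auto simp: path_image_def c_def)
qed

text \<open>The last two properties say that each closed arc is irreducible between its ends. They
  serve to recognise a given arc with these ends as one of the two.\<close>

lemma circle_minus_two_points:
  assumes "s \<in> S1" "t \<in> S1" "s \<noteq> t"
  obtains U V where "U \<union> V = S1 - {s, t}" "U \<inter> V = {}" "connected U" "connected V" "U \<noteq> {}" "V \<noteq> {}"
    "closed (U \<union> {s, t})" "closed (V \<union> {s, t})"
    "\<forall>C. connected C \<and> C \<subseteq> U \<union> {s, t} \<and> s \<in> C \<and> t \<in> C \<longrightarrow> C = U \<union> {s, t}"
    "\<forall>C. connected C \<and> C \<subseteq> V \<union> {s, t} \<and> s \<in> C \<and> t \<in> C \<longrightarrow> C = V \<union> {s, t}"
proof -
  obtain u d where ud: "arc u" "arc d" "pathstart u = s" "pathfinish u = t" "pathstart d = t" "pathfinish d = s"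
    "path_image u \<inter> path_image d = {s, t}" "path_image u \<union> path_image d = S1"
    using exists_double_arc[OF circle_simple_path(1,2)] circle_simple_path(3) assms by metis
  \<comment> \<open>Pulled back to the unit interval, a connected set containing both 0 and 1 is
    everything.\<close>
  have whole: "C = path_image g"
    if g: "arc g" "pathstart g \<in> C" "pathfinish g \<in> C" and C: "connected C" "C \<subseteq> path_image g"
    for g :: "real \<Rightarrow> complex" and C
  proof -
    obtain g' where g': "homeomorphism {0..1} (path_image g) g g'"
      using homeomorphism_arc[OF g(1)] .
    have "connected (g' ` C)"
      using C g' by (meson connected_continuous_image continuous_on_subset homeomorphism_def)
    moreover have "0 \<in> g' ` C" "1 \<in> g' ` C"
    proof -
      have "g' (g 0) = 0" "g' (g 1) = 1" using g' unfolding homeomorphism_def by auto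
      then show "0 \<in> g' ` C" "1 \<in> g' ` C"
        using g(2,3) unfolding pathstart_def pathfinish_def by (metis image_eqI)+
    qed
    ultimately have "{0..1} \<subseteq> g' ` C" by (simp add: connected_contains_Icc)
    have "path_image g \<subseteq> C"
    proof
      fix x assume x: "x \<in> path_image g"
      then have "g' x \<in> {0..1}" using g' unfolding homeomorphism_def by blast
      then obtain y where y: "y \<in> C" "g' y = g' x" using \<open>{0..1} \<subseteq> g' ` C\<close> by auto
      then have "y = x" using g' x C(2) unfolding homeomorphism_def by (metis subsetD)
      then show "x \<in> C" using y by simp
    qed
    then show ?thesis using C(2) by blast
  qed
  have ne: "path_image c - {s, t} \<noteq> {}" "connected (path_image c - {s, t})"
    if "arc c" "{pathstart c, pathfinish c} = {s, t}" for c
    using nonempty_simple_path_endless[of c] connected_simple_path_endless[of c] that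
    by (simp_all add: arc_imp_simple_path)
  have e: "path_image u - {s, t} \<union> {s, t} = path_image u" "path_image d - {s, t} \<union> {s, t} = path_image d"
    using ud(7) by auto
  show ?thesis
  proof (rule that[of "path_image u - {s, t}" "path_image d - {s, t}"])
    show "path_image u - {s, t} \<union> (path_image d - {s, t}) = S1 - {s, t}" using ud(8) by blast
    show "(path_image u - {s, t}) \<inter> (path_image d - {s, t}) = {}" using ud(7) by blast
    show "connected (path_image u - {s, t})" "path_image u - {s, t} \<noteq> {}"
      using ne[of u] ud by auto
    show "connected (path_image d - {s, t})" "path_image d - {s, t} \<noteq> {}"
      using ne[of d] ud(2,5,6) by (simp_all add: insert_commute)
    show "closed (path_image u - {s, t} \<union> {s, t})" "closed (path_image d - {s, t} \<union> {s, t})"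
      unfolding e using ud(1,2) by (simp_all add: closed_arc_image)
    show "\<forall>C. connected C \<and> C \<subseteq> path_image u - {s, t} \<union> {s, t} \<and> s \<in> C \<and> t \<in> C \<longrightarrow>
        C = path_image u - {s, t} \<union> {s, t}"
      unfolding e using whole[OF ud(1)] ud(3,4) by auto
    show "\<forall>C. connected C \<and> C \<subseteq> path_image d - {s, t} \<union> {s, t} \<and> s \<in> C \<and> t \<in> C \<longrightarrow>
        C = path_image d - {s, t} \<union> {s, t}"
      unfolding e using whole[OF ud(2)] ud(5,6) by auto
  qed
qed

lemma connected_one_side:
  assumes X: "connected X" "X \<subseteq> U \<union> V" "X \<inter> P = {}" and "U \<inter> V = {}" "closed (U \<union> P)" "closed (V \<union> P)"
  shows "X \<subseteq> U \<or> X \<subseteq> V"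
proof -
  have "(U \<union> P) \<inter> (V \<union> P) \<inter> X = {}" using X(3) assms(4) by blast
  moreover have "X \<subseteq> (U \<union> P) \<union> (V \<union> P)" using X(2) by blast
  ultimately have "(U \<union> P) \<inter> X = {} \<or> (V \<union> P) \<inter> X = {}"
    using connected_closedD[OF X(1)] assms(5,6) by blast
  then show ?thesis using X(2) by blast
qed

text \<open>This makes the two loops of a crossing well defined, although \<open>has_loop\<close>
  only asks for some partition into connected sets.\<close>

lemma circle_partition_unique:
  assumes "s \<in> S1" "t \<in> S1" "s \<noteq> t"
    and AB: "connected A" "connected B" "A \<union> B = S1 - {s, t}" "A \<inter> B = {}"
    and CD: "connected C" "connected D" "C \<union> D = S1 - {s, t}" "C \<inter> D = {}"
  shows "C = A \<and> D = B \<or> C = B \<and> D = A"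
proof -
  obtain U V where UV: "U \<union> V = S1 - {s, t}" "U \<inter> V = {}" "U \<noteq> {}" "V \<noteq> {}"
    "closed (U \<union> {s, t})" "closed (V \<union> {s, t})"
    using circle_minus_two_points[OF assms(1-3)] by metis
  have side: "X \<subseteq> U \<or> X \<subseteq> V" if "connected X" "X \<subseteq> S1 - {s, t}" for X
    by (rule connected_one_side[OF that(1) _ _ UV(2,5,6)]) (use that(2) UV(1) in auto)
  have *: "X = U \<and> Y = V \<or> X = V \<and> Y = U"
    if XY: "connected X" "connected Y" "X \<union> Y = S1 - {s, t}" "X \<inter> Y = {}" for X Y
  proof -
    have sub: "X \<subseteq> S1 - {s, t}" "Y \<subseteq> S1 - {s, t}" using XY(3) by auto
    have un: "X \<union> Y = U \<union> V" using XY(3) UV(1) by simp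
    have "\<not> (X \<subseteq> U \<and> Y \<subseteq> U)" using un UV(2,4) by blast
    moreover have "\<not> (X \<subseteq> V \<and> Y \<subseteq> V)" using un UV(2,3) by blast
    ultimately consider "X \<subseteq> U" "Y \<subseteq> V" | "X \<subseteq> V" "Y \<subseteq> U"
      using side[OF XY(1) sub(1)] side[OF XY(2) sub(2)] by auto
    then show ?thesis
    proof cases
      case 1
      then show ?thesis using un UV(2) by blast
    next
      case 2
      then show ?thesis using un UV(2) by blast
    qed
  qed
  show ?thesis using *[OF AB] *[OF CD] by blast
qed

text \<open>Connectedness of the complement is the point. The open arc lies in one of the two sides
  of its ends; together with the ends it fills that side by irreducibility, so the complement is the
  other side.\<close>

lemma circle_minus_arc:
  fixes \<alpha> :: "real \<Rightarrow> complex"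
  assumes \<alpha>: "continuous_on {u..v} \<alpha>" "inj_on \<alpha> {u..v}" "\<alpha> ` {u..v} \<subseteq> S1" and uv: "u < v"
  shows "connected (\<alpha> ` {u<..<v})" "connected (S1 - \<alpha> ` {u..v})"
    "\<alpha> ` {u<..<v} \<union> (S1 - \<alpha> ` {u..v}) = S1 - {\<alpha> u, \<alpha> v}" "\<alpha> ` {u<..<v} \<inter> (S1 - \<alpha> ` {u..v}) = {}"
proof -
  have split: "{u..v} = insert u (insert v {u<..<v})" using uv by auto
  have img: "\<alpha> ` {u..v} = \<alpha> ` {u<..<v} \<union> {\<alpha> u, \<alpha> v}" unfolding split by auto
  have nin: "\<alpha> u \<notin> \<alpha> ` {u<..<v}" "\<alpha> v \<notin> \<alpha> ` {u<..<v}"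
    using inj_onD[OF \<alpha>(2)] uv by fastforce+
  have st: "\<alpha> u \<in> S1" "\<alpha> v \<in> S1" "\<alpha> u \<noteq> \<alpha> v"
    using \<alpha>(3) uv inj_onD[OF \<alpha>(2), of u v] by (auto simp: img)
  show c: "connected (\<alpha> ` {u<..<v})"
    by (rule connected_continuous_image[OF continuous_on_subset[OF \<alpha>(1)]]) auto
  have c': "connected (\<alpha> ` {u..v})" by (rule connected_continuous_image[OF \<alpha>(1)]) simp
  show un: "\<alpha> ` {u<..<v} \<union> (S1 - \<alpha> ` {u..v}) = S1 - {\<alpha> u, \<alpha> v}"
    using \<alpha>(3) nin unfolding img by blast
  show "\<alpha> ` {u<..<v} \<inter> (S1 - \<alpha> ` {u..v}) = {}" unfolding img by blast
  obtain U V where UV: "U \<union> V = S1 - {\<alpha> u, \<alpha> v}" "U \<inter> V = {}" "connected U" "connected V"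
    "U \<noteq> {}" "V \<noteq> {}" "closed (U \<union> {\<alpha> u, \<alpha> v})" "closed (V \<union> {\<alpha> u, \<alpha> v})"
    "\<forall>C. connected C \<and> C \<subseteq> U \<union> {\<alpha> u, \<alpha> v} \<and> \<alpha> u \<in> C \<and> \<alpha> v \<in> C \<longrightarrow> C = U \<union> {\<alpha> u, \<alpha> v}"
    "\<forall>C. connected C \<and> C \<subseteq> V \<union> {\<alpha> u, \<alpha> v} \<and> \<alpha> u \<in> C \<and> \<alpha> v \<in> C \<longrightarrow> C = V \<union> {\<alpha> u, \<alpha> v}"
    by (rule circle_minus_two_points[OF st]) (rule that; assumption)
  let ?X = "\<alpha> ` {u<..<v}"
  have "?X \<subseteq> U \<or> ?X \<subseteq> V"
    by (rule connected_one_side[OF c _ _ UV(2,7,8)]) (use un UV(1) nin in auto)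
  moreover have cancel: "A = B" if "A \<union> P = B \<union> P" "A \<inter> P = {}" "B \<inter> P = {}" for A B P :: "complex set"
    using that by blast
  have dX: "?X \<inter> {\<alpha> u, \<alpha> v} = {}" using nin by simp
  have dUV: "U \<inter> {\<alpha> u, \<alpha> v} = {}" "V \<inter> {\<alpha> u, \<alpha> v} = {}" using UV(1) by blast+
  ultimately have "?X = U \<or> ?X = V"
  proof (elim disjE)
    assume "?X \<subseteq> U"
    then have "\<alpha> ` {u..v} = U \<union> {\<alpha> u, \<alpha> v}" by (intro UV(9)[rule_format] conjI c') (auto simp: img)
    then show ?thesis using cancel[OF _ dX dUV(1)] unfolding img by simp
  next
    assume "?X \<subseteq> V"
    then have "\<alpha> ` {u..v} = V \<union> {\<alpha> u, \<alpha> v}" by (intro UV(10)[rule_format] conjI c') (auto simp: img)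
    then show ?thesis using cancel[OF _ dX dUV(2)] unfolding img by simp
  qed
  moreover have "S1 - \<alpha> ` {u..v} = (S1 - {\<alpha> u, \<alpha> v}) - ?X" unfolding img by blast
  ultimately have "S1 - \<alpha> ` {u..v} = V \<or> S1 - \<alpha> ` {u..v} = U" using UV(1,2) by auto
  then show "connected (S1 - \<alpha> ` {u..v})" using UV(3,4) by auto
qed

text \<open>Loop lengths at most 6 distinguish nests of different depths, once there are two nests of
  depth at least 4 to make the complementary loops longer than that.\<close>

locale nested_diagram =
  fixes F :: "'a::t2_space set" and D0 D :: "'a diagram" and \<beta>0 \<alpha> d
  assumes D0: "is_diagram F D0" and flat0: "flat_disc F D0 \<beta>0 \<alpha>" and D: "is_diagram F D"
    and nested: "nested D0 \<alpha> d D" and deep: "4 \<le> d 4" "4 \<le> d 5"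
begin

sublocale base: flat F D0 \<beta>0 \<alpha>
  using flat0 D0 by (rule flat_disc_is_flat)

abbreviation X0 :: "complex set" where "X0 \<equiv> double_params (curve D0)"
abbreviation X :: "complex set" where "X \<equiv> double_params (curve D)"

definition feet :: "(nat \<times> nat \<times> bool) set" where
  "feet = {(j, i, b). j < 6 \<and> i < d j}"

definition foot_point :: "nat \<times> nat \<times> bool \<Rightarrow> complex" where
  "foot_point = (\<lambda>(j, i, b). \<alpha> (foot j i b))"

lemma finite_X: "finite X"
  using D by (simp add: is_diagram_def)

lemma foot_S1: "j < 6 \<Longrightarrow> \<alpha> (foot j i b) \<in> S1"
  by (intro base.\<alpha>_S1 foot_in)

lemma \<alpha>_foot_eq_iff:
  "j < 6 \<Longrightarrow> j' < 6 \<Longrightarrow> \<alpha> (foot j i b) = \<alpha> (foot j' i' b') \<longleftrightarrow> j = j' \<and> i = i' \<and> b = b'"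
  using inj_on_eq_iff[OF base.\<alpha>(2) foot_in foot_in] by (simp add: foot_eq_iff)

lemma inj_foot_point: "inj_on foot_point feet"
  by (rule inj_onI) (auto simp: feet_def foot_point_def \<alpha>_foot_eq_iff)

lemma curve_eq_iff:
  "s \<in> S1 \<Longrightarrow> t \<in> S1 \<Longrightarrow> s \<noteq> t \<Longrightarrow> curve D s = curve D t \<longleftrightarrow> curve D0 s = curve D0 t \<or>
     (\<exists>j<6. \<exists>i<d j. {s, t} = {\<alpha> (foot j i True), \<alpha> (foot j i False)})"
  using nested unfolding nested_def by blast

lemma X0_outside: "X0 \<inter> \<alpha> ` {-1..1} = {}"
  using base.\<alpha>_not_double by blast

lemma partner:
  assumes "j < 6" "i < d j" "t \<in> S1" "t \<noteq> \<alpha> (foot j i b)"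
  shows "curve D t = curve D (\<alpha> (foot j i b)) \<longleftrightarrow> t = \<alpha> (foot j i (\<not> b))"
proof -
  let ?s = "\<alpha> (foot j i b)"
  have s: "?s \<in> S1" using foot_S1 assms(1) by blast
  have "curve D0 ?s \<noteq> curve D0 t"
    using base.old_crossing_outside[OF s assms(3)] assms(4) imageI[OF foot_in[OF assms(1)], of \<alpha> i b] by blast
  then have "curve D ?s = curve D t \<longleftrightarrow> (\<exists>j'<6. \<exists>i'<d j'. {?s, t} = {\<alpha> (foot j' i' True), \<alpha> (foot j' i' False)})"
    using curve_eq_iff[OF s assms(3)] assms(4) by blast
  also have "\<dots> \<longleftrightarrow> t = \<alpha> (foot j i (\<not> b))"
  proof
    assume "\<exists>j'<6. \<exists>i'<d j'. {?s, t} = {\<alpha> (foot j' i' True), \<alpha> (foot j' i' False)}"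
    then obtain j' i' where "j' < 6" "{?s, t} = {\<alpha> (foot j' i' True), \<alpha> (foot j' i' False)}" by blast
    then show "t = \<alpha> (foot j i (\<not> b))"
      using assms(1) by (auto simp: doubleton_eq_iff \<alpha>_foot_eq_iff)
  next
    assume "t = \<alpha> (foot j i (\<not> b))"
    then have "{?s, t} = {\<alpha> (foot j i True), \<alpha> (foot j i False)}" by (cases b) auto
    then show "\<exists>j'<6. \<exists>i'<d j'. {?s, t} = {\<alpha> (foot j' i' True), \<alpha> (foot j' i' False)}"
      using assms(1,2) by blast
  qed
  finally show ?thesis by (simp only: eq_commute)
qed

lemma X_eq: "X = X0 \<union> foot_point ` feet"
proof (intro equalityI subsetI)
  fix s assume "s \<in> X"
  then obtain t where st: "s \<in> S1" "t \<in> S1" "t \<noteq> s" "curve D s = curve D t"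
    unfolding double_params_def by auto
  then consider "curve D0 s = curve D0 t" |
    j i where "j < 6" "i < d j" "{s, t} = {\<alpha> (foot j i True), \<alpha> (foot j i False)}"
    using curve_eq_iff[of s t] by auto
  then show "s \<in> X0 \<union> foot_point ` feet"
  proof cases
    case 1
    then show ?thesis using st unfolding double_params_def by auto
  next
    case 2
    then obtain b where "s = foot_point (j, i, b)"
      unfolding foot_point_def by (auto simp: doubleton_eq_iff)
    moreover have "(j, i, b) \<in> feet" using 2 by (simp add: feet_def)
    ultimately show ?thesis by blast
  qed
next
  fix s assume "s \<in> X0 \<union> foot_point ` feet"
  then show "s \<in> X"
  proof
    assume "s \<in> X0"
    then obtain t where "s \<in> S1" "t \<in> S1" "t \<noteq> s" "curve D0 t = curve D0 s"
      unfolding double_params_def by blast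
    then have "curve D t = curve D s" using curve_eq_iff[of t s] by simp
    then show ?thesis using \<open>s \<in> S1\<close> \<open>t \<in> S1\<close> \<open>t \<noteq> s\<close> unfolding double_params_def by blast
  next
    assume "s \<in> foot_point ` feet"
    then obtain j i b where s: "s = \<alpha> (foot j i b)" "j < 6" "i < d j"
      by (auto simp: feet_def foot_point_def)
    let ?t = "\<alpha> (foot j i (\<not> b))"
    have t: "?t \<in> S1" "?t \<noteq> s" "s \<in> S1"
      using foot_S1 s by (auto simp: \<alpha>_foot_eq_iff)
    then have "curve D ?t = curve D s" using partner[OF s(2,3) t(1)] s(1) by blast
    then show ?thesis using t unfolding double_params_def by blast
  qed
qed

text \<open>Four curls with two feet each, which is more than the lengths up to 6 that are
  compared.\<close>

lemma many_feet:
  assumes "\<And>i b. \<alpha> (foot j i b) \<in> A" "j = 4 \<or> j = 5"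
  shows "8 \<le> card (A \<inter> X)"
proof -
  let ?S = "{j} \<times> {..<4 :: nat} \<times> (UNIV :: bool set)"
  have sub: "?S \<subseteq> feet" using assms(2) deep by (auto simp: feet_def)
  have "8 = card (foot_point ` ?S)"
    using card_image[OF inj_on_subset[OF inj_foot_point sub]] by (simp add: card_cartesian_product)
  also have "\<dots> \<le> card (A \<inter> X)"
  proof (rule card_mono)
    show "foot_point ` ?S \<subseteq> A \<inter> X"
    proof (rule image_subsetI)
      fix p assume p: "p \<in> ?S"
      then have "foot_point p \<in> A" using assms(1) by (auto simp: foot_point_def)
      moreover have "foot_point p \<in> foot_point ` feet" using subsetD[OF sub p] by (rule imageI)
      ultimately show "foot_point p \<in> A \<inter> X" unfolding X_eq by blast
    qed
  qed (use finite_X in simp)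
  finally show ?thesis .
qed

text \<open>The inner loop meets only the feet of the \<open>d j - 1 - i\<close> deeper curls of the
  same nest, two for each. The outer loop contains a whole deep nest, so it is too long to have
  length \<open>k\<close>.\<close>

lemma loop_foot:
  assumes j: "j < 6" and i: "i < d j" and k: "k \<le> 6" and s: "{s, t} = {\<alpha> (foot j i True), \<alpha> (foot j i False)}"
  shows "has_loop X k s t \<longleftrightarrow> k = 2 * (d j - 1 - i)"
proof -
  let ?u = "foot j i False" and ?v = "foot j i True"
  have uv: "?u < ?v" using radius_pos[of i] by (simp add: foot_def)
  have sub: "{?u..?v} \<subseteq> {-1..1}" using foot_in[OF j, of i False] foot_in[OF j, of i True] by auto
  let ?I = "\<alpha> ` {?u<..<?v}" and ?O = "S1 - \<alpha> ` {?u..?v}"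
  have IO: "connected ?I" "connected ?O" "?I \<union> ?O = S1 - {\<alpha> ?u, \<alpha> ?v}" "?I \<inter> ?O = {}"
    using circle_minus_arc[of ?u ?v \<alpha>] uv continuous_on_subset[OF base.\<alpha>(1) sub] inj_on_subset[OF base.\<alpha>(2) sub]
      image_mono[OF sub, of \<alpha>] base.\<alpha>(3) by (meson subset_trans)+
  have st: "S1 - {s, t} = S1 - {\<alpha> ?u, \<alpha> ?v}" using s by auto
  have in_iff: "\<alpha> (foot j' i' b) \<in> ?I \<longleftrightarrow> j' = j \<and> i < i'" if "j' < 6" for j' i' b
  proof -
    have "\<alpha> (foot j' i' b) \<in> ?I \<longleftrightarrow> foot j' i' b \<in> {?u<..<?v}"
      using inj_on_image_mem_iff[OF base.\<alpha>(2) foot_in[OF that]] sub by (meson greaterThanLessThan_subseteq_atLeastAtMost_iff order_refl subset_trans)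
    also have "\<dots> \<longleftrightarrow> \<bar>foot j' i' b - centre j\<bar> < radius i"
      by (auto simp: foot_def[of j] abs_less_iff)
    finally show ?thesis by (simp add: foot_between_iff)
  qed
  have "?I \<inter> X = foot_point ` ({j} \<times> {i<..<d j} \<times> UNIV)"
  proof -
    have "?I \<subseteq> \<alpha> ` {-1..1}" using sub by (intro image_mono) auto
    then have "?I \<inter> X = foot_point ` feet \<inter> ?I" using X0_outside unfolding X_eq by blast
    also have "\<dots> = foot_point ` ({j} \<times> {i<..<d j} \<times> UNIV)"
    proof (intro equalityI subsetI)
      fix x assume "x \<in> foot_point ` feet \<inter> ?I"
      then obtain j' i' b where x: "x = foot_point (j', i', b)" "j' < 6" "i' < d j'" "\<alpha> (foot j' i' b) \<in> ?I"
        by (auto simp: feet_def foot_point_def)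
      then have "(j', i', b) \<in> {j} \<times> {i<..<d j} \<times> UNIV" using in_iff[of j' i' b] by auto
      then show "x \<in> foot_point ` ({j} \<times> {i<..<d j} \<times> UNIV)" using x(1) by blast
    next
      fix x assume "x \<in> foot_point ` ({j} \<times> {i<..<d j} \<times> UNIV)"
      then obtain i' b where x: "x = foot_point (j, i', b)" "i < i'" "i' < d j" by auto
      then have "(j, i', b) \<in> feet" using j by (simp add: feet_def)
      moreover have "x \<in> ?I" using in_iff[OF j, of i' b] x by (simp add: foot_point_def)
      ultimately show "x \<in> foot_point ` feet \<inter> ?I" using x(1) by blast
    qed
    finally show ?thesis .
  qed
  moreover have "{j} \<times> {i<..<d j} \<times> (UNIV :: bool set) \<subseteq> feet" using j by (auto simp: feet_def)
  ultimately have cI: "card (?I \<inter> X) = 2 * (d j - 1 - i)"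
    using card_image[OF inj_on_subset[OF inj_foot_point]] by (simp add: card_cartesian_product)
  \<comment> \<open>The curl may itself belong to one of the deep nests; then the other one lies on
    the outer loop.\<close>
  obtain j' :: nat where j': "j' = 4 \<or> j' = 5" "j' \<noteq> j"
    using that[of 4] that[of 5] by (cases "j = 4") auto
  have "\<alpha> (foot j' i' b) \<in> ?O" for i' b
  proof -
    have l: "j' < 6" using j'(1) by auto
    have "foot j' i' b \<notin> {?u..?v}"
    proof
      assume "foot j' i' b \<in> {?u..?v}"
      then have "foot j' i' b \<in> {?u<..<?v} \<or> foot j' i' b = ?u \<or> foot j' i' b = ?v" by auto
      then show False
        using in_iff[OF l, of i' b] j'(2) imageI[of "foot j' i' b" "{?u<..<?v}" \<alpha>] by (auto simp: foot_eq_iff)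
    qed
    then show ?thesis
      using inj_on_image_mem_iff[OF base.\<alpha>(2) foot_in[OF l] sub] foot_S1[OF l] by blast
  qed
  then have cO: "8 \<le> card (?O \<inter> X)" using many_feet j'(1) by blast
  have "\<alpha> ?u \<in> S1" "\<alpha> ?v \<in> S1" "\<alpha> ?u \<noteq> \<alpha> ?v" using foot_S1 j by (auto simp: \<alpha>_foot_eq_iff)
  note uniq = circle_partition_unique[OF this IO]
  show ?thesis
  proof
    assume "has_loop X k s t"
    then obtain A B where AB: "connected A" "connected B" "A \<union> B = S1 - {\<alpha> ?u, \<alpha> ?v}" "A \<inter> B = {}" "card (A \<inter> X) = k"
      unfolding has_loop_def st by blast
    then have "A = ?I \<or> A = ?O" using uniq[OF AB(1-4)] by blast
    then show "k = 2 * (d j - 1 - i)" using AB(5) cI cO k by auto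
  next
    assume "k = 2 * (d j - 1 - i)"
    then show "has_loop X k s t" unfolding has_loop_def st using IO cI by blast
  qed
qed

text \<open>Refers only to \<open>D0\<close> and the strand, not to the depths, so its contribution
  is common to all diagrams of the cube.\<close>

definition old_loops :: "nat \<Rightarrow> complex set" where
  "old_loops k = {s \<in> S1. \<exists>t\<in>S1. t \<noteq> s \<and> curve D0 t = curve D0 s \<and> (\<exists>A B. connected A \<and> connected B \<and>
     A \<union> B = S1 - {s, t} \<and> A \<inter> B = {} \<and> A \<inter> \<alpha> ` {-1..1} = {} \<and> card (A \<inter> X0) = k)}"

text \<open>The strand lies entirely on one loop of an old crossing, and that loop is too long
  because of the deep nests. The other loop contains no feet, so its length can be read off from
  \<open>D0\<close>.\<close>

lemma loop_old:
  assumes st: "s \<in> S1" "t \<in> S1" "t \<noteq> s" "curve D0 t = curve D0 s" and k: "k \<le> 6"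
  shows "has_loop X k s t \<longleftrightarrow> (\<exists>A B. connected A \<and> connected B \<and>
     A \<union> B = S1 - {s, t} \<and> A \<inter> B = {} \<and> A \<inter> \<alpha> ` {-1..1} = {} \<and> card (A \<inter> X0) = k)"
proof -
  have out: "s \<notin> \<alpha> ` {-1..1}" "t \<notin> \<alpha> ` {-1..1}"
    using base.old_crossing_outside st by metis+
  have "foot_point ` feet \<subseteq> \<alpha> ` {-1..1}"
    using foot_in by (auto simp: feet_def foot_point_def simp del: atLeastAtMost_iff)
  then have AX: "A \<inter> X = A \<inter> X0" if "A \<inter> \<alpha> ` {-1..1} = {}" for A
    unfolding X_eq using that by blast
  have "A \<inter> \<alpha> ` {-1..1} = {}"
    if AB: "connected A" "connected B" "A \<union> B = S1 - {s, t}" "A \<inter> B = {}" "card (A \<inter> X) = k" for A B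
  proof (rule ccontr)
    assume n: "A \<inter> \<alpha> ` {-1..1} \<noteq> {}"
    obtain U V where UV: "U \<union> V = S1 - {s, t}" "U \<inter> V = {}" "connected U" "connected V"
      "closed (U \<union> {s, t})" "closed (V \<union> {s, t})"
      using circle_minus_two_points[OF st(1,2) st(3)[symmetric]] by metis
    have "connected (\<alpha> ` {-1..1})" by (rule connected_continuous_image[OF base.\<alpha>(1)]) simp
    then have "\<alpha> ` {-1..1} \<subseteq> U \<or> \<alpha> ` {-1..1} \<subseteq> V"
      by (rule connected_one_side[OF _ _ _ UV(2,5,6)]) (use out base.\<alpha>(3) UV(1) in blast)+
    then have "\<alpha> ` {-1..1} \<subseteq> A \<or> \<alpha> ` {-1..1} \<subseteq> B"
      using circle_partition_unique[OF st(1,2) st(3)[symmetric] UV(3,4,1,2) AB(1-4)] by auto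
    then have "\<alpha> ` {-1..1} \<subseteq> A" using n AB(4) by blast
    then have "\<alpha> (foot 4 i b) \<in> A" for i b
      using foot_in[of 4 i b] by (auto simp del: atLeastAtMost_iff)
    then have "8 \<le> card (A \<inter> X)" by (rule many_feet) simp
    then show False using AB(5) k by simp
  qed
  then show ?thesis unfolding has_loop_def using AX by metis
qed

lemma loop_params_eq:
  assumes k: "2 * k \<le> 6"
  shows "loop_params D (2 * k) = old_loops (2 * k) \<union> foot_point ` {(j, i, b). j < 6 \<and> i + k + 1 = d j}"
proof (intro equalityI subsetI)
  fix s assume "s \<in> loop_params D (2 * k)"
  then obtain t where st: "s \<in> S1" "t \<in> S1" "t \<noteq> s" "curve D t = curve D s" and l: "has_loop X (2 * k) s t"
    unfolding loop_params_def by blast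
  consider "curve D0 t = curve D0 s" |
    j i where "j < 6" "i < d j" "{t, s} = {\<alpha> (foot j i True), \<alpha> (foot j i False)}"
    using curve_eq_iff[OF st(2,1,3)] st(4) by auto
  then show "s \<in> old_loops (2 * k) \<union> foot_point ` {(j, i, b). j < 6 \<and> i + k + 1 = d j}"
  proof cases
    case 1
    then show ?thesis
      using l loop_old[OF st(1-3) 1 k] st unfolding old_loops_def by blast
  next
    case 2
    then have "2 * k = 2 * (d j - 1 - i)"
      using loop_foot[OF 2(1,2) k, of s t] l by (simp add: insert_commute)
    then have ik: "i + k + 1 = d j" using 2(2) by simp
    obtain b where "s = foot_point (j, i, b)"
      using 2(3) unfolding foot_point_def by (auto simp: doubleton_eq_iff)
    then show ?thesis using ik 2(1) by blast
  qed
next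
  fix s assume "s \<in> old_loops (2 * k) \<union> foot_point ` {(j, i, b). j < 6 \<and> i + k + 1 = d j}"
  then show "s \<in> loop_params D (2 * k)"
  proof
    assume "s \<in> old_loops (2 * k)"
    then obtain t where st: "s \<in> S1" "t \<in> S1" "t \<noteq> s" "curve D0 t = curve D0 s" and
      "\<exists>A B. connected A \<and> connected B \<and> A \<union> B = S1 - {s, t} \<and> A \<inter> B = {} \<and>
        A \<inter> \<alpha> ` {-1..1} = {} \<and> card (A \<inter> X0) = 2 * k"
      unfolding old_loops_def by blast
    then have l: "has_loop X (2 * k) s t" using loop_old[OF st k] by blast
    have "curve D t = curve D s" using curve_eq_iff[OF st(2,1,3)] st(4) by simp
    then show ?thesis using st l unfolding loop_params_def by blast
  next
    assume "s \<in> foot_point ` {(j, i, b). j < 6 \<and> i + k + 1 = d j}"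
    then obtain j i b where s: "s = \<alpha> (foot j i b)" "j < 6" "i + k + 1 = d j"
      by (auto simp: foot_point_def)
    let ?t = "\<alpha> (foot j i (\<not> b))"
    have t: "?t \<in> S1" "?t \<noteq> s" "s \<in> S1"
      using foot_S1 s by (auto simp: \<alpha>_foot_eq_iff)
    then have "curve D ?t = curve D s" using partner[OF s(2) _ t(1)] s(1,3) by simp
    moreover have "{s, ?t} = {\<alpha> (foot j i True), \<alpha> (foot j i False)}" using s(1) by (cases b) auto
    then have "has_loop X (2 * k) s ?t" using loop_foot[OF s(2) _ k, of i s ?t] s(3) by simp
    ultimately show ?thesis using t unfolding loop_params_def by blast
  qed
qed

text \<open>In every nest deeper than \<open>k\<close>, exactly one curl, the one with
  \<open>i = d j - k - 1\<close>, has \<open>k\<close> further curls inside it; it contributes its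
  two feet.\<close>

lemma card_loop_params:
  assumes k: "2 * k \<le> 6"
  shows "card (loop_params D (2 * k)) = card (old_loops (2 * k)) + 2 * card {j. j < 6 \<and> k < d j}"
proof -
  let ?N = "{(j, i, b). j < 6 \<and> i + k + 1 = d j} :: (nat \<times> nat \<times> bool) set"
  have N: "?N = (\<lambda>(j, b). (j, d j - k - 1, b)) ` ({j. j < 6 \<and> k < d j} \<times> UNIV)"
    by (force simp: image_iff)
  have "inj_on (\<lambda>(j, b). (j, d j - k - 1, b)) ({j. j < 6 \<and> k < d j} \<times> (UNIV :: bool set))"
    by (auto simp: inj_on_def)
  then have cN: "card ?N = 2 * card {j. j < 6 \<and> k < d j}"
    unfolding N by (subst card_image) (simp_all add: card_cartesian_product)
  have sub: "?N \<subseteq> feet" by (auto simp: feet_def)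
  have "finite (loop_params D (2 * k))"
    by (rule finite_subset[OF loop_params_subset finite_X])
  then have fin: "finite (old_loops (2 * k))" "finite (foot_point ` ?N)"
    unfolding loop_params_eq[OF k] by auto
  have "old_loops (2 * k) \<subseteq> X0" unfolding old_loops_def double_params_def by blast
  moreover have "foot_point ` ?N \<subseteq> \<alpha> ` {-1..1}"
    using foot_in by (auto simp: foot_point_def simp del: atLeastAtMost_iff)
  ultimately have "old_loops (2 * k) \<inter> foot_point ` ?N = {}" using X0_outside by blast
  then show ?thesis
    unfolding loop_params_eq[OF k] using card_Un_disjoint[OF fin]
    by (simp only: card_image[OF inj_on_subset[OF inj_foot_point sub]] cN)
qed

end


section \<open>Reidemeister graphs contain the 4-cube\<close>

context nests
begin

text \<open>The order of the insertions is immaterial, as they commute.\<close>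

definition raised :: "(nat \<Rightarrow> complex \<Rightarrow> 'a) \<Rightarrow> 'a diagram \<Rightarrow> nat set \<Rightarrow> 'a diagram" where
  "raised \<beta> D S = Finite_Set.fold (\<lambda>j. curl (\<beta> j) (nest_disc \<alpha> j (depths j))) D S"

definition raised_depths :: "nat set \<Rightarrow> nat \<Rightarrow> nat" where
  "raised_depths S j = (if j \<in> S then Suc (depths j) else depths j)"

context
  fixes \<beta> D
  assumes T: "nest_tower F L K z D0 \<alpha> depths \<beta> D"
begin

lemma nest_discs_disjoint:
  assumes "i < 6" "j < 6" "i \<noteq> j"
  shows "nest_disc \<alpha> i (depths i) ` {-1..1} \<inter> nest_disc \<alpha> j (depths j) ` {-1..1} = {}"
proof -
  have f: "flat_disc F D (\<beta> i) (nest_disc \<alpha> i (depths i))" "flat_disc F D (\<beta> j) (nest_disc \<alpha> j (depths j))"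
    and disj: "\<beta> i ` cball 0 1 \<inter> \<beta> j ` cball 0 1 = {}" and D: "is_diagram F D"
    using T assms unfolding nest_tower_def height_diagram_def by blast+
  interpret i: flat F D "\<beta> i" "nest_disc \<alpha> i (depths i)" using f(1) D by (rule flat_disc_is_flat)
  interpret j: flat F D "\<beta> j" "nest_disc \<alpha> j (depths j)" using f(2) D by (rule flat_disc_is_flat)
  show ?thesis
  proof (rule equals0I)
    fix s assume s: "s \<in> nest_disc \<alpha> i (depths i) ` {-1..1} \<inter> nest_disc \<alpha> j (depths j) ` {-1..1}"
    then have "s \<in> S1" using i.\<alpha>(3) by blast
    then show False using i.curve_in_iff j.curve_in_iff s disj by blast
  qed
qed

lemma raised_insert:
  assumes "insert j S \<subseteq> {..<6}" "j \<notin> S"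
  shows "raised \<beta> D (insert j S) = curl (\<beta> j) (nest_disc \<alpha> j (depths j)) (raised \<beta> D S)"
proof -
  interpret comp_fun_commute_on "{..<6}" "\<lambda>j. curl (\<beta> j) (nest_disc \<alpha> j (depths j))"
  proof
    fix i j :: nat assume "i \<in> {..<6}" "j \<in> {..<6}"
    then show "curl (\<beta> j) (nest_disc \<alpha> j (depths j)) \<circ> curl (\<beta> i) (nest_disc \<alpha> i (depths i)) =
        curl (\<beta> i) (nest_disc \<alpha> i (depths i)) \<circ> curl (\<beta> j) (nest_disc \<alpha> j (depths j))"
      using curl_commute[OF nest_discs_disjoint[of j i]] by (cases "i = j") (auto simp: fun_eq_iff)
  qed
  show ?thesis
    unfolding raised_def using assms by (intro fold_insert) (auto intro: finite_subset)
qed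

lemma raised_empty: "raised \<beta> D {} = D"
  by (simp add: raised_def)

lemma raised_invariant:
  assumes "finite S" "S \<subseteq> {..<6}"
  shows "height_diagram F L K z (raised \<beta> D S) \<and> nested D0 \<alpha> (raised_depths S) (raised \<beta> D S) \<and>
    (\<forall>j\<in>{..<6} - S. flat_disc F (raised \<beta> D S) (\<beta> j) (nest_disc \<alpha> j (depths j)))"
  using assms
proof (induction S rule: finite_induct)
  case empty
  then show ?case using T unfolding nest_tower_def raised_empty by (simp add: raised_depths_def[abs_def])
next
  case (insert j S)
  let ?E = "raised \<beta> D S"
  have IH: "height_diagram F L K z ?E" "nested D0 \<alpha> (raised_depths S) ?E"
    "\<And>j. j < 6 \<Longrightarrow> j \<notin> S \<Longrightarrow> flat_disc F ?E (\<beta> j) (nest_disc \<alpha> j (depths j))"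
    using insert by auto
  have j: "j < 6" using insert.prems by simp
  have E: "is_diagram F ?E" using IH(1) by (simp add: height_diagram_def)
  interpret flat F ?E "\<beta> j" "nest_disc \<alpha> j (depths j)"
    using IH(3)[OF j insert.hyps(2)] E by (rule flat_disc_is_flat)
  have dj: "depths j = raised_depths S j" using insert.hyps(2) by (simp add: raised_depths_def)
  have "raised_depths (insert j S) = (raised_depths S)(j := Suc (raised_depths S j))"
    using insert.hyps(2) by (auto simp: raised_depths_def fun_eq_iff)
  then have "nested D0 \<alpha> (raised_depths (insert j S)) D'"
    using nested_curl[OF IH(2) _ E j] flat unfolding dj by simp
  moreover have "height_diagram F L K z D'"
    by (rule height_diagram_curl[OF lift K IH(1) mono_nest_disc[OF j]])
  moreover have "flat_disc F D' (\<beta> i) (nest_disc \<alpha> i (depths i))" if "i < 6" "i \<notin> insert j S" for i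
  proof (rule flat_other[OF IH(3)])
    show "\<beta> i ` cball 0 1 \<inter> \<beta> j ` cball 0 1 = {}"
      using T that j unfolding nest_tower_def by auto
  qed (use that in auto)
  ultimately show ?case
    unfolding raised_insert[OF insert.prems insert.hyps(2)] by auto
qed

lemma raised_move:
  assumes "insert j S \<subseteq> {..<6}" "j \<notin> S"
  shows "reidemeister_move F (raised \<beta> D S, raised \<beta> D (insert j S), \<beta> j ` cball 0 1)"
proof -
  have S: "finite S" "S \<subseteq> {..<6}" "j < 6" using assms(1) finite_subset by auto
  note inv = raised_invariant[OF S(1,2)]
  interpret flat F "raised \<beta> D S" "\<beta> j" "nest_disc \<alpha> j (depths j)"
    by (rule flat_disc_is_flat) (use inv S(3) assms(2) in \<open>auto simp: height_diagram_def\<close>)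
  show ?thesis unfolding raised_insert[OF assms] by (rule reidemeister_move_curl)
qed

text \<open>Take \<open>k\<close> in just one of the two sets. The nests deeper than
  \<open>k\<close> are the \<open>5 - k\<close> later ones and, precisely if it was raised, the nest
  \<open>k\<close> itself; earlier nests have depth at most \<open>k\<close> even when raised. So
  the numbers for loops of length \<open>2 * k\<close> differ by 2.\<close>

lemma raised_not_isotopic:
  assumes S: "S \<subseteq> {..<4}" "S' \<subseteq> {..<4}" "S \<noteq> S'"
  shows "\<not> isotopic_diagrams F (raised \<beta> D S) (raised \<beta> D S')"
proof
  assume iso: "isotopic_diagrams F (raised \<beta> D S) (raised \<beta> D S')"
  have nd: "nested_diagram F D0 (raised \<beta> D S) \<beta>0 \<alpha> (raised_depths S)" if "S \<subseteq> {..<4}" for S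
  proof -
    have "S \<subseteq> {..<6}" using that by auto
    then have "height_diagram F L K z (raised \<beta> D S)" "nested D0 \<alpha> (raised_depths S) (raised \<beta> D S)"
      using raised_invariant[of S] finite_subset by auto
    then show ?thesis
      using is_diagram_D0 D0(2) that
      by unfold_locales (auto simp: height_diagram_def raised_depths_def depths_eq)
  qed
  obtain k where k: "k < 4" "k \<in> S \<longleftrightarrow> k \<notin> S'" using S by blast
  have c: "card (loop_params (raised \<beta> D S) (2 * k)) =
      card (nested_diagram.old_loops D0 \<alpha> (2 * k)) + 2 * ((5 - k) + (if k \<in> S then 1 else 0))"
    if "S \<subseteq> {..<4}" for S
  proof -
    have "{j. j < 6 \<and> k < raised_depths S j} = (if k \<in> S then insert k {k<..<6} else {k<..<6})"
      using k(1) that by (auto simp: raised_depths_def depths_eq less_Suc_eq split: if_splits)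
    then have "card {j. j < 6 \<and> k < raised_depths S j} = (5 - k) + (if k \<in> S then 1 else 0)" by simp
    then show ?thesis
      using nested_diagram.card_loop_params[OF nd[OF that], of k] k(1) by simp
  qed
  have "is_diagram F (raised \<beta> D S)" "is_diagram F (raised \<beta> D S')"
    using nd S unfolding nested_diagram_def by blast+
  from card_loop_params_isotopic[OF iso this, of "2 * k"] show False
    using c[OF S(1)] c[OF S(2)] k(2) by (auto split: if_splits)
qed

end

definition cube_vertex :: "nat \<Rightarrow> nat set" where
  "cube_vertex n = {j \<in> {..<4}. odd (n div 2 ^ j)}"

lemma cube_vertex_inj: "inj_on cube_vertex {..<16}"
proof (rule inj_onI)
  fix m n :: nat assume mn: "m \<in> {..<16}" "n \<in> {..<16}" "cube_vertex m = cube_vertex n"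
  have "odd (m div 2 ^ j) \<longleftrightarrow> odd (n div 2 ^ j)" if "j < 4" for j
    using mn(3) that unfolding cube_vertex_def by blast
  from this[of 0] this[of 1] this[of 2] this[of 3]
  have *: "odd m \<longleftrightarrow> odd n" "odd (m div 2) \<longleftrightarrow> odd (n div 2)" "odd (m div 4) \<longleftrightarrow> odd (n div 4)"
    "odd (m div 8) \<longleftrightarrow> odd (n div 8)" by simp_all
  have digits: "\<forall>k\<in>{..<16::nat}. k = of_bool (odd k) + 2 * of_bool (odd (k div 2)) +
      4 * of_bool (odd (k div 4)) + 8 * of_bool (odd (k div 8))"
    by code_simp
  show "m = n" using bspec[OF digits mn(1)] bspec[OF digits mn(2)] unfolding * by simp
qed

lemma cube_edges_vertex:
  assumes "c \<in> cube_edges"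
  obtains a b j where "c = {a, b}" "cube_vertex b = insert j (cube_vertex a)" "j \<notin> cube_vertex a" "j < 4"
proof -
  \<comment> \<open>The third component is the binary digit that is 0 in the first vertex and 1 in
    the second.\<close>
  let ?E = "{(0,1,0), (0,4,2), (1,3,1), (1,5,2), (4,5,0), (4,6,1), (2,6,2), (2,3,0), (9,11,1), (3,11,3),
    (9,13,2), (5,13,3), (8,9,0), (0,8,3)} :: (nat \<times> nat \<times> nat) set"
  have E: "cube_edges = (\<lambda>(a, b, j). {a, b}) ` ?E"
    unfolding cube_edges_def image_insert image_empty prod.case ..
  obtain p where p: "p \<in> ?E" "c = (\<lambda>(a, b, j). {a, b}) p"
    using assms unfolding E by (rule imageE)
  obtain a b j where abj: "p = (a, b, j)" by (cases p)
  note c = p(2)[unfolded abj prod.case] p(1)[unfolded abj]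
  have "\<forall>(a, b, j)\<in>?E. cube_vertex b = insert j (cube_vertex a) \<and> j \<notin> cube_vertex a \<and> j < 4"
    unfolding cube_vertex_def by code_simp
  from bspec[OF this c(2)] have "cube_vertex b = insert j (cube_vertex a) \<and> j \<notin> cube_vertex a \<and> j < 4"
    unfolding prod.case .
  then show ?thesis using that c(1) by blast
qed

theorem reidemeister_graph_not_planar: "\<not> planar (reidemeister_graph F L K)"
proof -
  obtain \<beta> D where T: "nest_tower F L K z D0 \<alpha> depths \<beta> D"
    using nest_tower_exists .
  define X where "X = {D. diagram_of F L K D}"
  define r where "r = {(D, E). D \<in> X \<and> E \<in> X \<and> isotopic_diagrams F D E}"
  define M where "M = {(D, D', B). D \<in> X \<and> D' \<in> X \<and> reidemeister_move F (D, D', B)}"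
  define q where "q = {(m, m'). m \<in> M \<and> m' \<in> M \<and> same_move F m m'}"
  let ?G = "Multigraph (X // r) (M // q) (\<lambda>e. \<Union>(D, D', B)\<in>e. {r `` {D}, r `` {D'}})"
  have G: "reidemeister_graph F L K = ?G"
    unfolding reidemeister_graph_def Let_def X_def r_def M_def q_def by simp
  have X: "is_diagram F D" if "D \<in> X" for D using that by (simp add: X_def diagram_of_def)
  have r_eq: "r `` {D} = r `` {E}" if "isotopic_diagrams F D E" "D \<in> X" "E \<in> X" for D E
  proof -
    have "isotopic_diagrams F D A \<longleftrightarrow> isotopic_diagrams F E A" for A
      using isotopic_diagrams_trans[OF that(1) _ X[OF that(2)], of A]
        isotopic_diagrams_trans[OF isotopic_diagrams_sym[OF that(1) X[OF that(2)]] _ X[OF that(3)], of A]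
      by blast
    then show ?thesis using that(2,3) by (simp add: r_def Image_def)
  qed
  have r_iso: "isotopic_diagrams F D E" if "r `` {D} = r `` {E}" "E \<in> X" for D E
  proof -
    have "E \<in> r `` {E}" using that(2) by (simp add: r_def isotopic_diagrams_refl)
    then have "E \<in> r `` {D}" using that(1) by simp
    then show ?thesis by (simp add: r_def)
  qed
  define V where "V n = raised \<beta> D (cube_vertex n)" for n
  have sub: "cube_vertex n \<subseteq> {..<4}" for n by (auto simp: cube_vertex_def)
  have VX: "V n \<in> X" for n
  proof -
    have "cube_vertex n \<subseteq> {..<6}" using sub[of n] by auto
    then have "height_diagram F L K z (V n)"
      using raised_invariant[OF T, of "cube_vertex n"] finite_subset unfolding V_def by auto
    then show ?thesis by (auto simp: X_def diagram_of_iff)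
  qed
  \<comment> \<open>An edge collects the ends of all moves in its class. Isotopic moves have
    isotopic ends, possibly exchanged, so any representative yields the same set.\<close>
  have ends: "ends ?G (q `` {(D, E, B)}) = {r `` {D}, r `` {E}}"
    if m: "(D, E, B) \<in> M" for D E B
  proof -
    have self: "(D, E, B) \<in> q `` {(D, E, B)}"
    proof -
      have "ambient_isotopy F (\<lambda>t x. x)"
        unfolding ambient_isotopy_def case_prod_beta
        by (intro conjI ballI continuous_intros) (use homeomorphism_ident[of F] in auto)
      moreover have "carries (\<lambda>x. x) A A" for A :: "'a diagram"
        unfolding carries_def by (intro exI[of _ "\<lambda>x. x"]) (auto simp: homeomorphism_ident)
      ultimately have "isotopic_moves F (D, E, B) (D, E, B)"
        unfolding isotopic_moves_def prod.case by (intro exI[of _ "\<lambda>t x. x"]) auto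
      then show ?thesis using m by (simp add: q_def same_move_def)
    qed
    have same: "{r `` {D'}, r `` {E'}} = {r `` {D}, r `` {E}}" if "(D', E', B') \<in> q `` {(D, E, B)}" for D' E' B'
    proof -
      have m': "(D', E', B') \<in> M" and "same_move F (D, E, B) (D', E', B')"
        using that by (auto simp: q_def)
      then consider "isotopic_diagrams F D D'" "isotopic_diagrams F E E'"
        | "isotopic_diagrams F D E'" "isotopic_diagrams F E D'"
        unfolding same_move_def isotopic_moves_def prod.case isotopic_diagrams_def by blast
      moreover have "D \<in> X" "E \<in> X" "D' \<in> X" "E' \<in> X" using m m' by (auto simp: M_def)
      ultimately show ?thesis
        using r_eq by cases (auto simp: insert_commute)
    qed
    have "ends ?G (q `` {(D, E, B)}) = (\<Union>(D', E', B')\<in>q `` {(D, E, B)}. {r `` {D'}, r `` {E'}})" by simp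
    also have "\<dots> = (\<Union>_\<in>q `` {(D, E, B)}. {r `` {D}, r `` {E}})"
    proof (rule SUP_cong[OF refl])
      fix m' assume m': "m' \<in> q `` {(D, E, B)}"
      obtain D' E' B' where "m' = (D', E', B')" by (cases m')
      with m' show "(case m' of (D', E', B') \<Rightarrow> {r `` {D'}, r `` {E'}}) = {r `` {D}, r `` {E}}"
        using same by (simp only: prod.case)
    qed
    also have "\<dots> = {r `` {D}, r `` {E}}" using self by blast
    finally show ?thesis .
  qed
  have "\<exists>e. e \<in> edges ?G \<and> ends ?G e = (\<lambda>n. r `` {V n}) ` c" if cc: "c \<in> cube_edges" for c
  proof -
    obtain a b j where c: "c = {a, b}" "cube_vertex b = insert j (cube_vertex a)" "j \<notin> cube_vertex a" "j < 4"
      using cube_edges_vertex[OF cc] .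
    have "insert j (cube_vertex a) \<subseteq> {..<6}" using sub[of a] c(4) by auto
    then have m: "(V a, V b, \<beta> j ` cball 0 1) \<in> M"
      using raised_move[OF T _ c(3)] VX[of a] VX[of b] unfolding M_def V_def c(2) by simp
    show ?thesis
    proof (intro exI conjI)
      show "q `` {(V a, V b, \<beta> j ` cball 0 1)} \<in> edges ?G" using m by (auto intro: quotientI)
      show "ends ?G (q `` {(V a, V b, \<beta> j ` cball 0 1)}) = (\<lambda>n. r `` {V n}) ` c"
        unfolding ends[OF m] c(1) by simp
    qed
  qed
  then obtain e where e: "\<And>c. c \<in> cube_edges \<Longrightarrow> e c \<in> edges ?G \<and> ends ?G (e c) = (\<lambda>n. r `` {V n}) ` c"
    by metis
  have inj: "inj_on (\<lambda>n. r `` {V n}) {..<16}"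
  proof (rule inj_onI)
    fix m n :: nat assume mn: "m \<in> {..<16}" "n \<in> {..<16}" "r `` {V m} = r `` {V n}"
    then have "cube_vertex m = cube_vertex n"
      using r_iso[OF mn(3) VX] raised_not_isotopic[OF T sub sub] unfolding V_def by blast
    then show "m = n" using inj_onD[OF cube_vertex_inj] mn(1,2) by blast
  qed
  have "(\<lambda>n. r `` {V n}) ` {..<16} \<subseteq> vertices ?G"
    using VX by (auto intro: quotientI)
  then show ?thesis unfolding G by (rule planar_no_cube[OF inj _ e])
qed

end


section \<open>Shearing projections\<close>

definition cross2 :: "complex \<Rightarrow> complex \<Rightarrow> real" where
  "cross2 u v = Re u * Im v - Im u * Re v"

lemma cross2_simps [simp]: "cross2 u u = 0" "cross2 u 0 = 0" "cross2 0 v = 0"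
  by (simp_all add: cross2_def)

lemma cross2_bilinear:
  "cross2 (u + u') v = cross2 u v + cross2 u' v" "cross2 (u - u') v = cross2 u v - cross2 u' v"
  "cross2 u (v + v') = cross2 u v + cross2 u v'" "cross2 u (v - v') = cross2 u v - cross2 u v'"
  "cross2 (c *\<^sub>R u) v = c * cross2 u v" "cross2 u (c *\<^sub>R v) = c * cross2 u v"
  by (simp_all add: cross2_def algebra_simps)

text \<open>The projection of 3-space to the plane along the direction \<open>(- w, 1)\<close>.\<close>

definition proj :: "complex \<Rightarrow> complex \<times> real \<Rightarrow> complex" where
  "proj w x = fst x + snd x *\<^sub>R w"

lemma proj_linear: "proj w (x + y) = proj w x + proj w y" "proj w (x - y) = proj w x - proj w y"
  "proj w (c *\<^sub>R x) = c *\<^sub>R proj w x" "proj w 0 = 0"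
  by (simp_all add: proj_def algebra_simps)

lemma continuous_on_proj [continuous_intros]: "continuous_on S f \<Longrightarrow> continuous_on S (\<lambda>x. proj w (f x))"
  unfolding proj_def by (intro continuous_intros)

text \<open>As a function of \<open>w\<close>, the cross product of two projected vectors is affine, with the following
  linear part.\<close>

definition slope :: "complex \<times> real \<Rightarrow> complex \<times> real \<Rightarrow> complex" where
  "slope e f = snd f *\<^sub>R fst e - snd e *\<^sub>R fst f"

lemma cross2_proj: "cross2 (proj w e) (proj w f) = cross2 (fst e) (fst f) + cross2 (slope e f) w"
  by (simp add: proj_def slope_def cross2_def algebra_simps)

text \<open>Linear dependence in 3-space: up to order and signs, the two parts of
  \<open>slope\<close> and the planar cross product are the coordinates of the cross product of
  \<open>e\<close> and \<open>f\<close>.\<close>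

definition dependent2 :: "complex \<times> real \<Rightarrow> complex \<times> real \<Rightarrow> bool" where
  "dependent2 e f \<longleftrightarrow> slope e f = 0 \<and> cross2 (fst e) (fst f) = 0"

lemma dependent2_scaleR:
  assumes "dependent2 e f" "e \<noteq> 0"
  obtains c where "f = c *\<^sub>R e"
proof -
  have *: "snd f *\<^sub>R fst e = snd e *\<^sub>R fst f" "Re (fst e) * Im (fst f) = Im (fst e) * Re (fst f)"
    using assms(1) by (simp_all add: dependent2_def slope_def cross2_def)
  have **: "snd f * Re (fst e) = snd e * Re (fst f)" "snd f * Im (fst e) = snd e * Im (fst f)"
    using arg_cong[OF *(1), of Re] arg_cong[OF *(1), of Im] by simp_all
  have "snd e \<noteq> 0 \<or> Re (fst e) \<noteq> 0 \<or> Im (fst e) \<noteq> 0"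
    using assms(2) by (auto simp: prod_eq_iff complex_eq_iff)
  then consider "snd e \<noteq> 0" | "Re (fst e) \<noteq> 0" | "Im (fst e) \<noteq> 0" by blast
  then show ?thesis
  proof cases
    case 1
    show ?thesis by (rule that[of "snd f / snd e"])
      (use 1 * ** in \<open>auto simp: prod_eq_iff complex_eq_iff field_simps\<close>)
  next
    case 2
    show ?thesis by (rule that[of "Re (fst f) / Re (fst e)"])
      (use 2 * ** in \<open>auto simp: prod_eq_iff complex_eq_iff field_simps\<close>)
  next
    case 3
    show ?thesis by (rule that[of "Im (fst f) / Im (fst e)"])
      (use 3 * ** in \<open>auto simp: prod_eq_iff complex_eq_iff field_simps\<close>)
  qed
qed

text \<open>The zeros of an affine function of \<open>w\<close>: a line if the linear part is not 0,
  and otherwise empty, since the constant is then not 0.\<close>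

lemma negligible_cross2_proj:
  assumes "\<not> dependent2 e f"
  shows "negligible {w. cross2 (proj w e) (proj w f) = 0}"
proof (cases "slope e f = 0")
  case True
  then show ?thesis using assms by (simp add: cross2_proj dependent2_def)
next
  case False
  define n where "n = Complex (- Im (slope e f)) (Re (slope e f))"
  have "n \<noteq> 0" using False by (auto simp: n_def complex_eq_iff)
  moreover have "cross2 (slope e f) w = n \<bullet> w" for w
    by (simp add: cross2_def n_def inner_complex_def)
  then have "{w. cross2 (proj w e) (proj w f) = 0} = {w. n \<bullet> w = - cross2 (fst e) (fst f)}"
    unfolding cross2_proj by auto
  ultimately show ?thesis using negligible_hyperplane[of n] by simp
qed

lemma negligible_proj_zero:
  assumes "e \<noteq> 0"
  shows "negligible {w. proj w e = 0}"
proof (rule negligible_subset)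
  show "{w. proj w e = 0} \<subseteq> {- (1 / snd e) *\<^sub>R fst e}"
  proof
    fix w assume "w \<in> {w. proj w e = 0}"
    then have eq: "snd e *\<^sub>R w = - fst e" by (simp add: proj_def eq_neg_iff_add_eq_0 add.commute)
    then have ne: "snd e \<noteq> 0" using assms by (auto simp: prod_eq_iff)
    have "w = (1 / snd e) *\<^sub>R (snd e *\<^sub>R w)" using ne by simp
    then show "w \<in> {- (1 / snd e) *\<^sub>R fst e}" unfolding eq by simp
  qed
qed simp

text \<open>By Cramer's rule, the directions of the lines meeting three given lines are parametrised by the
  point on one of the latter, whence they are negligible.\<close>

lemma trisecant_eq:
  assumes e: "cross2 (fst e) (fst f) + cross2 (slope e f) w = 0"
    and e': "cross2 (fst e') (fst f') + cross2 (slope e' f') w = 0"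
    and d: "cross2 (slope e f) (slope e' f') \<noteq> 0"
  shows "w = (1 / cross2 (slope e f) (slope e' f')) *\<^sub>R
     (cross2 (fst e') (fst f') *\<^sub>R slope e f - cross2 (fst e) (fst f) *\<^sub>R slope e' f')"
proof -
  define l where "l = slope e f"
  define m where "m = slope e' f'"
  have c: "cross2 (fst e) (fst f) = - cross2 l w" "cross2 (fst e') (fst f') = - cross2 m w"
    using e e' by (simp_all add: l_def m_def)
  have "cross2 l m *\<^sub>R w = (- cross2 m w) *\<^sub>R l - (- cross2 l w) *\<^sub>R m"
    by (simp add: cross2_def complex_eq_iff algebra_simps)
  moreover have "w = (1 / cross2 l m) *\<^sub>R (cross2 l m *\<^sub>R w)" using d by (simp add: l_def m_def)
  ultimately show ?thesis unfolding c l_def[symmetric] m_def[symmetric] by simp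
qed

lemma negligible_trisecants:
  shows "negligible {w. \<exists>\<sigma>. cross2 (proj w d) (proj w (a - \<sigma> *\<^sub>R x)) = 0 \<and>
    cross2 (proj w d') (proj w (a' - \<sigma> *\<^sub>R x)) = 0 \<and>
    cross2 (slope d (a - \<sigma> *\<^sub>R x)) (slope d' (a' - \<sigma> *\<^sub>R x)) \<noteq> 0}"
proof -
  define l where "l \<sigma> = slope d (a - \<sigma> *\<^sub>R x)" for \<sigma> :: real
  define m where "m \<sigma> = slope d' (a' - \<sigma> *\<^sub>R x)" for \<sigma> :: real
  define W where "W \<sigma> = (1 / cross2 (l \<sigma>) (m \<sigma>)) *\<^sub>R
     (cross2 (fst d') (fst (a' - \<sigma> *\<^sub>R x)) *\<^sub>R l \<sigma> - cross2 (fst d) (fst (a - \<sigma> *\<^sub>R x)) *\<^sub>R m \<sigma>)" for \<sigma> :: real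
  let ?S = "{\<sigma>. cross2 (l \<sigma>) (m \<sigma>) \<noteq> 0}"
  have "W differentiable_on ?S"
    unfolding differentiable_on_def
  proof
    fix \<sigma> assume \<sigma>: "\<sigma> \<in> ?S"
    have lin: "(\<lambda>\<sigma>. p + \<sigma> *\<^sub>R q) differentiable (at \<sigma> within ?S)" for p q :: complex
      by (intro derivative_intros)
    have linr: "(\<lambda>\<sigma>. p + \<sigma> * q) differentiable (at \<sigma> within ?S)" for p q :: real
      by (intro derivative_intros)
    have "l = (\<lambda>\<sigma>. slope d a + \<sigma> *\<^sub>R (- slope d x))" "m = (\<lambda>\<sigma>. slope d' a' + \<sigma> *\<^sub>R (- slope d' x))"
      by (simp_all add: l_def m_def slope_def fun_eq_iff algebra_simps)
    then have l: "l differentiable (at \<sigma> within ?S)" and m: "m differentiable (at \<sigma> within ?S)"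
      using lin by simp_all
    have c: "(\<lambda>\<sigma>. cross2 u (fst (b - \<sigma> *\<^sub>R x))) differentiable (at \<sigma> within ?S)" for u b
      using linr[of "cross2 u (fst b)" "- cross2 u (fst x)"]
      by (simp add: cross2_bilinear)
    have comp: "(\<lambda>\<sigma>. Re (h \<sigma>)) differentiable (at \<sigma> within ?S)" "(\<lambda>\<sigma>. Im (h \<sigma>)) differentiable (at \<sigma> within ?S)"
      if h: "h differentiable (at \<sigma> within ?S)" for h
    proof -
      obtain H where H: "(h has_derivative H) (at \<sigma> within ?S)"
        using h[unfolded differentiable_def] by (rule exE)
      show "(\<lambda>\<sigma>. Re (h \<sigma>)) differentiable (at \<sigma> within ?S)"
        by (rule differentiableI[OF bounded_linear.has_derivative[OF bounded_linear_Re H]])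
      show "(\<lambda>\<sigma>. Im (h \<sigma>)) differentiable (at \<sigma> within ?S)"
        by (rule differentiableI[OF bounded_linear.has_derivative[OF bounded_linear_Im H]])
    qed
    have "(\<lambda>\<sigma>. Re (l \<sigma>) * Im (m \<sigma>) - Im (l \<sigma>) * Re (m \<sigma>)) differentiable (at \<sigma> within ?S)"
      by (intro derivative_intros comp l m)
    moreover have "(\<lambda>\<sigma>. cross2 (l \<sigma>) (m \<sigma>)) = (\<lambda>\<sigma>. Re (l \<sigma>) * Im (m \<sigma>) - Im (l \<sigma>) * Re (m \<sigma>))"
      by (simp add: cross2_def fun_eq_iff)
    ultimately have "(\<lambda>\<sigma>. cross2 (l \<sigma>) (m \<sigma>)) differentiable (at \<sigma> within ?S)" by simp
    then show "W differentiable (at \<sigma> within ?S)"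
      unfolding W_def[abs_def] using \<sigma> by (intro derivative_intros l m c) auto
  qed
  \<comment> \<open>A differentiable image of a subset of the real line has measure zero in the
    plane.\<close>
  then have "negligible (W ` ?S)"
    by (intro negligible_differentiable_image_lowdim) auto
  then show ?thesis
  proof (rule negligible_subset)
    show "{w. \<exists>\<sigma>. cross2 (proj w d) (proj w (a - \<sigma> *\<^sub>R x)) = 0 \<and>
        cross2 (proj w d') (proj w (a' - \<sigma> *\<^sub>R x)) = 0 \<and>
        cross2 (slope d (a - \<sigma> *\<^sub>R x)) (slope d' (a' - \<sigma> *\<^sub>R x)) \<noteq> 0} \<subseteq> W ` ?S"
    proof clarify
      fix w \<sigma> assume *: "cross2 (proj w d) (proj w (a - \<sigma> *\<^sub>R x)) = 0"
        "cross2 (proj w d') (proj w (a' - \<sigma> *\<^sub>R x)) = 0"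
        "cross2 (slope d (a - \<sigma> *\<^sub>R x)) (slope d' (a' - \<sigma> *\<^sub>R x)) \<noteq> 0"
      then have "w = W \<sigma>"
        unfolding W_def l_def m_def
        by (intro trisecant_eq[OF *(1)[unfolded cross2_proj] *(2)[unfolded cross2_proj] *(3)])
      then show "w \<in> W ` ?S" using *(3) by (auto simp: l_def m_def)
    qed
  qed
qed

text \<open>The last condition excludes triple points; \<open>\<sigma>\<close> is the parameter of the point on the first segment.\<close>

definition generic :: "((complex \<times> real) \<times> (complex \<times> real)) set \<Rightarrow> (complex \<times> real) set \<Rightarrow> complex \<Rightarrow> bool" where
  "generic S V w \<longleftrightarrow>
     (\<forall>u\<in>V. \<forall>v\<in>V. u \<noteq> v \<longrightarrow> proj w (v - u) \<noteq> 0) \<and>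
     (\<forall>(a, b)\<in>S. a \<noteq> b \<longrightarrow> proj w (b - a) \<noteq> 0) \<and>
     (\<forall>(a, b)\<in>S. \<forall>(c, d)\<in>S. cross2 (proj w (b - a)) (proj w (d - c)) = 0 \<longrightarrow> dependent2 (b - a) (d - c)) \<and>
     (\<forall>(a, b)\<in>S. \<forall>v\<in>V. cross2 (proj w (b - a)) (proj w (v - a)) = 0 \<longrightarrow> dependent2 (b - a) (v - a)) \<and>
     (\<forall>(a, b)\<in>S. \<forall>(c, d)\<in>S. \<forall>(c', d')\<in>S. \<not> (\<exists>\<sigma>.
        cross2 (proj w (d - c)) (proj w ((c - a) - \<sigma> *\<^sub>R (b - a))) = 0 \<and>
        cross2 (proj w (d' - c')) (proj w ((c' - a) - \<sigma> *\<^sub>R (b - a))) = 0 \<and>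
        cross2 (slope (d - c) ((c - a) - \<sigma> *\<^sub>R (b - a))) (slope (d' - c') ((c' - a) - \<sigma> *\<^sub>R (b - a))) \<noteq> 0))"

text \<open>Each condition excludes finitely many negligible sets of directions, and these cannot
  cover the plane.\<close>

lemma generic_exists:
  assumes S: "finite S" and V: "finite V"
  obtains w where "generic S V w"
proof -
  define B1 where "B1 = (\<Union>u\<in>V. \<Union>v\<in>V. if u = v then {} else {w. proj w (v - u) = 0})"
  define B2 where "B2 = (\<Union>(a, b)\<in>S. if a = b then {} else {w. proj w (b - a) = 0})"
  define B3 where "B3 = (\<Union>(a, b)\<in>S. \<Union>(c, d)\<in>S. if dependent2 (b - a) (d - c) then {} else
    {w. cross2 (proj w (b - a)) (proj w (d - c)) = 0})"
  define B4 where "B4 = (\<Union>(a, b)\<in>S. \<Union>v\<in>V. if dependent2 (b - a) (v - a) then {} else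
    {w. cross2 (proj w (b - a)) (proj w (v - a)) = 0})"
  define B5 where "B5 = (\<Union>(a, b)\<in>S. \<Union>(c, d)\<in>S. \<Union>(c', d')\<in>S. {w. \<exists>\<sigma>.
        cross2 (proj w (d - c)) (proj w ((c - a) - \<sigma> *\<^sub>R (b - a))) = 0 \<and>
        cross2 (proj w (d' - c')) (proj w ((c' - a) - \<sigma> *\<^sub>R (b - a))) = 0 \<and>
        cross2 (slope (d - c) ((c - a) - \<sigma> *\<^sub>R (b - a))) (slope (d' - c') ((c' - a) - \<sigma> *\<^sub>R (b - a))) \<noteq> 0})"
  have U: "negligible (\<Union>x\<in>A. f x)" if "finite A" "\<And>x. x \<in> A \<Longrightarrow> negligible (f x)"
    for A :: "'b set" and f :: "'b \<Rightarrow> complex set"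
    using that by (intro negligible_Union) auto
  have n1: "negligible B1" unfolding B1_def
    by (intro U V) (simp add: negligible_proj_zero)
  have n2: "negligible B2" unfolding B2_def case_prod_beta
    by (intro U S) (simp add: negligible_proj_zero)
  have n3: "negligible B3" unfolding B3_def case_prod_beta
    by (intro U S) (simp add: negligible_cross2_proj)
  have n4: "negligible B4" unfolding B4_def case_prod_beta
    by (intro U S V) (simp add: negligible_cross2_proj)
  have n5: "negligible B5" unfolding B5_def case_prod_beta
    by (intro U S negligible_trisecants)
  have "negligible (B1 \<union> B2 \<union> B3 \<union> B4 \<union> B5)"
    using n1 n2 n3 n4 n5 by (intro negligible_Un)
  then have "B1 \<union> B2 \<union> B3 \<union> B4 \<union> B5 \<noteq> UNIV"
    using non_negligible_UNIV by metis
  then obtain w where w: "w \<notin> B1" "w \<notin> B2" "w \<notin> B3" "w \<notin> B4" "w \<notin> B5" by blast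
  have "generic S V w"
    unfolding generic_def case_prod_beta
  proof (intro conjI ballI impI)
    show "proj w (v - u) \<noteq> 0" if "u \<in> V" "v \<in> V" "u \<noteq> v" for u v
      using w(1) that unfolding B1_def by auto
    show "proj w (snd p - fst p) \<noteq> 0" if "p \<in> S" "fst p \<noteq> snd p" for p
      using w(2) that unfolding B2_def case_prod_beta by auto
    show "dependent2 (snd p - fst p) (snd q - fst q)" if "p \<in> S" "q \<in> S"
      "cross2 (proj w (snd p - fst p)) (proj w (snd q - fst q)) = 0" for p q
    proof (rule ccontr)
      assume "\<not> dependent2 (snd p - fst p) (snd q - fst q)"
      then have "w \<in> B3" unfolding B3_def case_prod_beta using that by (intro UN_I[of p] UN_I[of q]) auto
      then show False using w(3) by simp
    qed
    show "dependent2 (snd p - fst p) (v - fst p)" if "p \<in> S" "v \<in> V"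
      "cross2 (proj w (snd p - fst p)) (proj w (v - fst p)) = 0" for p v
    proof (rule ccontr)
      assume "\<not> dependent2 (snd p - fst p) (v - fst p)"
      then have "w \<in> B4" unfolding B4_def case_prod_beta using that by (intro UN_I[of p] UN_I[of v]) auto
      then show False using w(4) by simp
    qed
    fix p q q' assume "p \<in> S" "q \<in> S" "q' \<in> S"
    then show "\<not> (\<exists>\<sigma>. cross2 (proj w (snd q - fst q)) (proj w ((fst q - fst p) - \<sigma> *\<^sub>R (snd p - fst p))) = 0 \<and>
        cross2 (proj w (snd q' - fst q')) (proj w ((fst q' - fst p) - \<sigma> *\<^sub>R (snd p - fst p))) = 0 \<and>
        cross2 (slope (snd q - fst q) ((fst q - fst p) - \<sigma> *\<^sub>R (snd p - fst p)))
          (slope (snd q' - fst q') ((fst q' - fst p) - \<sigma> *\<^sub>R (snd p - fst p))) \<noteq> 0)"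
      using w(5) unfolding B5_def case_prod_beta by blast
  qed
  then show ?thesis using that by blast
qed


section \<open>A diagram of a polygonal knot\<close>

text \<open>The finite family of segments may be arbitrary apart from its union being a circle.
  Counting the meeting points of non-parallel segments as corners ensures that near any other point
  the knot runs along a single line.\<close>

definition crossing_points ::
  "((complex \<times> real) \<times> (complex \<times> real)) set \<Rightarrow> (complex \<times> real) set" where
  "crossing_points S = {x. \<exists>(a, b)\<in>S. \<exists>(c, d)\<in>S. \<not> dependent2 (b - a) (d - c) \<and>
     x \<in> closed_segment a b \<and> x \<in> closed_segment c d}"

definition corners :: "((complex \<times> real) \<times> (complex \<times> real)) set \<Rightarrow> (complex \<times> real) set" where
  "corners S = fst ` S \<union> snd ` S \<union> crossing_points S"

lemma closed_segment_param:
  assumes "x \<in> closed_segment a b"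
  obtains t where "0 \<le> t" "t \<le> 1" "x = a + t *\<^sub>R (b - a)"
  using assms by (auto simp: in_segment algebra_simps)

lemma slope_scaleR: "slope (s *\<^sub>R e) (t *\<^sub>R f) = (s * t) *\<^sub>R slope e f"
  by (simp add: slope_def algebra_simps)

text \<open>The difference of two common points would be a multiple of both directions, so
  independent directions allow only one such point.\<close>

lemma finite_crossing_points:
  assumes "finite S"
  shows "finite (crossing_points S)"
proof -
  have "finite {x. x \<in> closed_segment a b \<and> x \<in> closed_segment c d}" (is "finite ?X")
    if nd: "\<not> dependent2 (b - a) (d - c)" for a b c d :: "complex \<times> real"
  proof -
    have uniq: "x = y" if x: "x \<in> ?X" and y: "y \<in> ?X" for x y
    proof -
      have seg: "x \<in> closed_segment a b" "y \<in> closed_segment a b" "x \<in> closed_segment c d" "y \<in> closed_segment c d"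
        using x y by simp_all
      obtain s where s: "x = a + s *\<^sub>R (b - a)" using seg(1) by (rule closed_segment_param)
      obtain t where t: "y = a + t *\<^sub>R (b - a)" using seg(2) by (rule closed_segment_param)
      obtain s' where s': "x = c + s' *\<^sub>R (d - c)" using seg(3) by (rule closed_segment_param)
      obtain t' where t': "y = c + t' *\<^sub>R (d - c)" using seg(4) by (rule closed_segment_param)
      note * = s t s' t'
      have e: "y - x = (t - s) *\<^sub>R (b - a)" "y - x = (t' - s') *\<^sub>R (d - c)"
        subgoal by (unfold s t) (simp add: algebra_simps)
        subgoal by (unfold s' t') (simp add: algebra_simps)
        done
      have "slope ((t - s) *\<^sub>R (b - a)) ((t' - s') *\<^sub>R (d - c)) = 0"
        "cross2 (fst ((t - s) *\<^sub>R (b - a))) (fst ((t' - s') *\<^sub>R (d - c))) = 0"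
        unfolding e[symmetric] by (simp_all add: slope_def)
      then have "((t - s) * (t' - s')) *\<^sub>R slope (b - a) (d - c) = 0"
        "(t' - s') * ((t - s) * cross2 (fst (b - a)) (fst (d - c))) = 0"
        by (simp_all only: slope_scaleR fst_scaleR cross2_bilinear)
      then have "t - s = 0 \<or> t' - s' = 0"
        using nd by (auto simp: dependent2_def)
      then show ?thesis using e by auto
    qed
    show ?thesis
    proof (cases "?X = {}")
      case False
      then obtain x where "x \<in> ?X" by blast
      then have "?X \<subseteq> {x}" using uniq by blast
      then show ?thesis using finite_subset by blast
    qed (simp only: finite.emptyI)
  qed
  then have "finite (\<Union>(a, b)\<in>S. \<Union>(c, d)\<in>S. if dependent2 (b - a) (d - c) then {} else
      {x. x \<in> closed_segment a b \<and> x \<in> closed_segment c d})"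
    using assms by auto
  moreover have "crossing_points S \<subseteq> (\<Union>(a, b)\<in>S. \<Union>(c, d)\<in>S. if dependent2 (b - a) (d - c) then {} else
      {x. x \<in> closed_segment a b \<and> x \<in> closed_segment c d})"
    unfolding crossing_points_def by fastforce
  ultimately show ?thesis by (rule finite_subset[rotated])
qed

locale generic_polygon =
  fixes S :: "((complex \<times> real) \<times> (complex \<times> real)) set" and w :: complex
    and f :: "complex \<Rightarrow> complex \<times> real" and g
  assumes S: "finite S" and gen: "generic S (corners S) w"
    and fg: "homeomorphism S1 (\<Union>(a, b)\<in>S. closed_segment a b) f g"
begin

abbreviation P :: "(complex \<times> real) set" where "P \<equiv> \<Union>(a, b)\<in>S. closed_segment a b"
abbreviation V :: "(complex \<times> real) set" where "V \<equiv> corners S"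

lemma f: "continuous_on S1 f" "f ` S1 = P" "\<And>s. s \<in> S1 \<Longrightarrow> g (f s) = s"
  "\<And>x. x \<in> P \<Longrightarrow> f (g x) = x" "\<And>x. x \<in> P \<Longrightarrow> g x \<in> S1" "continuous_on P g"
  using fg unfolding homeomorphism_def by blast+

lemma inj_f: "inj_on f S1" using f(3) by (metis inj_onI)

lemma finite_V: "finite V"
  using S finite_crossing_points by (simp add: corners_def)

lemma ends_V: "(a, b) \<in> S \<Longrightarrow> a \<in> V \<and> b \<in> V"
  unfolding corners_def by force

lemmas gen_conj =
  gen[unfolded generic_def, THEN conjunct1]
  gen[unfolded generic_def, THEN conjunct2, THEN conjunct1]
  gen[unfolded generic_def, THEN conjunct2, THEN conjunct2, THEN conjunct1]
  gen[unfolded generic_def, THEN conjunct2, THEN conjunct2, THEN conjunct2, THEN conjunct1]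
  gen[unfolded generic_def, THEN conjunct2, THEN conjunct2, THEN conjunct2, THEN conjunct2]

lemma gen_V: "u \<in> V \<Longrightarrow> v \<in> V \<Longrightarrow> u \<noteq> v \<Longrightarrow> proj w (v - u) \<noteq> 0"
  using gen_conj(1) by blast

lemma gen_S: "(a, b) \<in> S \<Longrightarrow> a \<noteq> b \<Longrightarrow> proj w (b - a) \<noteq> 0"
  using gen_conj(2) by fast

lemma gen_SS: "(a, b) \<in> S \<Longrightarrow> (c, d) \<in> S \<Longrightarrow> cross2 (proj w (b - a)) (proj w (d - c)) = 0 \<Longrightarrow>
    dependent2 (b - a) (d - c)"
  using gen_conj(3) by fast

lemma gen_SV: "(a, b) \<in> S \<Longrightarrow> v \<in> V \<Longrightarrow> cross2 (proj w (b - a)) (proj w (v - a)) = 0 \<Longrightarrow>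
    dependent2 (b - a) (v - a)"
  using gen_conj(4) by fast

lemma gen_SSS: "(a, b) \<in> S \<Longrightarrow> (c, d) \<in> S \<Longrightarrow> (c', d') \<in> S \<Longrightarrow>
        cross2 (proj w (d - c)) (proj w ((c - a) - \<sigma> *\<^sub>R (b - a))) = 0 \<Longrightarrow>
        cross2 (proj w (d' - c')) (proj w ((c' - a) - \<sigma> *\<^sub>R (b - a))) = 0 \<Longrightarrow>
        cross2 (slope (d - c) ((c - a) - \<sigma> *\<^sub>R (b - a))) (slope (d' - c') ((c' - a) - \<sigma> *\<^sub>R (b - a))) = 0"
  using gen_conj(5) by fast

text \<open>The projections of \<open>v - a\<close> and \<open>b - a\<close> are parallel.  By genericity, so are the vectors themselves, and
  the projection is injective on the line through \<open>a\<close> and \<open>b\<close>.\<close>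

lemma proj_collinear:
  assumes ab: "(a, b) \<in> S" "a \<noteq> b" and v: "v \<in> V" and x: "x = a + \<sigma> *\<^sub>R (b - a)"
    and y: "y = v + \<tau> *\<^sub>R (b - a)" and eq: "proj w x = proj w y"
  shows "x = y"
proof -
  have "proj w (v - a) = (\<sigma> - \<tau>) *\<^sub>R proj w (b - a)"
  proof -
    have "v - a = (y - x) + (\<sigma> - \<tau>) *\<^sub>R (b - a)" by (simp add: x y algebra_simps)
    then show ?thesis using eq by (simp only: proj_linear) simp
  qed
  then have "dependent2 (b - a) (v - a)"
    by (intro gen_SV ab v) (simp add: cross2_bilinear)
  then obtain c where c: "v - a = c *\<^sub>R (b - a)"
    using dependent2_scaleR ab(2) by (metis right_minus_eq)
  then have yx: "y - x = (c + \<tau> - \<sigma>) *\<^sub>R (b - a)" by (simp add: x y algebra_simps)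
  then have "(c + \<tau> - \<sigma>) *\<^sub>R proj w (b - a) = 0"
    using eq proj_linear(2,3)[of w] by (metis right_minus_eq)
  then have "c + \<tau> - \<sigma> = 0" using gen_S[OF ab] by simp
  then show ?thesis using yx by simp
qed

lemma proj_corner:
  assumes v: "v \<in> V" and y: "y \<in> P" "proj w y = proj w v"
  shows "y = v"
proof -
  obtain a b where ab: "(a, b) \<in> S" "y \<in> closed_segment a b" using y(1) by auto
  show ?thesis
  proof (cases "a = b")
    case True
    then have "y \<in> V" using ab ends_V by auto
    then show ?thesis using gen_V[OF v \<open>y \<in> V\<close>] y(2) by (auto simp: proj_linear)
  next
    case False
    obtain t where "y = a + t *\<^sub>R (b - a)" using ab(2) by (rule closed_segment_param)
    then show ?thesis using proj_collinear[OF ab(1) False v, of y t v 0] y(2) by simp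
  qed
qed

text \<open>For parallel directions, \<open>y\<close> would lie on the line of direction
  \<open>b - a\<close> through the corner \<open>c\<close>, and \<open>proj_collinear\<close> would
  give \<open>x = y\<close>.\<close>

lemma proj_crossing:
  assumes ab: "(a, b) \<in> S" "x \<in> closed_segment a b" and cd: "(c, d) \<in> S" "y \<in> closed_segment c d"
    and ne: "x \<noteq> y" and eq: "proj w x = proj w y"
  shows "cross2 (proj w (b - a)) (proj w (d - c)) \<noteq> 0" "x \<notin> V"
proof -
  have xy: "x \<in> P" "y \<in> P" using ab cd by blast+
  show nV: "x \<notin> V" using proj_corner[of x y] xy(2) ne eq by auto
  have "y \<notin> V" using proj_corner[of y x] xy(1) ne eq by auto
  have ne': "a \<noteq> b" "c \<noteq> d"
    using nV \<open>y \<notin> V\<close> ab(2) cd(2) ends_V[OF ab(1)] ends_V[OF cd(1)] by auto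
  show "cross2 (proj w (b - a)) (proj w (d - c)) \<noteq> 0"
  proof
    assume "cross2 (proj w (b - a)) (proj w (d - c)) = 0"
    then have "dependent2 (b - a) (d - c)" by (intro gen_SS ab cd)
    then obtain k where k: "d - c = k *\<^sub>R (b - a)"
      using dependent2_scaleR ne'(1) by (metis right_minus_eq)
    obtain s where s: "x = a + s *\<^sub>R (b - a)" using ab(2) by (rule closed_segment_param)
    obtain t where "y = c + t *\<^sub>R (d - c)" using cd(2) by (rule closed_segment_param)
    then have "y = c + (t * k) *\<^sub>R (b - a)" by (simp add: k)
    then show False using proj_collinear[OF ab(1) ne'(1) _ s _ eq] ends_V[OF cd(1)] ne by blast
  qed
qed

text \<open>The projected segments have independent directions because of the crossing at
  \<open>x\<close>, so their lines meet only once. This bounds the number of crossings.\<close>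

lemma proj_crossing_unique:
  assumes ab: "(a, b) \<in> S" "x \<in> closed_segment a b" "x' \<in> closed_segment a b"
    and cd: "(c, d) \<in> S" "y \<in> closed_segment c d" "y' \<in> closed_segment c d"
    and ne: "x \<noteq> y" and eq: "proj w x = proj w y" "proj w x' = proj w y'"
  shows "x = x'"
proof -
  obtain s where s: "x = a + s *\<^sub>R (b - a)" using ab(2) by (rule closed_segment_param)
  obtain s' where s': "x' = a + s' *\<^sub>R (b - a)" using ab(3) by (rule closed_segment_param)
  obtain t where t: "y = c + t *\<^sub>R (d - c)" using cd(2) by (rule closed_segment_param)
  obtain t' where t': "y' = c + t' *\<^sub>R (d - c)" using cd(3) by (rule closed_segment_param)
  have "proj w (x' - x) = proj w (y' - y)" using eq by (simp add: proj_linear)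
  moreover have "x' - x = (s' - s) *\<^sub>R (b - a)" "y' - y = (t' - t) *\<^sub>R (d - c)"
    by (simp_all add: s s' t t' algebra_simps)
  ultimately have "(s' - s) *\<^sub>R proj w (b - a) = (t' - t) *\<^sub>R proj w (d - c)" by (simp add: proj_linear(3))
  then have "(s' - s) * cross2 (proj w (b - a)) (proj w (d - c)) = 0"
    using cross2_bilinear(5) by (metis cross2_simps(1) mult_zero_right)
  then show ?thesis using proj_crossing(1)[OF ab(1,2) cd(1,2) ne eq(1)] s s' by simp
qed

text \<open>A vector killed by \<open>proj w\<close> is a multiple of \<open>(- w, 1)\<close>, and
  the multiple of \<open>e\<close> drops out because \<open>slope\<close> is alternating. This
  translates the last condition of \<open>generic\<close> into cross products of projected
  directions.\<close>

lemma slope_vertical: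
  assumes "proj w h = 0"
  shows "slope e (h - t *\<^sub>R e) = snd h *\<^sub>R proj w e"
proof -
  have "fst h = - (snd h *\<^sub>R w)" using assms by (simp add: proj_def eq_neg_iff_add_eq_0)
  then show ?thesis by (simp add: slope_def proj_def algebra_simps)
qed

text \<open>A triple point gives a line of direction \<open>(- w, 1)\<close> meeting three segments.
  Genericity then makes the two slopes parallel; as they are nonzero multiples of the projected
  directions at \<open>y\<close> and \<open>u\<close>, this contradicts
  \<open>proj_crossing\<close>.\<close>

lemma proj_no_triple:
  assumes "x \<in> P" "y \<in> P" "u \<in> P" "x \<noteq> y" "y \<noteq> u" "x \<noteq> u" "proj w x = proj w y" "proj w x = proj w u"
  shows False
proof -
  obtain a b where ab: "(a, b) \<in> S" "x \<in> closed_segment a b" using assms(1) by auto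
  obtain c d where cd: "(c, d) \<in> S" "y \<in> closed_segment c d" using assms(2) by auto
  obtain c' d' where cd': "(c', d') \<in> S" "u \<in> closed_segment c' d'" using assms(3) by auto
  obtain s where s: "x = a + s *\<^sub>R (b - a)" using ab(2) by (rule closed_segment_param)
  obtain t where t: "y = c + t *\<^sub>R (d - c)" using cd(2) by (rule closed_segment_param)
  obtain t' where t': "u = c' + t' *\<^sub>R (d' - c')" using cd'(2) by (rule closed_segment_param)
  have e: "(c - a) - s *\<^sub>R (b - a) = (y - x) - t *\<^sub>R (d - c)"
    "(c' - a) - s *\<^sub>R (b - a) = (u - x) - t' *\<^sub>R (d' - c')"
    by (simp_all add: s t t' algebra_simps)
  have v: "proj w (y - x) = 0" "proj w (u - x) = 0" using assms(7,8) by (simp_all add: proj_linear)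
  have "cross2 (snd (y - x) *\<^sub>R proj w (d - c)) (snd (u - x) *\<^sub>R proj w (d' - c')) = 0"
    using gen_SSS[OF ab(1) cd(1) cd'(1), of s] unfolding e slope_vertical[OF v(1)] slope_vertical[OF v(2)]
    by (simp only: proj_linear(2)[of w "y - x"] proj_linear(2)[of w "u - x"] v proj_linear(3) cross2_bilinear) simp
  then have z: "snd (u - x) * (snd (y - x) * cross2 (proj w (d - c)) (proj w (d' - c'))) = 0"
    by (simp only: cross2_bilinear)
  have "snd h \<noteq> 0" if "proj w h = 0" "h \<noteq> 0" for h
    using that by (auto simp: proj_def prod_eq_iff)
  moreover have "y - x \<noteq> 0" "u - x \<noteq> 0" using assms(4,6) by simp_all
  ultimately have "snd (y - x) \<noteq> 0" "snd (u - x) \<noteq> 0" using v by blast+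
  then have "cross2 (proj w (d - c)) (proj w (d' - c')) = 0" using z by simp
  moreover have "proj w y = proj w u" using assms(7,8) by simp
  ultimately show False using proj_crossing(1)[OF cd cd' assms(5)] by blast
qed

text \<open>The segments that miss \<open>x\<close> form a compact set. All others contain
  \<open>x\<close>, which is not a corner, and therefore have the same direction.\<close>

lemma local_line:
  assumes x: "(a, b) \<in> S" "x \<in> closed_segment a b" "x \<notin> V"
  obtains N where "open N" "x \<in> N" "\<forall>y\<in>P \<inter> N. \<exists>m. y = x + m *\<^sub>R (b - a)" "compact (P - N)"
proof -
  define Q where "Q = (\<Union>(c, d)\<in>{(c, d)\<in>S. x \<notin> closed_segment c d}. closed_segment c d)"
  have "compact Q"
    unfolding Q_def by (intro compact_UN) (use S in \<open>auto intro: finite_subset\<close>)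
  show ?thesis
  proof (rule that[of "- Q"])
    show "open (- Q)" using \<open>compact Q\<close> compact_imp_closed by blast
    show "x \<in> - Q" by (auto simp: Q_def)
    have "P - - Q = Q" by (auto simp: Q_def)
    then show "compact (P - - Q)" using \<open>compact Q\<close> by simp
    show "\<forall>y\<in>P \<inter> - Q. \<exists>m. y = x + m *\<^sub>R (b - a)"
    proof
      fix y assume "y \<in> P \<inter> - Q"
      then have y: "y \<in> P" "y \<in> - Q" by simp_all
      then obtain c d where cd: "(c, d) \<in> S" "y \<in> closed_segment c d" by auto
      then have xcd: "x \<in> closed_segment c d" using y(2) cd unfolding Q_def by blast
      have "dependent2 (b - a) (d - c)"
        using x cd(1) xcd unfolding corners_def crossing_points_def by blast
      moreover have "a \<noteq> b" using x(2,3) ends_V[OF x(1)] by auto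
      ultimately obtain k where k: "d - c = k *\<^sub>R (b - a)"
        using dependent2_scaleR by (metis right_minus_eq)
      obtain s where s: "x = c + s *\<^sub>R (d - c)" using xcd by (rule closed_segment_param)
      obtain t where t: "y = c + t *\<^sub>R (d - c)" using cd(2) by (rule closed_segment_param)
      have "y = x + (t - s) *\<^sub>R (d - c)" by (unfold s t) (simp add: algebra_simps)
      then have "y = x + ((t - s) * k) *\<^sub>R (b - a)" by (simp add: k)
      then show "\<exists>m. y = x + m *\<^sub>R (b - a)" ..
    qed
  qed
qed

definition plane_curve :: "complex \<Rightarrow> complex \<Rightarrow> complex" where
  "plane_curve p0 s = proj w (f s) - p0"

definition plane_diagram :: "complex \<Rightarrow> complex diagram" where
  "plane_diagram p0 = Diagram (plane_curve p0)
     {s \<in> S1. \<exists>t\<in>S1. t \<noteq> s \<and> plane_curve p0 t = plane_curve p0 s \<and> snd (f t) < snd (f s)}"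

lemma plane_curve_eq_iff: "plane_curve p0 s = plane_curve p0 t \<longleftrightarrow> proj w (f s) = proj w (f t)"
  by (simp add: plane_curve_def)

lemma f_neq: "s \<in> S1 \<Longrightarrow> t \<in> S1 \<Longrightarrow> s \<noteq> t \<Longrightarrow> f s \<noteq> f t"
  using inj_onD[OF inj_f] by blast

lemma f_P: "s \<in> S1 \<Longrightarrow> f s \<in> P"
  using f(2) by blast

lemma finite_double_params: "finite (double_params (plane_curve p0))"
proof -
  let ?X = "\<lambda>a b c d. {x \<in> closed_segment a b. \<exists>y\<in>closed_segment c d. x \<noteq> y \<and> proj w x = proj w y}"
  have fin: "finite (?X a b c d)" if "(a, b) \<in> S" "(c, d) \<in> S" for a b c d
  proof (cases "?X a b c d = {}")
    case False
    then obtain x where x: "x \<in> ?X a b c d" by blast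
    have "?X a b c d \<subseteq> {x}"
    proof
      fix x' assume "x' \<in> ?X a b c d"
      then obtain y' where y': "x' \<in> closed_segment a b" "y' \<in> closed_segment c d" "x' \<noteq> y'"
        "proj w x' = proj w y'" by blast
      obtain y where y: "x \<in> closed_segment a b" "y \<in> closed_segment c d" "proj w x = proj w y"
        using x by blast
      show "x' \<in> {x}"
        using proj_crossing_unique[OF that(1) y'(1) y(1) that(2) y'(2) y(2) y'(3,4) y(3)] by simp
    qed
    then show ?thesis using finite_subset by blast
  qed (simp only: finite.emptyI)
  have "finite (\<Union>(a, b)\<in>S. \<Union>(c, d)\<in>S. ?X a b c d)"
    using S fin by (intro finite_UN_I) auto
  moreover have "f ` double_params (plane_curve p0) \<subseteq> (\<Union>(a, b)\<in>S. \<Union>(c, d)\<in>S. ?X a b c d)"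
  proof (rule image_subsetI)
    fix s assume "s \<in> double_params (plane_curve p0)"
    then obtain t where st: "s \<in> S1" "t \<in> S1" "t \<noteq> s" "proj w (f t) = proj w (f s)"
      unfolding double_params_def plane_curve_eq_iff by blast
    obtain a b where ab: "(a, b) \<in> S" "f s \<in> closed_segment a b" using f_P[OF st(1)] by auto
    obtain c d where cd: "(c, d) \<in> S" "f t \<in> closed_segment c d" using f_P[OF st(2)] by auto
    have "f s \<in> ?X a b c d" using ab cd st f_neq by (auto intro!: bexI[of _ "f t"])
    then show "f s \<in> (\<Union>(a, b)\<in>S. \<Union>(c, d)\<in>S. ?X a b c d)" using ab(1) cd(1) by blast
  qed
  ultimately have "finite (f ` double_params (plane_curve p0))" by (rule finite_subset[rotated])
  moreover have "inj_on f (double_params (plane_curve p0))"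
    by (rule inj_on_subset[OF inj_f]) (auto simp: double_params_def)
  ultimately show ?thesis by (simp add: finite_image_iff)
qed

text \<open>Near the two points the knot is straight. The chart consists of the affine coordinates
  centred at the crossing, with the two projected directions as axes, computed by Cramer's
  rule.\<close>

lemma transverse_plane_curve:
  assumes st: "s \<in> S1" "t \<in> S1" "s \<noteq> t" "plane_curve p0 s = plane_curve p0 t"
  shows "transverse_at UNIV (plane_curve p0) s t"
proof -
  have eq: "proj w (f s) = proj w (f t)" using st(4) by (simp add: plane_curve_eq_iff)
  obtain a b where ab: "(a, b) \<in> S" "f s \<in> closed_segment a b" using f_P[OF st(1)] by auto
  obtain c d where cd: "(c, d) \<in> S" "f t \<in> closed_segment c d" using f_P[OF st(2)] by auto
  note ne = f_neq[OF st(1-3)]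
  define e where "e = proj w (b - a)"
  define h where "h = proj w (d - c)"
  define q where "q = plane_curve p0 s"
  have eh: "cross2 e h \<noteq> 0" using proj_crossing(1)[OF ab cd ne eq] by (simp add: e_def h_def)
  have nV: "f s \<notin> V" "f t \<notin> V"
    using proj_crossing(2)[OF ab cd ne eq] proj_crossing(2)[OF cd ab ne[symmetric] eq[symmetric]] by auto
  define \<phi> where "\<phi> = (\<lambda>p. Complex (cross2 (p - q) h / cross2 e h) (cross2 e (p - q) / cross2 e h))"
  define \<psi> where "\<psi> = (\<lambda>z. q + Re z *\<^sub>R e + Im z *\<^sub>R h)"
  have \<phi>\<psi>: "\<phi> (\<psi> z) = z" for z
    using eh by (simp add: \<phi>_def \<psi>_def cross2_bilinear complex_eq_iff)
  have \<psi>\<phi>: "\<psi> (\<phi> p) = p" for p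
  proof -
    have "cross2 e h *\<^sub>R (p - q) = cross2 (p - q) h *\<^sub>R e + cross2 e (p - q) *\<^sub>R h"
      by (simp add: cross2_def complex_eq_iff algebra_simps)
    then have "p - q = (1 / cross2 e h) *\<^sub>R (cross2 (p - q) h *\<^sub>R e + cross2 e (p - q) *\<^sub>R h)"
      using eh by (metis divide_self_if scaleR_one scaleR_scaleR times_divide_eq_left mult_1)
    then show ?thesis by (simp add: \<phi>_def \<psi>_def scaleR_add_right algebra_simps)
  qed
  have c\<phi>: "continuous_on A \<phi>" for A
    unfolding \<phi>_def cross2_def Complex_eq by (intro continuous_intros) (use eh in \<open>auto simp: cross2_def\<close>)
  have c\<psi>: "continuous_on A \<psi>" for A
    unfolding \<psi>_def by (intro continuous_intros)
  define U where "U = \<phi> -` ball 0 1"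
  have "open U" unfolding U_def by (rule open_vimage[OF open_ball c\<phi>])
  have hom: "homeomorphism U (ball 0 1) \<phi> \<psi>"
    by (rule homeomorphismI[OF c\<phi> c\<psi>]) (auto simp: U_def \<phi>\<psi> \<psi>\<phi>)
  have "\<phi> q = 0" by (simp add: \<phi>_def complex_eq_iff)
  then have qU: "q \<in> U" by (simp add: U_def)
  have cp: "continuous_on S1 (plane_curve p0)"
    unfolding plane_curve_def by (intro continuous_intros f)
  obtain N where N: "open N" "f s \<in> N" "\<forall>y\<in>P \<inter> N. \<exists>m. y = f s + m *\<^sub>R (b - a)"
    using local_line[OF ab nV(1)] .
  obtain N' where N': "open N'" "f t \<in> N'" "\<forall>y\<in>P \<inter> N'. \<exists>m. y = f t + m *\<^sub>R (d - c)"
    using local_line[OF cd nV(2)] .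
  define A where "A = (S1 \<inter> f -` N) \<inter> (S1 \<inter> plane_curve p0 -` U)"
  define B where "B = (S1 \<inter> f -` N') \<inter> (S1 \<inter> plane_curve p0 -` U)"
  have AB: "openin (top_of_set S1) A" "openin (top_of_set S1) B"
    unfolding A_def B_def
    by (intro openin_Int continuous_openin_preimage_gen f cp N N' \<open>open U\<close>)+
  have "Im (\<phi> (plane_curve p0 s')) = 0" if "s' \<in> A" for s'
  proof -
    have "f s' \<in> P" "f s' \<in> N" using that f_P by (auto simp: A_def)
    then obtain m where "f s' = f s + m *\<^sub>R (b - a)" using N(3) by blast
    then have "plane_curve p0 s' = q + m *\<^sub>R e" by (simp add: plane_curve_def q_def e_def proj_linear)
    then show ?thesis by (simp add: \<phi>_def cross2_bilinear)
  qed
  moreover have "Re (\<phi> (plane_curve p0 s')) = 0" if "s' \<in> B" for s'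
  proof -
    have "f s' \<in> P" "f s' \<in> N'" using that f_P by (auto simp: B_def)
    then obtain m where "f s' = f t + m *\<^sub>R (d - c)" using N'(3) by blast
    then have "plane_curve p0 s' = q + m *\<^sub>R h"
      using eq by (simp add: plane_curve_def q_def h_def proj_linear)
    then show ?thesis by (simp add: \<phi>_def cross2_bilinear)
  qed
  moreover have "s \<in> A" "t \<in> B" using st N(2) N'(2) qU by (auto simp: A_def B_def q_def)
  moreover have "plane_curve p0 ` A \<subseteq> U" "plane_curve p0 ` B \<subseteq> U" by (auto simp: A_def B_def)
  ultimately show ?thesis
    unfolding transverse_at_def using hom AB \<open>open U\<close>
    by (intro exI[of _ U] exI[of _ \<phi>] exI[of _ \<psi>] exI[of _ A] exI[of _ B]) auto
qed

lemma height_neq: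
  assumes "s \<in> S1" "t \<in> S1" "s \<noteq> t" "plane_curve p0 s = plane_curve p0 t"
  shows "snd (f s) \<noteq> snd (f t)"
  using f_neq[OF assms(1-3)] assms(4) by (auto simp: plane_curve_def proj_def prod_eq_iff)

lemma unique_partner:
  assumes "s \<in> S1" "t \<in> S1" "u \<in> S1" "t \<noteq> s" "u \<noteq> s" "plane_curve p0 t = plane_curve p0 s"
    "plane_curve p0 u = plane_curve p0 s"
  shows "t = u"
proof (rule ccontr)
  assume "t \<noteq> u"
  show False
    by (rule proj_no_triple[of "f s" "f t" "f u"])
      (use assms \<open>t \<noteq> u\<close> f_P f_neq in \<open>auto simp: plane_curve_eq_iff simp del: mem_sphere_0\<close>)
qed

lemma overs_iff:
  assumes "s \<in> S1" "t \<in> S1" "s \<noteq> t" "plane_curve p0 s = plane_curve p0 t"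
  shows "s \<in> overs (plane_diagram p0) \<longleftrightarrow> snd (f t) < snd (f s)"
proof -
  have "u = t" if "u \<in> S1" "u \<noteq> s" "plane_curve p0 u = plane_curve p0 s" for u
    using unique_partner[OF assms(1) that(1) assms(2)] assms that by metis
  then show ?thesis unfolding plane_diagram_def diagram.sel mem_Collect_eq using assms by metis
qed

lemma is_diagram_plane: "is_diagram UNIV (plane_diagram p0)"
proof -
  have cp: "continuous_on S1 (plane_curve p0)"
    unfolding plane_curve_def by (intro continuous_intros f)
  have "card {t \<in> S1. plane_curve p0 t = plane_curve p0 s} \<le> 2" if s: "s \<in> S1" for s
  proof -
    obtain t where "{t \<in> S1. plane_curve p0 t = plane_curve p0 s} \<subseteq> {s, t}"
    proof (cases "\<exists>t\<in>S1. t \<noteq> s \<and> plane_curve p0 t = plane_curve p0 s")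
      case True
      then obtain t where t: "t \<in> S1" "t \<noteq> s" "plane_curve p0 t = plane_curve p0 s" by blast
      have "u \<in> {s, t}" if "u \<in> S1" "plane_curve p0 u = plane_curve p0 s" for u
        using unique_partner[OF s t(1) that(1) t(2) _ t(3) that(2)] by blast
      then show ?thesis using that by blast
    qed (use that[of s] in blast)
    then have "card {t \<in> S1. plane_curve p0 t = plane_curve p0 s} \<le> card {s, t}"
      by (intro card_mono) auto
    also have "\<dots> \<le> 2" by (simp add: card_insert_if)
    finally show ?thesis .
  qed
  moreover have "overs (plane_diagram p0) \<subseteq> double_params (plane_curve p0)"
    unfolding plane_diagram_def double_params_def by auto
  moreover have "s \<in> overs (plane_diagram p0) \<longleftrightarrow> t \<notin> overs (plane_diagram p0)"
    if "s \<in> S1" "t \<in> S1" "s \<noteq> t" "plane_curve p0 s = plane_curve p0 t" for s t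
    using overs_iff[OF that] overs_iff[OF that(2,1) that(3)[symmetric] that(4)[symmetric]] height_neq[OF that] by auto
  ultimately show ?thesis
    unfolding is_diagram_def using cp finite_double_params transverse_plane_curve
    by (simp add: plane_diagram_def)
qed

text \<open>The translation by \<open>p0\<close> moves the strand to a ray, on which the norm increases.\<close>

lemma flat_disc_exists:
  assumes ab: "(a, b) \<in> S" "snd a \<noteq> snd b"
  obtains p0 \<beta> \<alpha> where "flat_disc UNIV (plane_diagram p0) \<beta> \<alpha>"
    "strict_mono_on {-1..1} ((snd \<circ> f) \<circ> \<alpha>)"
    "strict_mono_on {-1..1} (norm \<circ> (curve (plane_diagram p0) \<circ> \<alpha>))"
proof -
  have "infinite (closed_segment a b)" using ab(2) by auto
  moreover have "finite (V \<union> f ` double_params (plane_curve 0))"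
    using finite_V finite_double_params by simp
  \<comment> \<open>Away from the finitely many corners and crossings: the knot is straight at
    \<open>x\<close>, and no other point has the same projection. Translating the curve does not
    affect crossings, so the origin 0 is as good as \<open>p0\<close>.\<close>
  ultimately obtain x where x: "x \<in> closed_segment a b" "x \<notin> V" "x \<notin> f ` double_params (plane_curve 0)"
    by (meson UnCI finite_subset subsetI)
  have xP: "x \<in> P" using x(1) ab(1) by blast
  have single: "y = x" if "y \<in> P" "proj w y = proj w x" for y
  proof (rule ccontr)
    assume "y \<noteq> x"
    then have "g y \<noteq> g x" using f(4) that(1) xP by metis
    moreover have "plane_curve 0 (g y) = plane_curve 0 (g x)"
      using that f(4) xP by (simp add: plane_curve_eq_iff)
    ultimately have "g x \<in> double_params (plane_curve 0)"
      unfolding double_params_def using f(5) that(1) xP by blast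
    then show False using x(3) f(4)[OF xP] by (metis image_eqI)
  qed
  obtain t where t: "0 \<le> t" "t \<le> 1" "x = a + t *\<^sub>R (b - a)" using x(1) by (rule closed_segment_param)
  have "t \<noteq> 0" "t \<noteq> 1" using x(2) t(3) ends_V[OF ab(1)] by auto
  define \<epsilon> where "\<epsilon> = min t (1 - t)"
  have \<epsilon>: "0 < \<epsilon>" using t \<open>t \<noteq> 0\<close> \<open>t \<noteq> 1\<close> by (simp add: \<epsilon>_def)
  \<comment> \<open>The sign makes \<open>d\<close> point upwards, in whichever order the ends of
    the segment are given.\<close>
  define \<sigma> where "\<sigma> = sgn (snd b - snd a)"
  have \<sigma>: "\<sigma> = 1 \<or> \<sigma> = -1" using ab(2) by (auto simp: \<sigma>_def sgn_if)
  define d where "d = \<sigma> *\<^sub>R (b - a)"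
  have sd: "0 < snd d"
  proof -
    have "snd d = \<bar>snd b - snd a\<bar>" by (simp add: d_def \<sigma>_def abs_sgn mult.commute)
    then show ?thesis using ab(2) by simp
  qed
  have on: "x + \<tau> *\<^sub>R d \<in> closed_segment a b" if "\<bar>\<tau>\<bar> \<le> \<epsilon>" for \<tau>
  proof -
    have "x + \<tau> *\<^sub>R d = (1 - (t + \<tau> * \<sigma>)) *\<^sub>R a + (t + \<tau> * \<sigma>) *\<^sub>R b"
      by (simp add: t(3) d_def algebra_simps)
    moreover have "0 \<le> t + \<tau> * \<sigma>" "t + \<tau> * \<sigma> \<le> 1" using that \<sigma> by (auto simp: \<epsilon>_def abs_le_iff)
    ultimately show ?thesis unfolding in_segment by blast
  qed
  obtain N where N: "open N" "x \<in> N" "\<forall>y\<in>P \<inter> N. \<exists>m. y = x + m *\<^sub>R (b - a)" "compact (P - N)"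
    using local_line[OF ab(1) x(1,2)] .
  have line: "\<exists>m. y = x + m *\<^sub>R d" if y: "y \<in> P" "y \<in> N" for y
  proof -
    obtain m where "y = x + m *\<^sub>R (b - a)" using N(3) y by blast
    then have "y = x + (m * \<sigma>) *\<^sub>R d" using \<sigma> by (auto simp: d_def)
    then show ?thesis ..
  qed
  \<comment> \<open>A compact part of the knot without \<open>x\<close> that contains everything off
    the local line. By the choice of \<open>x\<close>, its projection keeps a positive distance
    \<open>r\<close> from that of \<open>x\<close>.\<close>
  define Q where "Q = (P - N) \<union> (P \<inter> {y. \<epsilon> * snd d \<le> \<bar>snd y - snd x\<bar>})"
  have "compact P" using compact_continuous_image[OF f(1)] f(2) compact_sphere by metis
  have "compact Q"
    unfolding Q_def using N(4)
  proof (rule compact_Un)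
    have "closed {y :: complex \<times> real. \<epsilon> * snd d \<le> \<bar>snd y - snd x\<bar>}"
      by (intro closed_Collect_le continuous_intros)
    then show "compact (P \<inter> {y. \<epsilon> * snd d \<le> \<bar>snd y - snd x\<bar>})"
      using \<open>compact P\<close> by (rule compact_Int_closed[rotated])
  qed
  then have "compact (proj w ` Q)"
    by (intro compact_continuous_image continuous_intros)
  then have "open (- (proj w ` Q))" using compact_imp_closed by blast
  moreover have "proj w x \<in> - (proj w ` Q)"
  proof -
    have "x \<notin> Q" using N(2) \<epsilon> sd by (auto simp: Q_def not_le)
    moreover have "Q \<subseteq> P" by (auto simp: Q_def)
    ultimately show ?thesis using single by force
  qed
  ultimately obtain r where r: "r > 0" "ball (proj w x) r \<subseteq> - (proj w ` Q)"
    using openE by blast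
  define e where "e = proj w d"
  have e: "e \<noteq> 0"
    using gen_S[OF ab(1)] ab(2) \<sigma> by (auto simp: e_def d_def proj_linear)
  \<comment> \<open>The bound \<open>\<epsilon>\<close> keeps the strand on the segment, and half of
    \<open>r\<close> leaves room for the closed disc of radius \<open>\<kappa> * norm e\<close> in
    the open ball.\<close>
  define \<kappa> where "\<kappa> = min (r / 2 / norm e) \<epsilon>"
  have \<kappa>: "0 < \<kappa>" "\<kappa> \<le> \<epsilon>" using r(1) e \<epsilon> by (auto simp: \<kappa>_def)
  have \<kappa>r: "\<kappa> * norm e < r"
  proof -
    have "\<kappa> * norm e \<le> r / 2 / norm e * norm e" by (intro mult_right_mono) (auto simp: \<kappa>_def)
    then show ?thesis using e r(1) by simp
  qed
  \<comment> \<open>The factor 2 puts the whole strand, from \<open>\<kappa>\<close> to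
    \<open>3 * \<kappa>\<close> times \<open>e\<close>, on one side of the origin.\<close>
  define p0 where "p0 = proj w x - (2 * \<kappa>) *\<^sub>R e"
  define \<beta> where "\<beta> = (\<lambda>z. (2 * \<kappa>) *\<^sub>R e + (\<kappa> *\<^sub>R e) * z)"
  define \<alpha> where "\<alpha> = (\<lambda>s. g (x + (s * \<kappa>) *\<^sub>R d))"
  have le\<epsilon>: "\<bar>s * \<kappa>\<bar> \<le> \<epsilon>" if "s \<in> {-1..1}" for s
  proof -
    have "\<bar>s\<bar> * \<kappa> \<le> 1 * \<kappa>" using that \<kappa>(1) by (intro mult_right_mono) auto
    moreover have "\<bar>s * \<kappa>\<bar> = \<bar>s\<bar> * \<kappa>" using \<kappa>(1) by (simp add: abs_mult)
    ultimately show ?thesis using \<kappa>(2) by linarith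
  qed
  have inP: "x + (s * \<kappa>) *\<^sub>R d \<in> P" if "s \<in> {-1..1}" for s
    using on[OF le\<epsilon>[OF that]] ab(1) by blast
  have f\<alpha>: "f (\<alpha> s) = x + (s * \<kappa>) *\<^sub>R d" if "s \<in> {-1..1}" for s
    using f(4)[OF inP[OF that]] by (simp add: \<alpha>_def)
  have c\<alpha>: "plane_curve p0 (\<alpha> s) = (\<kappa> * (2 + s)) *\<^sub>R e" if "s \<in> {-1..1}" for s
    by (simp add: plane_curve_def f\<alpha>[OF that] p0_def proj_linear e_def algebra_simps)
  have nz: "\<kappa> *\<^sub>R e \<noteq> 0" using \<kappa>(1) e by simp
  have "flat_disc UNIV (plane_diagram p0) \<beta> \<alpha>"
    unfolding flat_disc_def
  proof (intro conjI ballI)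
    show "continuous_on (cball 0 1) \<beta>" unfolding \<beta>_def by (intro continuous_intros)
    have inj: "inj \<beta>" using nz by (auto simp: \<beta>_def inj_def)
    then show "inj_on \<beta> (cball 0 1)" by (rule inj_on_subset) simp
    have "open (\<beta> ` ball 0 1)"
      by (rule invariance_of_domain[OF _ open_ball inj_on_subset[OF inj subset_UNIV]])
        (auto simp: \<beta>_def intro!: continuous_intros)
    then show "openin (top_of_set UNIV) (\<beta> ` ball 0 1)" by simp
    show "continuous_on {-1..1} \<alpha>"
      unfolding \<alpha>_def by (rule continuous_on_compose2[OF f(6)]) (use inP in \<open>auto intro!: continuous_intros\<close>)
    show "inj_on \<alpha> {-1..1}"
    proof (rule inj_onI)
      fix s s' assume s: "s \<in> {-1..1}" "s' \<in> {-1..1}" "\<alpha> s = \<alpha> s'"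
      have "d \<noteq> 0" using sd by auto
      have "x + (s * \<kappa>) *\<^sub>R d = x + (s' * \<kappa>) *\<^sub>R d" using f\<alpha>[OF s(1)] f\<alpha>[OF s(2)] s(3) by metis
      then have "(s * \<kappa>) *\<^sub>R d = (s' * \<kappa>) *\<^sub>R d" by (rule add_left_imp_eq)
      then have "s * \<kappa> = s' * \<kappa>" using \<open>d \<noteq> 0\<close> scaleR_cancel_right by blast
      then show "s = s'" using \<kappa>(1) by simp
    qed
    show "\<alpha> ` {-1..1} \<subseteq> S1" unfolding \<alpha>_def by (intro image_subsetI f(5) inP)
    show "curve (plane_diagram p0) (\<alpha> s) = \<beta> (of_real s)" if "s \<in> {-1..1}" for s
      unfolding plane_diagram_def diagram.sel c\<alpha>[OF that]
      by (simp add: \<beta>_def scaleR_conv_of_real algebra_simps)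
    fix s assume s: "s \<in> S1 - \<alpha> ` {-1..1}"
    show "curve (plane_diagram p0) s \<notin> \<beta> ` cball 0 1"
    proof
      assume "curve (plane_diagram p0) s \<in> \<beta> ` cball 0 1"
      then obtain z where z: "norm z \<le> 1" "plane_curve p0 s = \<beta> z" by (auto simp: plane_diagram_def)
      then have eq: "proj w (f s) - proj w x = (\<kappa> *\<^sub>R e) * z" by (simp add: plane_curve_def \<beta>_def p0_def)
      have le: "norm (proj w (f s) - proj w x) \<le> \<kappa> * norm e"
        unfolding eq using z(1) \<kappa>(1) by (simp add: norm_mult mult_left_le)
      then have "proj w (f s) \<in> ball (proj w x) r" using \<kappa>r by (simp add: dist_norm norm_minus_commute)
      then have nQ: "f s \<notin> Q" using r(2) by blast
      have fP: "f s \<in> P" using s f_P by blast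
      then have "f s \<in> N" using nQ unfolding Q_def by blast
      then obtain m where m: "f s = x + m *\<^sub>R d" using line[OF fP] by blast
      have "norm (m *\<^sub>R e) \<le> \<kappa> * norm e" using le by (simp add: m proj_linear e_def)
      then have "\<bar>m\<bar> \<le> \<kappa>" using e by simp
      then have "m / \<kappa> \<in> {-1..1}" using \<kappa>(1) by (auto simp: abs_le_iff divide_le_eq le_divide_eq)
      moreover have "s = \<alpha> (m / \<kappa>)" using f(3)[of s] s m \<kappa>(1) by (simp add: \<alpha>_def)
      ultimately show False using s by blast
    qed
  qed simp
  moreover have "strict_mono_on {-1..1} ((snd \<circ> f) \<circ> \<alpha>)"
    unfolding strict_mono_on_def using sd \<kappa>(1) by (auto simp: f\<alpha>)
  moreover have "strict_mono_on {-1..1} (norm \<circ> (curve (plane_diagram p0) \<circ> \<alpha>))"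
    unfolding strict_mono_on_def plane_diagram_def diagram.sel using e \<kappa>(1)
    by (auto simp: c\<alpha> abs_mult intro!: mult_strict_right_mono mult_strict_left_mono)
  ultimately show ?thesis using that by blast
qed

end


section \<open>Isotopies of 3-space and lifts\<close>

abbreviation north :: "(complex \<times> real) \<times> real" where "north \<equiv> (0, 1)"

definition unstereo :: "(complex \<times> real) \<times> real \<Rightarrow> complex \<times> real" where
  "unstereo y = (1 / (1 - snd y)) *\<^sub>R fst y"

lemma unstereo_stereo [simp]: "unstereo (stereo x) = x"
proof -
  define q where "q = 1 + (norm x)\<^sup>2"
  have q: "q > 0" by (simp add: q_def add_pos_nonneg)
  then have "1 - snd (stereo x) = 2 / q" by (simp add: stereo_def q_def[symmetric]) (simp add: q_def field_simps)
  moreover have "fst (stereo x) = (2 / q) *\<^sub>R x" by (simp add: stereo_def q_def)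
  ultimately show ?thesis using q by (simp add: unstereo_def)
qed

lemma stereo_eq_iff: "stereo x = stereo y \<longleftrightarrow> x = y"
  by (metis unstereo_stereo)

text \<open>The chordal distance to the pole, by which continuity at infinity becomes a comparison
  of norms.\<close>

lemma dist_stereo_north: "dist (stereo x) north = 2 / sqrt (1 + (norm x)\<^sup>2)"
proof -
  define r where "r = (norm x)\<^sup>2"
  have r: "1 + r > 0" by (simp add: r_def add_pos_nonneg)
  have "stereo x - north = ((2 / (1 + r)) *\<^sub>R x, - 2 / (1 + r))"
    using r by (simp add: stereo_def r_def[symmetric] field_simps)
  then have "(dist (stereo x) north)\<^sup>2 = (2 / (1 + r) * norm x)\<^sup>2 + (2 / (1 + r))\<^sup>2"
    using r by (simp add: dist_norm norm_Pair power_divide)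
  also have "\<dots> = 4 * (1 + r) / (1 + r)\<^sup>2"
    by (simp add: power_mult_distrib power_divide r_def[symmetric] add_divide_distrib distrib_left)
  also have "\<dots> = (2 / sqrt (1 + r))\<^sup>2"
  proof -
    have "4 * q / q\<^sup>2 = (2 / sqrt q)\<^sup>2" if "q > 0" for q :: real
      using that by (simp add: power_divide power2_eq_square)
    from this[OF r] show ?thesis .
  qed
  finally show ?thesis
    unfolding r_def using r[unfolded r_def] by (simp add: power2_eq_iff_nonneg)
qed

lemma stereo_neq_north: "stereo x \<noteq> north"
proof
  assume "stereo x = north"
  then have "2 / sqrt (1 + (norm x)\<^sup>2) = 0" using dist_stereo_north[of x] by simp
  moreover have "1 + (norm x)\<^sup>2 > 0" by (simp add: add_pos_nonneg)
  ultimately show False by simp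
qed

lemma S3_height: "y \<in> S3 \<Longrightarrow> y \<noteq> north \<Longrightarrow> snd y < 1"
proof -
  assume y: "y \<in> S3" "y \<noteq> north"
  have n: "(norm (fst y))\<^sup>2 + (snd y)\<^sup>2 = 1"
    using y(1) by (cases y) (simp add: norm_Pair real_sqrt_eq_1_iff)
  then have "(snd y)\<^sup>2 \<le> 1" by (metis le_add_same_cancel2 zero_le_power2)
  then have "snd y \<le> 1" by (simp add: abs_square_le_1 abs_le_iff)
  moreover have "snd y \<noteq> 1"
  proof
    assume "snd y = 1"
    then have "y = north" using n by (simp add: prod_eq_iff)
    then show False using y(2) by simp
  qed
  ultimately show ?thesis by simp
qed

lemma stereo_unstereo:
  assumes "y \<in> S3" "y \<noteq> north"
  shows "stereo (unstereo y) = y"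
proof -
  define h where "h = snd y"
  have h: "h < 1" using S3_height[OF assms] by (simp add: h_def)
  have n: "(norm (fst y))\<^sup>2 = 1 - h\<^sup>2"
    using assms(1) by (cases y) (simp add: norm_Pair real_sqrt_eq_1_iff h_def algebra_simps)
  have "(norm (unstereo y))\<^sup>2 = (1 - h\<^sup>2) / (1 - h)\<^sup>2"
    by (simp add: unstereo_def h_def[symmetric] power_mult_distrib power_divide n power_divide)
  also have "1 - h\<^sup>2 = (1 + h) * (1 - h)" by (simp add: power2_eq_square algebra_simps)
  also have "(1 + h) * (1 - h) / (1 - h)\<^sup>2 = (1 + h) / (1 - h)" using h by (simp add: power2_eq_square)
  finally have r: "(norm (unstereo y))\<^sup>2 = (1 + h) / (1 - h)" .
  have r1: "1 + (1 + h) / (1 - h) = 2 / (1 - h)" "(1 + h) / (1 - h) - 1 = 2 * h / (1 - h)"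
    using h by (simp_all add: field_simps)
  show ?thesis
    unfolding stereo_def r r1 using h
    by (simp add: prod_eq_iff unstereo_def h_def[symmetric])
qed

lemma continuous_stereo: "continuous_on A stereo"
proof -
  have "1 + (norm x)\<^sup>2 \<noteq> 0" for x :: "complex \<times> real"
    by (metis add_pos_nonneg less_irrefl zero_le_power2 zero_less_one)
  then show ?thesis unfolding stereo_def by (intro continuous_intros) auto
qed

lemma homeomorphism_stereo: "homeomorphism UNIV (S3 - {north}) stereo unstereo"
proof (rule homeomorphismI)
  show "continuous_on (S3 - {north}) unstereo"
    unfolding unstereo_def using S3_height by (intro continuous_intros) fastforce
  show "range stereo \<subseteq> S3 - {north}"
    by (intro image_subsetI DiffI stereo_in_S3) (simp add: stereo_neq_north)
  show "stereo (unstereo y) = y" if "y \<in> S3 - {north}" for y using stereo_unstereo that by blast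
qed (simp_all add: continuous_stereo)

lemma openin_stereo:
  assumes "open W"
  shows "openin (top_of_set S3) (stereo ` W)"
proof -
  have "openin (top_of_set (S3 - {north})) (stereo ` W)"
    using homeomorphism_imp_open_map[OF homeomorphism_stereo] assms by simp
  moreover have "openin (top_of_set S3) (S3 - {north})"
    by (simp add: openin_delete)
  ultimately show ?thesis by (rule openin_trans)
qed

text \<open>An isotopy of 3-space extends to the point at infinity if it moves no point too far towards
  the origin.\<close>

lemma ambient_isotopic_stereo:
  fixes H :: "real \<Rightarrow> complex \<times> real \<Rightarrow> complex \<times> real"
  assumes cont: "continuous_on ({0..1} \<times> UNIV) (\<lambda>(t, x). H t x)"
    and inv: "\<And>t x. t \<in> {0..1} \<Longrightarrow> H' t (H t x) = x" "\<And>t x. t \<in> {0..1} \<Longrightarrow> H t (H' t x) = x"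
    and H0: "\<And>x. H 0 x = x"
    and proper: "\<And>t x. t \<in> {0..1} \<Longrightarrow> norm x \<le> k * norm (H t x) + C" and k: "k > 0"
  shows "ambient_isotopic S3 (stereo ` X) (stereo ` H 1 ` X)"
proof -
  define G where "G = (\<lambda>t y. if y = north then north else stereo (H t (unstereo y)))"
  have Gs: "G t (stereo x) = stereo (H t x)" for t x
    using stereo_neq_north by (simp add: G_def)
  have "ambient_isotopy S3 G"
  proof (rule ambient_isotopy_compactI)
    show "compact S3" by simp
    let ?A = "{0..1::real} \<times> S3" and ?A' = "{0..1::real} \<times> (S3 - {north})"
    have c': "continuous_on ?A' (\<lambda>(t, y). G t y)"
    proof -
      have "continuous_on ?A' (\<lambda>q. unstereo (snd q))"
        by (rule continuous_on_compose2[of "S3 - {north}"])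
          (use homeomorphism_stereo in \<open>auto simp: homeomorphism_def intro!: continuous_intros\<close>)
      then have "continuous_on ?A' (\<lambda>q. (\<lambda>(t, x). H t x) (fst q, unstereo (snd q)))"
        by (intro continuous_on_compose2[OF cont] continuous_intros) auto
      then have "continuous_on ?A' (\<lambda>q. stereo (H (fst q) (unstereo (snd q))))"
        by (intro continuous_on_compose2[OF continuous_stereo[of UNIV]]) auto
      then show ?thesis
      proof (rule continuous_on_eq)
        fix q assume "q \<in> ?A'"
        then have "snd q \<noteq> north" by (simp only: mem_Times_iff Diff_iff singleton_iff simp_thms)
        then show "stereo (H (fst q) (unstereo (snd q))) = (case q of (t, y) \<Rightarrow> G t y)"
          unfolding G_def case_prod_beta by (rule if_not_P[symmetric])
      qed
    qed
    show "continuous_on ?A (\<lambda>(t, y). G t y)"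
      unfolding continuous_on_iff
    proof (intro ballI allI impI)
      fix p and e :: real assume p: "p \<in> ?A" and e: "0 < e"
      obtain t y where ty: "p = (t, y)" by (cases p)
      show "\<exists>d>0. \<forall>q\<in>?A. dist q p < d \<longrightarrow> dist (case q of (t, y) \<Rightarrow> G t y) (case p of (t, y) \<Rightarrow> G t y) < e"
      proof (cases "y = north")
        case False
        then have "p \<in> ?A'" using p ty by auto
        then obtain d where d: "d > 0"
          "\<forall>q\<in>?A'. dist q p < d \<longrightarrow> dist (case q of (t, y) \<Rightarrow> G t y) (case p of (t, y) \<Rightarrow> G t y) < e"
          using c' e unfolding continuous_on_iff by blast
        show ?thesis
        proof (intro exI[of _ "min d (dist north y)"] conjI ballI impI)
          fix q assume q: "q \<in> ?A" "dist q p < min d (dist north y)"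
          have "snd q \<noteq> north"
          proof
            assume "snd q = north"
            then have "dist north y \<le> dist q p" using dist_snd_le[of q p] ty by simp
            then show False using q(2) by simp
          qed
          then have "q \<in> ?A'" using q(1) by (auto simp: mem_Times_iff)
          then show "dist (case q of (t, y) \<Rightarrow> G t y) (case p of (t, y) \<Rightarrow> G t y) < e"
            using bspec[OF d(2), of q] q(2) by linarith
        qed (use d False in auto)
      next
        case True
        \<comment> \<open>If \<open>norm x\<close> exceeds \<open>B\<close>, properness gives
          \<open>norm (H u x) > 2 / e\<close>, so the image is within \<open>e\<close> of the pole.
          Points within \<open>2 / (1 + B)\<close> of the pole come from such \<open>x\<close>, as
          \<open>sqrt (1 + (norm x)\<^sup>2) \<le> 1 + norm x\<close>.\<close>
        define B where "B = k * (2 / e) + \<bar>C\<bar>"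
        have B: "B > 0" using k e by (simp add: B_def add_pos_nonneg)
        show ?thesis
        proof (intro exI[of _ "2 / (1 + B)"] conjI ballI impI)
          show "2 / (1 + B) > 0" using B by simp
          fix q assume q: "q \<in> ?A" "dist q p < 2 / (1 + B)"
          obtain u v where uv: "q = (u, v)" by (cases q)
          have v: "dist v north < 2 / (1 + B)" "u \<in> {0..1}" "v \<in> S3"
            using q dist_snd_le[of q p] True ty uv by auto
          have "dist (G u v) north < e"
          proof (cases "v = north")
            case True
            then show ?thesis using e by (simp add: G_def)
          next
            case False
            define x where "x = unstereo v"
            have vx: "v = stereo x" using stereo_unstereo[OF v(3) False] by (simp add: x_def)
            have sq: "sqrt (1 + (norm x)\<^sup>2) \<le> 1 + norm x"
              by (rule real_le_lsqrt) (auto simp: power2_eq_square algebra_simps)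
            have sp: "0 < sqrt (1 + (norm z)\<^sup>2)" for z :: "complex \<times> real" by (simp add: add_pos_nonneg)
            have "2 / sqrt (1 + (norm x)\<^sup>2) < 2 / (1 + B)" using v(1) unfolding vx dist_stereo_north .
            then have "1 + B < sqrt (1 + (norm x)\<^sup>2)"
              using B sp[of x] by (simp add: divide_less_cancel frac_less2 field_simps)
            then have "B < norm x" using sq by linarith
            also have "\<dots> \<le> k * norm (H u x) + C" by (rule proper[OF v(2)])
            finally have "k * (2 / e) < k * norm (H u x)" unfolding B_def by linarith
            then have "2 / e < norm (H u x)" using k by (simp only: mult_less_cancel_left_pos)
            also have "\<dots> \<le> sqrt (1 + (norm (H u x))\<^sup>2)" by (rule real_le_rsqrt) simp
            finally have "2 / sqrt (1 + (norm (H u x))\<^sup>2) < e"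
              using e sp[of "H u x"] by (simp add: field_simps)
            then show ?thesis unfolding vx Gs dist_stereo_north .
          qed
          then show "dist (case q of (t, y) \<Rightarrow> G t y) (case p of (t, y) \<Rightarrow> G t y) < e"
            using True by (simp add: uv ty G_def)
        qed
      qed
    qed
    fix t :: real assume t: "t \<in> {0..1}"
    show "bij_betw (G t) S3 S3"
    proof (rule bij_betw_byWitness[where f' = "\<lambda>y. if y = north then north else stereo (H' t (unstereo y))"])
      show "\<forall>y\<in>S3. (if G t y = north then north else stereo (H' t (unstereo (G t y)))) = y"
        using inv(1)[OF t] stereo_unstereo by (auto simp: G_def stereo_neq_north simp del: mem_sphere_0)
      show "\<forall>y\<in>S3. G t (if y = north then north else stereo (H' t (unstereo y))) = y"
        using inv(2)[OF t] stereo_unstereo by (auto simp: G_def stereo_neq_north simp del: mem_sphere_0)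
      show "G t ` S3 \<subseteq> S3"
        by (rule image_subsetI) (simp add: G_def norm_stereo norm_Pair)
      show "(\<lambda>y. if y = north then north else stereo (H' t (unstereo y))) ` S3 \<subseteq> S3"
        by (rule image_subsetI) (simp add: norm_stereo norm_Pair)
    qed
  next
    fix y assume "y \<in> S3"
    then show "G 0 y = y" using H0 stereo_unstereo by (auto simp: G_def simp del: mem_sphere_0)
  qed
  moreover have "G 1 ` stereo ` X = stereo ` H 1 ` X" by (simp add: image_image Gs)
  ultimately show ?thesis unfolding ambient_isotopic_def by blast
qed

lemma norm_prod_le: "norm x \<le> norm (fst x) + norm (snd x)"
  using norm_Pair_le[of "fst x" "snd x"] by simp

text \<open>Used to tilt the polygon until a chosen segment is no longer horizontal.\<close>

lemma ambient_isotopic_vertical_shear: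
  "ambient_isotopic S3 (stereo ` X) (stereo ` (\<lambda>x. (fst x, snd x + e \<bullet> fst x)) ` X)"
proof -
  define H where "H = (\<lambda>t (x :: complex \<times> real). (fst x, snd x + t * (e \<bullet> fst x)))"
  have "ambient_isotopic S3 (stereo ` X) (stereo ` H 1 ` X)"
  proof (rule ambient_isotopic_stereo[where k = "2 + norm e" and C = 0
        and H' = "\<lambda>t x. (fst x, snd x - t * (e \<bullet> fst x))"])
    show "continuous_on ({0..1} \<times> UNIV) (\<lambda>(t, x). H t x)"
      unfolding H_def case_prod_beta by (intro continuous_intros)
    fix t :: real and x :: "complex \<times> real" assume t: "t \<in> {0..1}"
    have 1: "norm (fst x) \<le> norm (H t x)" unfolding H_def by (rule norm_fst_le)
    have 2: "norm (snd x + t * (e \<bullet> fst x)) \<le> norm (H t x)" unfolding H_def by (rule norm_snd_le)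
    have "\<bar>t * (e \<bullet> fst x)\<bar> \<le> 1 * (norm e * norm (fst x))"
      unfolding abs_mult using t Cauchy_Schwarz_ineq2[of e "fst x"] by (intro mult_mono) auto
    also have "\<dots> \<le> norm e * norm (H t x)" using 1 by (simp add: mult_left_mono)
    finally have "\<bar>snd x\<bar> \<le> norm (H t x) + norm e * norm (H t x)" using 2 by simp
    then show "norm x \<le> (2 + norm e) * norm (H t x) + 0"
      using norm_prod_le[of x] 1 by (simp add: algebra_simps)
  qed (auto simp: H_def add_pos_nonneg)
  then show ?thesis by (simp add: H_def)
qed

text \<open>This shear turns the projection along \<open>(- w, 1)\<close> into the vertical one and
  moves \<open>p\<close> to the origin.\<close>

lemma ambient_isotopic_horizontal_shear:
  "ambient_isotopic S3 (stereo ` X) (stereo ` (\<lambda>x. (fst x + snd x *\<^sub>R w - p, snd x)) ` X)"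
proof -
  define H where "H = (\<lambda>t (x :: complex \<times> real). (fst x + t *\<^sub>R (snd x *\<^sub>R w - p), snd x))"
  have "ambient_isotopic S3 (stereo ` X) (stereo ` H 1 ` X)"
  proof (rule ambient_isotopic_stereo[where k = "2 + norm w" and C = "norm p"
        and H' = "\<lambda>t x. (fst x - t *\<^sub>R (snd x *\<^sub>R w - p), snd x)"])
    show "continuous_on ({0..1} \<times> UNIV) (\<lambda>(t, x). H t x)"
      unfolding H_def case_prod_beta by (intro continuous_intros)
    fix t :: real and x :: "complex \<times> real" assume t: "t \<in> {0..1}"
    have 1: "norm (snd x) \<le> norm (H t x)" unfolding H_def by (rule norm_snd_le)
    have 2: "norm (fst x + t *\<^sub>R (snd x *\<^sub>R w - p)) \<le> norm (H t x)" unfolding H_def by (rule norm_fst_le)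
    have "norm (t *\<^sub>R (snd x *\<^sub>R w - p)) \<le> 1 * (norm (snd x) * norm w + norm p)"
      unfolding norm_scaleR using t norm_triangle_ineq4[of "snd x *\<^sub>R w" p] by (intro mult_mono) auto
    also have "\<dots> \<le> norm (H t x) * norm w + norm p" using 1 by (simp add: mult_right_mono)
    finally have "norm (fst x) \<le> norm (H t x) + norm w * norm (H t x) + norm p"
      using 2 norm_triangle_ineq4[of "fst x + t *\<^sub>R (snd x *\<^sub>R w - p)" "t *\<^sub>R (snd x *\<^sub>R w - p)"]
      by (simp add: mult.commute)
    then show "norm x \<le> (2 + norm w) * norm (H t x) + norm p"
      using norm_prod_le[of x] 1 by (simp add: algebra_simps)
  qed (auto simp: H_def add_pos_nonneg)
  then show ?thesis by (simp add: H_def add_diff_eq)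
qed

text \<open>The horizontal planes at small heights are dilated and lifted, so that the knot is seen from
  the origin as it was seen from infinity.\<close>

lemma ambient_isotopic_perspective:
  assumes R: "R > 0" and X: "\<And>x. x \<in> X \<Longrightarrow> \<bar>snd x\<bar> \<le> R / 2"
  shows "ambient_isotopic S3 (stereo ` X) (stereo ` (\<lambda>x. ((1 + snd x / R) *\<^sub>R fst x, R + snd x)) ` X)"
proof -
  \<comment> \<open>Heights are clamped to keep the dilation factor at least 1/2 on all of 3-space;
    at the heights of \<open>X\<close> nothing is clamped.\<close>
  define c where "c = (\<lambda>z. max (- R / 2) (min (R / 2) z))"
  define H where "H = (\<lambda>t (x :: complex \<times> real). ((1 + t * c (snd x) / R) *\<^sub>R fst x, snd x + t * R))"
  have c: "\<bar>c z\<bar> \<le> R / 2" for z using R by (auto simp: c_def)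
  have l: "1 / 2 \<le> 1 + t * c z / R" if "t \<in> {0..1}" for t z
  proof -
    have "\<bar>t * c z\<bar> \<le> 1 * (R / 2)" unfolding abs_mult using that c by (intro mult_mono) auto
    then have "- (1 / 2) \<le> t * c z / R" using R by (simp add: le_divide_eq abs_le_iff)
    then show ?thesis by (linarith | argo)
  qed
  have "ambient_isotopic S3 (stereo ` X) (stereo ` H 1 ` X)"
  proof (rule ambient_isotopic_stereo[where k = 3 and C = R
        and H' = "\<lambda>t x. ((1 / (1 + t * c (snd x - t * R) / R)) *\<^sub>R fst x, snd x - t * R)"])
    show "continuous_on ({0..1} \<times> UNIV) (\<lambda>(t, x). H t x)"
      unfolding H_def c_def case_prod_beta using R by (intro continuous_intros) auto
    fix t :: real and x :: "complex \<times> real" assume t: "t \<in> {0..1}"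
    have ne: "1 + t * c z / R \<noteq> 0" for z
    proof
      assume eq: "1 + t * c z / R = 0"
      show False using l[OF t, of z] unfolding eq by simp
    qed
    show "((1 / (1 + t * c (snd (H t x) - t * R) / R)) *\<^sub>R fst (H t x), snd (H t x) - t * R) = x"
      using ne by (simp add: H_def)
    show "H t ((1 / (1 + t * c (snd x - t * R) / R)) *\<^sub>R fst x, snd x - t * R) = x"
      using ne by (simp add: H_def)
    have 1: "norm (snd x + t * R) \<le> norm (H t x)" unfolding H_def by (rule norm_snd_le)
    have 2: "norm ((1 + t * c (snd x) / R) *\<^sub>R fst x) \<le> norm (H t x)" unfolding H_def by (rule norm_fst_le)
    have "1 / 2 * norm (fst x) \<le> \<bar>1 + t * c (snd x) / R\<bar> * norm (fst x)"
      by (intro mult_right_mono order_trans[OF l[OF t] abs_ge_self]) simp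
    then have "norm (fst x) \<le> 2 * norm (H t x)" using 2 by simp
    moreover have "t * R \<le> R" "0 \<le> t * R" using t R by auto
    then have "\<bar>snd x\<bar> \<le> norm (H t x) + R" using 1 by (simp add: abs_le_iff)
    ultimately show "norm x \<le> 3 * norm (H t x) + R" using norm_prod_le[of x] by simp
  qed (auto simp: H_def)
  moreover have "H 1 ` X = (\<lambda>x. ((1 + snd x / R) *\<^sub>R fst x, R + snd x)) ` X"
  proof (rule image_cong[OF refl])
    fix x assume "x \<in> X"
    then have "c (snd x) = snd x" using X[of x] by (auto simp: c_def abs_le_iff)
    then show "H 1 x = ((1 + snd x / R) *\<^sub>R fst x, R + snd x)" by (simp add: H_def add.commute)
  qed
  ultimately show ?thesis by simp
qed

section \<open>The thickened plane and sphere in the 3-sphere\<close>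

lemma lift_plane: "lift UNIV plane_lift"
  unfolding lift_def
proof (intro conjI allI ballI impI)
  show "continuous_on (UNIV \<times> UNIV) (\<lambda>(p, z). plane_lift p z)"
    using continuous_stereo by (simp add: plane_lift_def case_prod_beta)
  fix U :: "complex set" and V :: "real set" assume "openin (top_of_set UNIV) U \<and> open V"
  then have "openin (top_of_set S3) (stereo ` (U \<times> V))" by (intro openin_stereo open_Times) auto
  moreover have "(\<lambda>(p, z). plane_lift p z) ` (U \<times> V) = stereo ` (U \<times> V)"
    by (simp add: plane_lift_def case_prod_beta)
  ultimately show "openin (top_of_set S3) ((\<lambda>(p, z). plane_lift p z) ` (U \<times> V))" by simp
qed (simp_all add: plane_lift_def stereo_eq_iff norm_stereo)

lemma lift_sphere: "lift S2 sphere_lift"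
  unfolding lift_def
proof (intro conjI allI ballI impI)
  show "continuous_on (S2 \<times> UNIV) (\<lambda>(p, z). sphere_lift p z)"
    unfolding sphere_lift_def case_prod_beta
    by (intro continuous_on_compose2[OF continuous_stereo[of UNIV]] continuous_intros) auto
  fix U :: "(complex \<times> real) set" and V :: "real set" assume UV: "openin (top_of_set S2) U \<and> open V"
  then obtain U' where U': "open U'" "U = S2 \<inter> U'" by (auto simp: openin_open)
  let ?N = "- {0} :: (complex \<times> real) set"
  \<comment> \<open>Polar coordinates describe the image as a preimage of open sets in the punctured
    space.\<close>
  have "(\<lambda>(p, z). exp z *\<^sub>R p) ` (U \<times> V) =
      (?N \<inter> (\<lambda>x. (1 / norm x) *\<^sub>R x) -` U') \<inter> (?N \<inter> (\<lambda>x. ln (norm x)) -` V)" (is "?L = ?R")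
  proof (intro equalityI subsetI)
    fix x assume "x \<in> ?L"
    then obtain p z where "x = exp z *\<^sub>R p" "p \<in> U'" "norm p = 1" "z \<in> V" by (auto simp: U')
    then show "x \<in> ?R" by auto
  next
    fix x assume x: "x \<in> ?R"
    then have "x = exp (ln (norm x)) *\<^sub>R ((1 / norm x) *\<^sub>R x)" by simp
    moreover have "(1 / norm x) *\<^sub>R x \<in> U" "ln (norm x) \<in> V" using x by (auto simp: U')
    ultimately show "x \<in> ?L" by (intro image_eqI[of _ _ "((1 / norm x) *\<^sub>R x, ln (norm x))"]) auto
  qed
  moreover have "open ?R"
    by (intro open_Int continuous_open_preimage continuous_intros U') (use UV in auto)
  ultimately have "openin (top_of_set S3) (stereo ` (\<lambda>(p, z). exp z *\<^sub>R p) ` (U \<times> V))"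
    by (intro openin_stereo) simp
  moreover have "(\<lambda>(p, z). sphere_lift p z) ` (U \<times> V) = stereo ` (\<lambda>(p, z). exp z *\<^sub>R p) ` (U \<times> V)"
    by (simp add: sphere_lift_def image_image case_prod_beta)
  ultimately show "openin (top_of_set S3) ((\<lambda>(p, z). sphere_lift p z) ` (U \<times> V))" by simp
next
  fix p p' :: "complex \<times> real" and z z' assume p: "p \<in> S2" "p' \<in> S2" "sphere_lift p z = sphere_lift p' z'"
  then have eq: "exp z *\<^sub>R p = exp z' *\<^sub>R p'" by (simp add: sphere_lift_def stereo_eq_iff)
  from arg_cong[OF this, of norm] have "z = z'" using p(1,2) by simp
  then show "p = p' " "z = z'" using eq by simp_all
qed (simp_all add: sphere_lift_def norm_stereo)


section \<open>Diagrams of every knot\<close>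

lemma closed_segment_image:
  assumes "linear L"
  shows "L ` (\<Union>(a, b)\<in>S. closed_segment a b) = (\<Union>(a, b)\<in>map_prod L L ` S. closed_segment a b)"
  using assms by (simp add: image_UN case_prod_beta closed_segment_linear_image)

lemma plane_base_diagram:
  assumes K: "K \<in> knot_types"
  obtains z D \<beta> \<alpha> where "height_diagram UNIV plane_lift K z D" "flat_disc UNIV D \<beta> \<alpha>"
    "strict_mono_on {-1..1} (z \<circ> \<alpha>)" "strict_mono_on {-1..1} (norm \<circ> (curve D \<circ> \<alpha>))"
proof -
  obtain P where P: "polygonal_knot P" and KP: "\<And>k. ambient_isotopic S3 (stereo ` P) k \<Longrightarrow> k \<in> K"
    using knot_types_polygonal[OF K] by metis
  obtain S where S: "finite S" "P = (\<Union>(a, b)\<in>S. closed_segment a b)" and PS: "P homeomorphic S1"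
    using P unfolding polygonal_knot_def by (elim conjE exE) (rule that)
  have hom: "S1 homeomorphic P" using PS by (rule homeomorphic_sym[THEN iffD1])
  obtain f g where hfg: "homeomorphism S1 P f g" using hom by (auto simp: homeomorphic_def)
  \<comment> \<open>Degenerate segments alone would have a finite union, whereas the circle is
    infinite.\<close>
  have "\<exists>(a, b)\<in>S. a \<noteq> b"
  proof (rule ccontr)
    assume "\<not> ?thesis"
    then have "P \<subseteq> fst ` S" unfolding S(2) by force
    then have "finite P" using S(1) finite_subset by blast
    moreover have "P = f ` S1" "inj_on f S1"
      using hfg unfolding homeomorphism_def by (metis, metis inj_on_def)
    ultimately have "finite S1" by (simp add: finite_image_iff)
    moreover have "infinite S1"
    proof
      assume "finite S1"
      then have "finite (cis ` {0..1})" by (rule finite_subset[rotated]) auto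
      moreover have "inj_on cis {0..1}"
      proof (rule inj_onI)
        fix x y :: real assume xy: "x \<in> {0..1}" "y \<in> {0..1}" "cis x = cis y"
        then have "cos x = cos y" by (metis cis.sel(1))
        moreover have "y \<le> pi" "x \<le> pi" using xy pi_gt3 by auto
        ultimately show "x = y" using cos_inj_pi[of x y] xy by simp
      qed
      ultimately have "finite {0..1::real}" by (simp add: finite_image_iff)
      then show False using infinite_Icc[of 0 "1::real"] by simp
    qed
    ultimately show False by simp
  qed
  then obtain a b where ab: "(a, b) \<in> S" "a \<noteq> b" by blast
  \<comment> \<open>A horizontal segment is tilted along its own direction; otherwise no tilt is
    required.\<close>
  obtain e where e: "snd (b - a) + e \<bullet> fst (b - a) \<noteq> 0"
  proof (cases "snd (b - a) = 0")
    case True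
    then have "fst (b - a) \<noteq> 0" using ab(2) by (metis prod_eqI right_minus_eq zero_prod_def fst_conv snd_conv)
    then show ?thesis using that[of "fst (b - a)"] True by simp
  qed (use that[of 0] in simp)
  define L where "L = (\<lambda>x :: complex \<times> real. (fst x, snd x + e \<bullet> fst x))"
  have lin: "linear L" unfolding L_def by (rule linearI) (auto simp: inner_add_right algebra_simps)
  define S' where "S' = map_prod L L ` S"
  have LP: "L ` P = (\<Union>(a, b)\<in>S'. closed_segment a b)"
    unfolding S(2) S'_def by (rule closed_segment_image[OF lin])
  have Linv: "homeomorphism P (L ` P) L (\<lambda>x. (fst x, snd x - e \<bullet> fst x))"
    by (rule homeomorphismI) (auto simp: L_def intro!: continuous_intros)
  have fg': "homeomorphism S1 (\<Union>(a, b)\<in>S'. closed_segment a b) (L \<circ> f) (g \<circ> (\<lambda>x. (fst x, snd x - e \<bullet> fst x)))"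
    unfolding LP[symmetric] by (rule homeomorphism_compose[OF hfg Linv])
  have S': "finite S'" using S(1) by (simp add: S'_def)
  then have "finite (corners S')" by (simp add: corners_def finite_crossing_points)
  then obtain w where w: "generic S' (corners S') w" using generic_exists[OF S'] by blast
  interpret generic_polygon S' w "L \<circ> f" "g \<circ> (\<lambda>x. (fst x, snd x - e \<bullet> fst x))"
    by unfold_locales (fact S' w fg')+
  have "(L a, L b) \<in> S'" using ab(1) by (force simp: S'_def)
  moreover have "snd (L a) \<noteq> snd (L b)" using e by (simp add: L_def inner_diff_right)
  ultimately obtain p0 \<beta> \<alpha> where flat: "flat_disc UNIV (plane_diagram p0) \<beta> \<alpha>"
    "strict_mono_on {-1..1} ((snd \<circ> (L \<circ> f)) \<circ> \<alpha>)"
    "strict_mono_on {-1..1} (norm \<circ> (curve (plane_diagram p0) \<circ> \<alpha>))"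
    by (rule flat_disc_exists)
  let ?z = "snd \<circ> (L \<circ> f)"
  have "height_diagram UNIV plane_lift K ?z (plane_diagram p0)"
    unfolding height_diagram_def
  proof (intro conjI ballI impI)
    show "is_diagram UNIV (plane_diagram p0)" by (rule is_diagram_plane)
    show "continuous_on S1 ?z"
      unfolding comp_def[of snd] by (intro continuous_intros f)
    show "?z t < ?z s" if "s \<in> S1" "t \<in> S1" "s \<noteq> t \<and> curve (plane_diagram p0) s = curve (plane_diagram p0) t \<and>
        s \<in> overs (plane_diagram p0)" for s t
    proof -
      have "curve (plane_diagram p0) = plane_curve p0" by (simp add: plane_diagram_def)
      then have *: "s \<noteq> t" "plane_curve p0 s = plane_curve p0 t" "s \<in> overs (plane_diagram p0)"
        using that(3) by simp_all
      show ?thesis using overs_iff[OF that(1,2) *(1,2)] *(3) by (simp add: comp_def)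
    qed
    have "(\<lambda>s. plane_lift (curve (plane_diagram p0) s) (?z s)) ` S1 =
        stereo ` (\<lambda>x. (fst x + snd x *\<^sub>R w - p0, snd x)) ` L ` P"
    proof -
      have "P = f ` S1" using hfg unfolding homeomorphism_def by simp
      then show ?thesis by (simp add: image_image plane_lift_def plane_diagram_def plane_curve_def proj_def)
    qed
    moreover have "ambient_isotopic S3 (stereo ` P) (stereo ` L ` P)"
      unfolding L_def by (rule ambient_isotopic_vertical_shear)
    then have "ambient_isotopic S3 (stereo ` P) (stereo ` (\<lambda>x. (fst x + snd x *\<^sub>R w - p0, snd x)) ` L ` P)"
      by (rule ambient_isotopic_trans[OF _ ambient_isotopic_horizontal_shear]) (use stereo_in_S3 in blast)
    ultimately show "(\<lambda>s. plane_lift (curve (plane_diagram p0) s) (?z s)) ` S1 \<in> K"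
      using KP by simp
  qed
  then show ?thesis using flat that by blast
qed

lemma transverse_at_image:
  assumes t: "transverse_at UNIV \<gamma> s t" and \<iota>: "homeomorphism UNIV O' \<iota> \<kappa>" and O: "openin (top_of_set F) O'"
  shows "transverse_at F (\<iota> \<circ> \<gamma>) s t"
proof -
  obtain U h g A B where *: "open U" "homeomorphism U (ball (0::complex) 1) h g"
    "openin (top_of_set S1) A" "s \<in> A" "\<gamma> ` A \<subseteq> U" "\<forall>a\<in>A. Im (h (\<gamma> a)) = 0"
    "openin (top_of_set S1) B" "t \<in> B" "\<gamma> ` B \<subseteq> U" "\<forall>b\<in>B. Re (h (\<gamma> b)) = 0"
    using t unfolding transverse_at_def by auto
  have \<kappa>: "\<kappa> (\<iota> x) = x" for x using \<iota> by (simp add: homeomorphism_def)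
  have "openin (top_of_set O') (\<iota> ` U)" using homeomorphism_imp_open_map[OF \<iota>, of U] *(1) by simp
  then have op: "openin (top_of_set F) (\<iota> ` U)" using O by (rule openin_trans)
  have "homeomorphism U (\<iota> ` U) \<iota> \<kappa>"
    by (rule homeomorphism_of_subsets[OF \<iota>]) auto
  then have hom: "homeomorphism (\<iota> ` U) (ball 0 1) (h \<circ> \<kappa>) (\<iota> \<circ> g)"
    by (rule homeomorphism_compose[OF homeomorphism_symD *(2)])
  show ?thesis
    unfolding transverse_at_def using * op hom \<kappa>
    by (intro exI[of _ "\<iota> ` U"] exI[of _ "h \<circ> \<kappa>"] exI[of _ "\<iota> \<circ> g"] exI[of _ A] exI[of _ B]) auto
qed

lemma is_diagram_image:
  assumes D: "is_diagram UNIV D" and \<iota>: "homeomorphism UNIV O' \<iota> \<kappa>" and O: "openin (top_of_set F) O'"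
  shows "is_diagram F (Diagram (\<iota> \<circ> curve D) (overs D))"
proof -
  have inj: "\<iota> x = \<iota> y \<longleftrightarrow> x = y" for x y using \<iota> unfolding homeomorphism_def by (metis UNIV_I)
  have dp: "double_params (\<iota> \<circ> curve D) = double_params (curve D)"
    by (simp add: double_params_def inj)
  have "continuous_on S1 (\<iota> \<circ> curve D)"
    by (rule continuous_on_compose)
      (use D \<iota> in \<open>auto simp: is_diagram_def homeomorphism_def intro: continuous_on_subset\<close>)
  moreover have "\<iota> x \<in> F" for x
    using \<iota> openin_imp_subset[OF O] unfolding homeomorphism_def by blast
  ultimately show ?thesis
    using D transverse_at_image[OF _ \<iota> O] unfolding is_diagram_def
    by (auto simp: dp inj)
qed

text \<open>After the perspective isotopy, the point over \<open>p\<close> at height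
  \<open>z\<close> lies on the ray from the centre through \<open>(p, R)\<close>. Central projection
  therefore reproduces the plane diagram on the upper hemisphere.\<close>

lemma sphere_base_diagram:
  assumes K: "K \<in> knot_types"
  obtains z D \<beta> \<alpha> where "height_diagram S2 sphere_lift K z D" "flat_disc S2 D \<beta> \<alpha>"
    "strict_mono_on {-1..1} (z \<circ> \<alpha>)"
proof -
  obtain z D \<beta> \<alpha> where D: "height_diagram UNIV plane_lift K z D" "flat_disc UNIV D \<beta> \<alpha>"
    "strict_mono_on {-1..1} (z \<circ> \<alpha>)" "strict_mono_on {-1..1} (norm \<circ> (curve D \<circ> \<alpha>))"
    using plane_base_diagram[OF K] .
  have dia: "is_diagram UNIV D" and cz: "continuous_on S1 z"
    and over: "\<And>s t. s \<in> S1 \<Longrightarrow> t \<in> S1 \<Longrightarrow> s \<noteq> t \<Longrightarrow> curve D s = curve D t \<Longrightarrow> s \<in> overs D \<Longrightarrow> z t < z s"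
    and DK: "(\<lambda>s. plane_lift (curve D s) (z s)) ` S1 \<in> K"
    using D(1) unfolding height_diagram_def by blast+
  have "compact (z ` S1)" by (rule compact_continuous_image[OF cz compact_sphere])
  then have "bounded (z ` S1)" by (rule compact_imp_bounded)
  then obtain M where "\<forall>y\<in>z ` S1. norm y \<le> M" unfolding bounded_iff by blast
  then have M: "\<bar>z s\<bar> \<le> M" if "s \<in> S1" for s using that by (metis image_eqI real_norm_def)
  \<comment> \<open>More than twice the bound on the heights: the knot lies in the slab that the
    perspective isotopy requires, and its image stays above the centre.\<close>
  define R where "R = 2 * \<bar>M\<bar> + 1"
  have R: "R > 0" by (simp add: R_def)
  have zR: "\<bar>z s\<bar> \<le> R / 2" if "s \<in> S1" for s using M[OF that] by (simp add: R_def)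
  have Rz: "R + z s > 0" if "s \<in> S1" for s using zR[OF that] R by (auto simp: abs_le_iff)
  define \<nu> where "\<nu> p = norm ((1 / R) *\<^sub>R p, 1 :: real)" for p :: complex
  \<comment> \<open>Central projection onto the sphere of the plane at height \<open>R\<close>;
    \<open>\<nu> p\<close> is the norm of \<open>(p, R)\<close> divided by \<open>R\<close>.\<close>
  define \<iota> where "\<iota> p = (1 / \<nu> p) *\<^sub>R ((1 / R) *\<^sub>R p, 1 :: real)" for p :: complex
  have \<nu>0: "\<nu> p > 0" for p by (simp add: \<nu>_def prod_eq_iff zero_prod_def)
  have \<nu>mono: "\<nu> p \<le> \<nu> q" if "norm p \<le> norm q" for p q
    unfolding \<nu>_def norm_Pair using that R by (intro real_sqrt_le_mono add_right_mono power_mono) (auto simp: divide_right_mono)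
  have c\<nu>: "continuous_on A \<nu>" for A unfolding \<nu>_def by (intro continuous_intros)
  have n\<iota>: "norm (\<iota> p) = 1" for p
    using \<nu>0[of p] unfolding \<iota>_def norm_scaleR \<nu>_def[symmetric] by simp
  define O' where "O' = S2 \<inter> {x. 0 < snd x}"
  define \<kappa> where "\<kappa> = (\<lambda>x :: complex \<times> real. (R / snd x) *\<^sub>R fst x)"
  have \<iota>: "homeomorphism UNIV O' \<iota> \<kappa>"
  proof (rule homeomorphismI)
    show "continuous_on UNIV \<iota>"
      unfolding \<iota>_def using \<nu>0 by (intro continuous_intros c\<nu>) (auto simp: less_le)
    show "continuous_on O' \<kappa>"
      unfolding \<kappa>_def by (intro continuous_intros) (auto simp: O'_def)
    show "range \<iota> \<subseteq> O'" using n\<iota> \<nu>0 by (auto simp: O'_def \<iota>_def)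
    show "\<kappa> (\<iota> p) = p" for p using R \<nu>0[of p] by (simp add: \<kappa>_def \<iota>_def)
    show "\<iota> (\<kappa> x) = x" if "x \<in> O'" for x
    proof -
      have x: "norm x = 1" "snd x > 0" using that by (auto simp: O'_def)
      have "((1 / R) *\<^sub>R \<kappa> x, 1 :: real) = (1 / snd x) *\<^sub>R x"
        using R x(2) by (simp add: \<kappa>_def prod_eq_iff)
      moreover from this have "\<nu> (\<kappa> x) = 1 / snd x" using x unfolding \<nu>_def by simp
      ultimately show ?thesis using x(2) unfolding \<iota>_def by simp
    qed
  qed simp
  have O: "openin (top_of_set S2) O'"
    unfolding O'_def by (intro openin_open_Int open_Collect_less continuous_intros)
  have inj: "\<iota> x = \<iota> y \<longleftrightarrow> x = y" for x y using \<iota> unfolding homeomorphism_def by (metis UNIV_I)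
  have c\<iota>: "continuous_on UNIV \<iota>" using \<iota> by (simp add: homeomorphism_def)
  define E where "E = Diagram (\<iota> \<circ> curve D) (overs D)"
  \<comment> \<open>The argument of the logarithm is the distance of the moved knot point from the
    centre. At a crossing both branches have the same \<open>\<nu>\<close>, so the order of heights
    is that of \<open>z\<close>.\<close>
  define y where "y s = ln ((R + z s) * \<nu> (curve D s))" for s
  have pos: "0 < (R + z s) * \<nu> (curve D s)" if "s \<in> S1" for s using Rz[OF that] \<nu>0 by simp
  have "height_diagram S2 sphere_lift K y E"
    unfolding height_diagram_def
  proof (intro conjI ballI impI)
    show "is_diagram S2 E" unfolding E_def by (rule is_diagram_image[OF dia \<iota> O])
    have "continuous_on S1 (curve D)" using dia by (simp add: is_diagram_def)
    then show "continuous_on S1 y"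
      unfolding y_def using pos by (intro continuous_intros cz continuous_on_compose2[OF c\<nu>[of UNIV]]) (auto simp: less_le)
    show "y t < y s" if "s \<in> S1" "t \<in> S1" "s \<noteq> t \<and> curve E s = curve E t \<and> s \<in> overs E" for s t
    proof -
      have "curve D s = curve D t" "z t < z s" using that over by (auto simp: E_def inj)
      then show ?thesis
        unfolding y_def using pos[OF that(1)] pos[OF that(2)] \<nu>0 by (simp add: ln_less_cancel_iff)
    qed
    let ?Q = "(\<lambda>s. (curve D s, z s)) ` S1"
    have "sphere_lift (curve E s) (y s) = stereo ((1 + z s / R) *\<^sub>R curve D s, R + z s)" if "s \<in> S1" for s
    proof -
      have "exp (y s) = (R + z s) * \<nu> (curve D s)" using pos[OF that] by (simp add: y_def)
      then have "exp (y s) *\<^sub>R \<iota> (curve D s) = (R + z s) *\<^sub>R ((1 / R) *\<^sub>R curve D s, 1)"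
        using \<nu>0[of "curve D s"] by (simp only: \<iota>_def scaleR_scaleR) simp
      also have "\<dots> = ((1 + z s / R) *\<^sub>R curve D s, R + z s)"
        using R by (simp add: add_divide_distrib)
      finally show ?thesis by (simp add: sphere_lift_def E_def)
    qed
    then have "(\<lambda>s. sphere_lift (curve E s) (y s)) ` S1 =
        stereo ` (\<lambda>x. ((1 + snd x / R) *\<^sub>R fst x, R + snd x)) ` ?Q"
      unfolding image_image by (intro image_cong) auto
    moreover have "ambient_isotopic S3 (stereo ` ?Q) (stereo ` (\<lambda>x. ((1 + snd x / R) *\<^sub>R fst x, R + snd x)) ` ?Q)"
      by (rule ambient_isotopic_perspective[OF R]) (use zR in auto)
    moreover have "stereo ` ?Q \<in> K" using DK by (simp add: plane_lift_def image_image)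
    ultimately show "(\<lambda>s. sphere_lift (curve E s) (y s)) ` S1 \<in> K"
      using knot_types_isotopic[OF K] by simp
  qed
  moreover have "flat_disc S2 E (\<iota> \<circ> \<beta>) \<alpha>"
  proof -
    have \<beta>: "continuous_on (cball 0 1) \<beta>" "inj_on \<beta> (cball 0 1)" "open (\<beta> ` ball 0 1)"
      using D(2) by (auto simp: flat_disc_def)
    have "openin (top_of_set O') (\<iota> ` \<beta> ` ball 0 1)"
      using homeomorphism_imp_open_map[OF \<iota>] \<beta>(3) by simp
    then have "openin (top_of_set S2) ((\<iota> \<circ> \<beta>) ` ball 0 1)"
      using O openin_trans unfolding image_comp by blast
    moreover have "continuous_on (cball 0 1) (\<iota> \<circ> \<beta>)"
      by (intro continuous_on_compose \<beta> continuous_on_subset[OF c\<iota>]) simp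
    moreover have "inj_on (\<iota> \<circ> \<beta>) (cball 0 1)"
      using \<beta>(2) by (simp add: inj_on_def inj)
    moreover have "(\<iota> \<circ> \<beta>) ` cball 0 1 \<subseteq> S2" using n\<iota> by auto
    moreover have "curve E s \<in> (\<iota> \<circ> \<beta>) ` cball 0 1 \<longleftrightarrow> curve D s \<in> \<beta> ` cball 0 1" for s
      by (auto simp: E_def inj image_iff)
    ultimately show ?thesis
      using D(2) unfolding flat_disc_def by (simp add: E_def)
  qed
  moreover have "strict_mono_on {-1..1} (y \<circ> \<alpha>)"
    unfolding strict_mono_on_def
  proof (intro allI impI)
    fix r s :: real assume rs: "r \<in> {-1..1} \<and> s \<in> {-1..1} \<and> r < s"
    have \<alpha>: "\<alpha> r \<in> S1" "\<alpha> s \<in> S1" using D(2) rs unfolding flat_disc_def by blast+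
    have "z (\<alpha> r) < z (\<alpha> s)" "norm (curve D (\<alpha> r)) < norm (curve D (\<alpha> s))"
      using D(3,4) rs unfolding strict_mono_on_def by auto
    \<comment> \<open>The first factor grows with the height, and the second does not decrease
      because the norm grows along the ray.\<close>
    then have "(R + z (\<alpha> r)) * \<nu> (curve D (\<alpha> r)) < (R + z (\<alpha> s)) * \<nu> (curve D (\<alpha> s))"
      using Rz[OF \<alpha>(1)] \<nu>0 \<nu>mono by (intro mult_less_le_imp_less) auto
    then show "(y \<circ> \<alpha>) r < (y \<circ> \<alpha>) s"
      unfolding y_def using pos[OF \<alpha>(1)] pos[OF \<alpha>(2)] by simp
  qed
  ultimately show ?thesis using that by blast
qed

theorem proposition4p2:
  fixes K :: "((complex \<times> real) \<times> real) set set"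
  assumes "K \<in> knot_types"
  shows "\<not> planar (plane_reidemeister_graph K) \<and> \<not> planar (sphere_reidemeister_graph K)"
proof
  obtain z D \<beta> \<alpha> where "height_diagram UNIV plane_lift K z D" "flat_disc UNIV D \<beta> \<alpha>"
    "strict_mono_on {-1..1} (z \<circ> \<alpha>)"
    using plane_base_diagram[OF assms] by metis
  then interpret nests UNIV plane_lift K z D \<beta> \<alpha>
    using lift_plane assms by unfold_locales
  show "\<not> planar (plane_reidemeister_graph K)"
    unfolding plane_reidemeister_graph_def by (rule reidemeister_graph_not_planar)
next
  obtain z D \<beta> \<alpha> where "height_diagram S2 sphere_lift K z D" "flat_disc S2 D \<beta> \<alpha>"
    "strict_mono_on {-1..1} (z \<circ> \<alpha>)"
    using sphere_base_diagram[OF assms] .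
  then interpret nests S2 sphere_lift K z D \<beta> \<alpha>
    using lift_sphere assms by unfold_locales
  show "\<not> planar (sphere_reidemeister_graph K)"
    unfolding sphere_reidemeister_graph_def by (rule reidemeister_graph_not_planar)
qed

end
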